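(* Let $D$ be a unimodular cyclotomic plan of index $n$. Let $\mathcal A$ be a family of unimodularized instances of $D$ such that the set $\{\mathrm{len}(A): A\in\mathcal A\}$ is unbounded. Then $\mathcal A$ has well regulated growth of $\mathrm{GUC}$ if and only if $D$ is both balanced and orthogonal.
   Context: An aperiodic sequence is a function $f:\mathbb Z\to\mathbb C$ with finitely many nonzero values $f_j$. For aperiodic $f,g$ and $s\in\mathbb Z$, the crosscorrelation is $C_{f,g}(s)=\sum_{j\in\mathbb Z}f_{j+s}\overline{g_j}$. A codebook is a finite set of aperiodic sequences. For a codebook $F$, $\mathrm{GUC}(F)=\max|C_{f,g}(s)|$ over all $(f,g,s)\in F\times F\times\mathbb Z$ except those of the form $(f,f,0)$, and $\mathrm{SDC}(F)=\min_{f\in F}C_{f,f}(0)$. A family $\mathcal F$ of codebooks with $\{\mathrm{SDC}(F):F\in\mathcal F\}$ unbounded has well regulated growth of $\mathrm{GUC}$ if for every real $\epsilon>0$, $\mathrm{GUC}(F)/\mathrm{SDC}(F)^{1/2+\epsilon}\to0$ as $\mathrm{SDC}(F)\to\infty$. The length of a codebook of sequences all of the same length $\ell$ (length = size of the smallest set of consecutive integers containing the support) is $\ell$. A periodic sequence of length $\ell$ is a function $g:\mathbb Z/\ell\mathbb Z\to\mathbb C$ (indices read mod $\ell$); for $r\in\mathbb Z$ its rotation $g^{(r)}$ is the aperiodic sequence with $g^{(r)}_j=g_{r+j}$ for $0\le j\le \ell-1$ and $g^{(r)}_j=0$ otherwise. For each prime $p$, $\alpha_p$ is a fixed primitive element of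 $\mathbb F_p$; for $n\mid p-1$, $\mathbb F_p^{*n}$ is the subgroup of $n$th powers in $\mathbb F_p^*$. A cyclotomic pattern of index $n$ is a function $d:\mathbb Z/n\mathbb Z\to\mathbb C$; for a prime $p\equiv1\pmod n$ the periodic sequence of length $p$ from $d$ is $f:\mathbb F_p\to\mathbb C$ with $f_0=0$ and $f_h=d_k$ whenever $h\in\alpha_p^k\mathbb F_p^{*n}$. A cyclotomic plan of index $n$ is a finite set $D$ of cyclotomic patterns of index $n$. $D$ is unimodular if every entry of every pattern has modulus $1$; balanced if every pattern has entries summing to $0$; orthogonal if distinct patterns are orthogonal in $\mathbb C^n$ with the inner product $\langle d,d'\rangle=\sum_j d_j\overline{d'_j}$. If $D$ is unimodular and $f_d$ is the periodic sequence of length $p$ from $d$, a unimodularization $\tilde f_d$ of $f_d$ agrees with $f_d$ except that $|\tilde f_{d,0}|=1$. A unimodularized $p$-instance of $D$ is a codebook $\{\tilde f_d^{(r_d)}: d\in D\}$ for some unimodularizations $\tilde f_d$ and integers $r_d$; a unimodularized instance of $D$ is a unimodularized $p$-instance for some prime $p\equiv 1\pmod n$. *)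

theory Defs
  imports "HOL-Analysis.Analysis" "HOL-Number_Theory.Number_Theory"
begin

(* Aperiodic sequences: int => complex (finite support, where relevant). *)

definition crosscorr :: "(int \<Rightarrow> complex) \<Rightarrow> (int \<Rightarrow> complex) \<Rightarrow> int \<Rightarrow> complex" where
  "crosscorr f g s = (\<Sum>j | g j \<noteq> 0. f (j + s) * cnj (g j))"

definition GUC :: "(int \<Rightarrow> complex) set \<Rightarrow> real" where
  "GUC F = Sup {cmod (crosscorr f g s) | f g s. f \<in> F \<and> g \<in> F \<and> \<not> (f = g \<and> s = 0)}"

definition SDC :: "(int \<Rightarrow> complex) set \<Rightarrow> real" where
  "SDC F = Min ((\<lambda>f. Re (crosscorr f f 0)) ` F)"

definition well_regulated_GUC :: "(int \<Rightarrow> complex) set set \<Rightarrow> bool" where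
  "well_regulated_GUC \<A> \<longleftrightarrow>
     (\<forall>M. \<exists>F\<in>\<A>. SDC F > M) \<and>
     (\<forall>\<epsilon>>0. \<forall>\<delta>>0. \<exists>M. \<forall>F\<in>\<A>. SDC F > M \<longrightarrow>
          GUC F / SDC F powr (1/2 + \<epsilon>) < \<delta>)"

definition seq_len :: "(int \<Rightarrow> complex) \<Rightarrow> nat" where
  "seq_len f = (if {j. f j \<noteq> 0} = {} then 0
                else nat (Max {j. f j \<noteq> 0} - Min {j. f j \<noteq> 0} + 1))"

definition codebook_len :: "(int \<Rightarrow> complex) set \<Rightarrow> nat" where
  "codebook_len F = (THE l. \<forall>f\<in>F. seq_len f = l)"

(* rotation g^{(r)} of a periodic sequence of length l (periodic sequences are
   modelled as l-periodic functions int => complex) *)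
definition rotation :: "nat \<Rightarrow> (int \<Rightarrow> complex) \<Rightarrow> int \<Rightarrow> (int \<Rightarrow> complex)" where
  "rotation l g r = (\<lambda>j. if 0 \<le> j \<and> j \<le> int l - 1 then g (r + j) else 0)"

(* cyclotomic pattern of index n: d : Z/nZ -> C, modelled as nat => complex
   with values at 0..n-1 and zero elsewhere *)
definition cyc_pattern :: "nat \<Rightarrow> (nat \<Rightarrow> complex) \<Rightarrow> bool" where
  "cyc_pattern n d \<longleftrightarrow> (\<forall>k\<ge>n. d k = 0)"

definition cyc_plan :: "nat \<Rightarrow> (nat \<Rightarrow> complex) set \<Rightarrow> bool" where
  "cyc_plan n D \<longleftrightarrow> finite D \<and> (\<forall>d\<in>D. cyc_pattern n d)"

definition plan_unimodular :: "nat \<Rightarrow> (nat \<Rightarrow> complex) set \<Rightarrow> bool" where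
  "plan_unimodular n D \<longleftrightarrow> (\<forall>d\<in>D. \<forall>k<n. cmod (d k) = 1)"

definition plan_balanced :: "nat \<Rightarrow> (nat \<Rightarrow> complex) set \<Rightarrow> bool" where
  "plan_balanced n D \<longleftrightarrow> (\<forall>d\<in>D. (\<Sum>k<n. d k) = 0)"

definition plan_orthogonal :: "nat \<Rightarrow> (nat \<Rightarrow> complex) set \<Rightarrow> bool" where
  "plan_orthogonal n D \<longleftrightarrow>
     (\<forall>d\<in>D. \<forall>d'\<in>D. d \<noteq> d' \<longrightarrow> (\<Sum>k<n. d k * cnj (d' k)) = 0)"

(* periodic sequence of length p from pattern d, with primitive element a of F_p:
   f_0 = 0 and f_h = d_k whenever h \<in> a^k (F_p^* )^n *)
definition cyc_seq :: "nat \<Rightarrow> nat \<Rightarrow> nat \<Rightarrow> (nat \<Rightarrow> complex) \<Rightarrow> int \<Rightarrow> complex" where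
  "cyc_seq n a p d h =
     (if [h = 0] (mod int p) then 0
      else d (THE k. k < n \<and> (\<exists>y::int. [h = int a ^ k * y ^ n] (mod int p))))"

definition unimodularization :: "nat \<Rightarrow> (int \<Rightarrow> complex) \<Rightarrow> (int \<Rightarrow> complex) \<Rightarrow> bool" where
  "unimodularization p f g \<longleftrightarrow>
     (\<forall>h. g (h + int p) = g h) \<and>
     (\<forall>h. \<not> [h = 0] (mod int p) \<longrightarrow> g h = f h) \<and>
     cmod (g 0) = 1"

(* A is a unimodularized p-instance of D (alpha p = the fixed primitive element of F_p) *)
definition unimod_p_instance ::
  "nat \<Rightarrow> (nat \<Rightarrow> nat) \<Rightarrow> (nat \<Rightarrow> complex) set \<Rightarrow> nat \<Rightarrow> (int \<Rightarrow> complex) set \<Rightarrow> bool" where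
  "unimod_p_instance n \<alpha> D p A \<longleftrightarrow>
     (\<exists>ft r. (\<forall>d\<in>D. unimodularization p (cyc_seq n (\<alpha> p) p d) (ft d)) \<and>
            A = (\<lambda>d. rotation p (ft d) (r d)) ` D)"

definition unimod_instance ::
  "nat \<Rightarrow> (nat \<Rightarrow> nat) \<Rightarrow> (nat \<Rightarrow> complex) set \<Rightarrow> (int \<Rightarrow> complex) set \<Rightarrow> bool" where
  "unimod_instance n \<alpha> D A \<longleftrightarrow>
     (\<exists>p. prime p \<and> [p = 1] (mod n) \<and> unimod_p_instance n \<alpha> D p A)"

end

theory Submission
  imports
    "HOL-Algebra.Algebraic_Closure_Type"
    "Berlekamp_Zassenhaus.Finite_Field"
    "HOL-Real_Asymp.Real_Asymp"
    Defs
begin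

text \<open>Fourier analysis on Z/nZ writes the periodic sequence of a pattern d as a combination of
  the n characters modulo p of order dividing n; the coefficient of the trivial character is the
  mean of d. At shift 0 the product of the sequence of d with the conjugate of that of d' is again
  cyclotomic, with pattern \<open>d k * cnj (d' k)\<close> and mean <d,d'>/n. Balance thus removes
  the trivial character from correlations at nonzero shifts, and orthogonality removes it at shift 0
  between distinct patterns.

  If both hold, an aperiodic correlation is, up to an error of at most 2 from the unimodularized
  entries, a bounded combination of incomplete sums of eta(x), or of conj(eta'(x)) eta(x+v), with
  nontrivial characters. Polya-Vinogradov completion (\<open>incomplete_sum_bound\<close>) reduces
  these to complete sums with an additive twist, which are O(sqrt p). So GUC is O(sqrt p log p),
  whereas SDC is p (\<open>GUC_codebook_upper\<close>). If some mean is nonzero, the trivial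
  characters give a main term of order p in a periodic correlation, at shift 1 or at shift 0.
  Periodic correlations differ little from aperiodic ones or are sums of two of them, so GUC grows
  linearly (\<open>GUC_codebook_lower_unbalanced\<close>,
  \<open>GUC_codebook_lower_nonorthogonal\<close>), which already contradicts the exponent 3/4.

  The deep ingredient is the Weil bound 2 sqrt p for K = sum of eta(x) psi(x+1) e(x)
  (\<open>weil_mixed_bound\<close>), obtained here by elementary means. Sorting the elements of
  GF(q^2) by trace and norm over GF(q) gives K_{q^2} + K_q^2 = 2 S with |S| = q, so the normalized
  sums k = |K_q| / sqrt q satisfy k' >= k^2 - 2 (\<open>mixed_sum_doubling\<close>). If k > 2 over
  GF(p), repeated doubling makes k unbounded. But Stepanov's method bounds k, far enough up the
  tower, by a constant depending on p (\<open>stepanov_count\<close>,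
  \<open>mixed_sum_lift_bound\<close>): at most q/(p (p-1)^2) + O(sqrt q) elements x of GF(q) have
  prescribed nonzero norms of x and x+1 and prescribed trace of x. The auxiliary polynomial is
  nonzero because the powers of an n-th root of a polynomial with a simple zero are independent
  (\<open>kummer_independence\<close>). A field is a type, so the bound is proved over a type of
  characteristic p and then carried to every prime by \<open>char_sum_bounds_prime\<close>.\<close>

hide_const (open) Module.smult UnivPoly.coeff UnivPoly.monom UnivPoly.deg Coset.order

section \<open>Linear systems and Kummer independence\<close>

text \<open>Gaussian elimination: each induction step removes one equation together with its pivot
  unknown. Both existence arguments below, the substitute for a norm and Stepanov's auxiliary
  polynomial, rest on it.\<close>

lemma homogeneous_system_nontrivial:
  fixes a :: "'j \<Rightarrow> 'i \<Rightarrow> 'a::field"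
  assumes "finite J" "finite I" "card J < card I"
  shows "\<exists>\<kappa>. (\<exists>i\<in>I. \<kappa> i \<noteq> 0) \<and> (\<forall>j\<in>J. (\<Sum>i\<in>I. a j i * \<kappa> i) = 0)"
  using assms
proof (induction J arbitrary: I a rule: finite_induct)
  case empty
  then obtain i where "i \<in> I" by fastforce
  then show ?case by (intro exI[of _ "\<lambda>_. 1"]) auto
next
  case (insert j J)
  show ?case
  proof (cases "\<forall>i\<in>I. a j i = 0")
    case True
    have "card J < card I" using insert by simp
    from insert.IH[OF insert.prems(1) this] obtain \<kappa>
      where "\<exists>i\<in>I. \<kappa> i \<noteq> 0" "\<forall>k\<in>J. (\<Sum>i\<in>I. a k i * \<kappa> i) = 0" by blast
    with True show ?thesis by (intro exI[of _ \<kappa>]) auto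
  next
    case False
    then obtain i0 where i0: "i0 \<in> I" "a j i0 \<noteq> 0" by blast
    define I' where "I' = I - {i0}"
    have fin: "finite I'" "card J < card I'"
      using insert i0 by (auto simp: I'_def card_Diff_singleton)
    \<comment> \<open>\<open>\<kappa>\<close> solves the remaining equations after the unknown
      \<open>i0\<close> is eliminated; the value at \<open>i0\<close> is then recovered from
      equation \<open>j\<close>.\<close>
    obtain \<kappa> where \<kappa>: "\<exists>i\<in>I'. \<kappa> i \<noteq> 0"
      "\<forall>k\<in>J. (\<Sum>i\<in>I'. (a k i - a k i0 * a j i / a j i0) * \<kappa> i) = 0"
      using insert.IH[OF fin, of "\<lambda>k i. a k i - a k i0 * a j i / a j i0"] by blast
    define \<mu> where "\<mu> = (\<lambda>i. if i = i0 then - (\<Sum>i\<in>I'. a j i * \<kappa> i) / a j i0 else \<kappa> i)"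
    have split: "(\<Sum>i\<in>I. a k i * \<mu> i) = a k i0 * \<mu> i0 + (\<Sum>i\<in>I'. a k i * \<kappa> i)" for k
      using i0 insert.prems(1) unfolding I'_def
      by (subst sum.remove[of I i0]) (auto simp: \<mu>_def intro!: sum.cong)
    have "(\<Sum>i\<in>I. a k i * \<mu> i) = 0" if "k \<in> insert j J" for k
    proof (cases "k = j")
      case True
      then show ?thesis using i0 unfolding split by (simp add: \<mu>_def)
    next
      case False
      with that have "k \<in> J" by simp
      with \<kappa>(2) have "(\<Sum>i\<in>I'. a k i * \<kappa> i) - (\<Sum>i\<in>I'. a k i0 * a j i / a j i0 * \<kappa> i) = 0"
        by (simp add: algebra_simps sum_subtractf)
      moreover have "(\<Sum>i\<in>I'. a k i0 * a j i / a j i0 * \<kappa> i) = a k i0 / a j i0 * (\<Sum>i\<in>I'. a j i * \<kappa> i)"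
        by (simp add: sum_distrib_left algebra_simps)
      ultimately show ?thesis unfolding split by (simp add: \<mu>_def field_simps)
    qed
    moreover have "\<exists>i\<in>I. \<mu> i \<noteq> 0" using \<kappa>(1) by (auto simp: \<mu>_def I'_def)
    ultimately show ?thesis by blast
  qed
qed

text \<open>Each polynomial relation of degree below \<open>N\<close> costs \<open>N\<close> linear
  equations, one per coefficient.\<close>

lemma poly_relations_nontrivial:
  fixes P :: "'c \<Rightarrow> 'i \<Rightarrow> 'a::field poly"
  assumes "finite C" "finite I" "\<And>c i. c \<in> C \<Longrightarrow> i \<in> I \<Longrightarrow> degree (P c i) < N"
    and "card C * N < card I"
  shows "\<exists>\<kappa>. (\<exists>i\<in>I. \<kappa> i \<noteq> 0) \<and> (\<forall>c\<in>C. (\<Sum>i\<in>I. smult (\<kappa> i) (P c i)) = 0)"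
proof -
  have "card (C \<times> {..<N}) < card I" using assms by simp
  from homogeneous_system_nontrivial[OF _ assms(2) this, of "\<lambda>(c,e) i. coeff (P c i) e"]
  obtain \<kappa> where \<kappa>: "\<exists>i\<in>I. \<kappa> i \<noteq> 0"
    "\<And>c e. c \<in> C \<Longrightarrow> e < N \<Longrightarrow> (\<Sum>i\<in>I. coeff (P c i) e * \<kappa> i) = 0"
    using assms(1) by fastforce
  have "(\<Sum>i\<in>I. smult (\<kappa> i) (P c i)) = 0" if c: "c \<in> C" for c
  proof (rule poly_eqI)
    fix e
    show "coeff (\<Sum>i\<in>I. smult (\<kappa> i) (P c i)) e = coeff 0 e"
    proof (cases "e < N")
      case True
      then show ?thesis using \<kappa>(2)[OF c True] by (simp add: coeff_sum mult.commute)
    next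
      case False
      then show ?thesis using assms(3)[OF c]
        by (force simp: coeff_sum intro!: sum.neutral coeff_eq_0)
    qed
  qed
  with \<kappa>(1) show ?thesis by blast
qed

lemma power_dvd_of_le_order:
  assumes "e \<le> order z f"
  shows "[:-z, 1:] ^ e dvd (f :: 'a::idom poly)"
  using assms order_1 power_le_dvd by blast

text \<open>\<open>K[z, Y]/(Y\<^sup>n - H)\<close> has no zero divisors: at a simple root of \<open>H\<close> the terms \<open>k\<^sub>i Y\<^sup>i\<close> have pairwise
  distinct valuations \<open>n v(k\<^sub>i) + i\<close>.\<close>

lemma kummer_norm_nonzero:
  fixes H H0 :: "'a::field poly" and k b :: "nat \<Rightarrow> 'a poly"
  assumes H: "H = [:-z1, 1:] * H0" "poly H0 z1 \<noteq> 0"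
    and k: "\<exists>i<n. k i \<noteq> 0" and b: "\<exists>i<n. b i \<noteq> 0"
  shows "\<exists>c<n. (\<Sum>i<n. \<Sum>j<n. if i + j = c then k i * b j
             else if i + j = c + n then H * (k i * b j) else 0) \<noteq> 0"
proof -
  \<comment> \<open>With \<open>Y ^ n = H\<close> and a simple zero of \<open>H\<close> at
    \<open>z1\<close>, \<open>Y\<close> has valuation 1/n there; \<open>w f i\<close> is n times the
    valuation of \<open>f i * Y ^ i\<close>.\<close>
  define w where "w = (\<lambda>f i. n * order z1 (f i :: 'a poly) + i)"
  have ex: "\<exists>i. i < n \<and> f i \<noteq> 0 \<and> (\<forall>i'<n. f i' \<noteq> 0 \<longrightarrow> i' \<noteq> i \<longrightarrow> w f i < w f i')"
    if ne: "\<exists>i<n. f i \<noteq> 0" for f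
  proof -
    obtain i where i: "i < n \<and> f i \<noteq> 0" "\<forall>i'. i' < n \<and> f i' \<noteq> 0 \<longrightarrow> w f i \<le> w f i'"
      using ex_has_least_nat[of "\<lambda>i. i < n \<and> f i \<noteq> 0" _ "w f"] ne by blast
    \<comment> \<open>Weights of distinct indices differ modulo \<open>n\<close>, so the minimum is
      attained only once.\<close>
    have "w f i \<noteq> w f i'" if "i' < n" "i' \<noteq> i" for i'
    proof
      assume "w f i = w f i'"
      then have "w f i mod n = w f i' mod n" by simp
      with i(1) that show False by (simp add: w_def)
    qed
    with i show ?thesis by (metis le_neq_implies_less)
  qed
  obtain i0 where i0: "i0 < n" "k i0 \<noteq> 0" "\<And>i'. i'<n \<Longrightarrow> k i' \<noteq> 0 \<Longrightarrow> i' \<noteq> i0 \<Longrightarrow> w k i0 < w k i'"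
    using ex[OF k] by blast
  obtain j0 where j0: "j0 < n" "b j0 \<noteq> 0" "\<And>i'. i'<n \<Longrightarrow> b i' \<noteq> 0 \<Longrightarrow> i' \<noteq> j0 \<Longrightarrow> w b j0 < w b i'"
    using ex[OF b] by blast
  have H0: "H \<noteq> 0" using H by (metis mult_eq_0_iff pCons_eq_0_iff poly_0 one_neq_zero)
  have ordH: "order z1 H = 1"
  proof -
    have "order z1 H = order z1 [:-z1, 1:] + order z1 H0"
      using H0 H by (metis order_mult)
    also have "order z1 H0 = 0" using H(2) order_0I by blast
    also have "order z1 [:-z1, 1:] = 1"
      using order_power_n_n[of z1 1] by simp
    finally show ?thesis by simp
  qed
  \<comment> \<open>\<open>c\<close> is the exponent of \<open>Y\<close> to which the product of the
    two minimal terms reduces; \<open>T i j\<close> is what the pair \<open>i\<close>,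
    \<open>j\<close> contributes to that exponent.\<close>
  define c where "c = (i0 + j0) mod n"
  define T where "T = (\<lambda>i j. if i + j = c then k i * b j
             else if i + j = c + n then H * (k i * b j) else 0)"
  have c: "c < n" "i0 + j0 = c \<or> i0 + j0 = c + n"
  proof -
    show "c < n" using i0 by (simp add: c_def)
    show "i0 + j0 = c \<or> i0 + j0 = c + n"
    proof (cases "i0 + j0 < n")
      case False
      then have "(i0 + j0) mod n = i0 + j0 - n" using i0 j0 by (simp add: mod_if)
      with False show ?thesis by (simp add: c_def)
    qed (simp add: c_def)
  qed
  define e where "e = order z1 (T i0 j0)"
  have T0: "T i0 j0 \<noteq> 0" using c i0 j0 H0 by (auto simp: T_def)
  have ord: "n * order z1 (T i j) + c = w k i + w b j"
    if ij: "i + j = c \<or> i + j = c + n" "k i \<noteq> 0" "b j \<noteq> 0" for i j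
  proof -
    consider "i + j = c" | "i + j = c + n" "i + j \<noteq> c" using ij(1) by blast
    then show ?thesis
    proof cases
      case 1
      have "order z1 (k i * b j) = order z1 (k i) + order z1 (b j)" using ij by (simp add: order_mult)
      with 1 show ?thesis by (auto simp: T_def w_def algebra_simps)
    next
      case 2
      have "order z1 (H * (k i * b j)) = 1 + (order z1 (k i) + order z1 (b j))"
        using ij H0 ordH by (simp add: order_mult)
      with 2 show ?thesis by (auto simp: T_def w_def algebra_simps)
    qed
  qed
  \<comment> \<open>Every other pair has strictly larger total weight. Contributing pairs all have
    weight congruent to \<open>c\<close> modulo \<open>n\<close>, so the gap amounts to at least one
    more factor at \<open>z1\<close>, and the lowest term cannot cancel.\<close>
  have big: "[:-z1, 1:] ^ Suc e dvd T i j" if "i < n" "j < n" "(i, j) \<noteq> (i0, j0)" for i j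
  proof (cases "(i + j = c \<or> i + j = c + n) \<and> k i \<noteq> 0 \<and> b j \<noteq> 0")
    case True
    have "w k i0 + w b j0 < w k i + w b j"
    proof (cases "i = i0")
      case True': True
      with that have "j \<noteq> j0" by simp
      with j0(3)[of j] that True True' show ?thesis by simp
    next
      case False
      then have "w k i0 < w k i" using i0(3) that True by blast
      moreover have "w b j0 \<le> w b j" using j0(3)[of j] that True by (cases "j = j0") auto
      ultimately show ?thesis by simp
    qed
    moreover have "n * e + c = w k i0 + w b j0" using ord[of i0 j0] c i0 j0 by (simp add: e_def)
    moreover have "n * order z1 (T i j) + c = w k i + w b j" using ord[of i j] True by blast
    ultimately have "n * e + c < n * order z1 (T i j) + c" by linarith
    then have "Suc e \<le> order z1 (T i j)" by simp
    then show ?thesis by (rule power_dvd_of_le_order)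
  next
    case False
    then have "T i j = 0" by (auto simp: T_def)
    then show ?thesis by simp
  qed
  have "(\<Sum>i<n. \<Sum>j<n. T i j) \<noteq> 0"
  proof
    assume "(\<Sum>i<n. \<Sum>j<n. T i j) = 0"
    then have "(\<Sum>(i,j)\<in>{..<n}\<times>{..<n}. T i j) = 0" by (simp add: sum.cartesian_product)
    then have "T i0 j0 + (\<Sum>(i,j)\<in>{..<n}\<times>{..<n} - {(i0,j0)}. T i j) = 0"
      using i0 j0 by (subst (asm) sum.remove[of _ "(i0,j0)"]) auto
    moreover have "[:-z1, 1:] ^ Suc e dvd (\<Sum>(i,j)\<in>{..<n}\<times>{..<n} - {(i0,j0)}. T i j)"
      by (rule dvd_sum) (use big in auto)
    ultimately have "[:-z1, 1:] ^ Suc e dvd T i0 j0"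
      by (metis add_eq_0_iff2 dvd_minus_iff)
    then show False using order_2[OF T0, of z1] unfolding e_def by simp
  qed
  then show ?thesis using c unfolding T_def by blast
qed

text \<open>In place of the norm of \<open>\<Sum> k\<^sub>j Y\<^sup>j\<close>, linear algebra yields a multiple of it that lies in \<open>K[z]\<close> and has
  degree below that of \<open>M\<close>; it is divisible by \<open>M\<close>, hence zero.\<close>

lemma kummer_independence:
  fixes H H0 W M :: "'a::field poly" and k :: "nat \<Rightarrow> 'a poly"
  assumes H: "H = [:-z1, 1:] * H0" "poly H0 z1 \<noteq> 0"
    and W: "M dvd W ^ n - H"
    and deg: "\<And>j. j < n \<Longrightarrow> degree (k j) \<le> A"
    and dvd: "M dvd (\<Sum>j<n. k j * W ^ j)"
    and M: "n * (A + degree H + 1) < degree M"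
    and j: "j < n"
  shows "k j = 0"
proof (rule ccontr)
  assume kj: "k j \<noteq> 0"
  \<comment> \<open>\<open>A'\<close> bounds the degree of the multiplier's coefficients. It is
    large enough for the \<open>n * (A' + 1)\<close> unknowns to outnumber the equations from
    \<open>n - 1\<close> relations, and small enough for the surviving coefficient to have degree
    below \<open>n * (A + degree H + 1)\<close>.\<close>
  define A' where "A' = (n - 1) * (A + degree H + 1)"
  \<comment> \<open>\<open>Q c j\<close> is the coefficient of \<open>Y ^ c\<close> in
    \<open>(\<Sum>i<n. k i * Y ^ i) * Y ^ j\<close> after reduction by
    \<open>Y ^ n = H\<close>.\<close>
  define Q where "Q = (\<lambda>c j. \<Sum>i<n. if i + j = c then k i else if i + j = c + n then H * k i else 0)"
  have degQ: "degree (Q c j) \<le> A + degree H" for c j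
    unfolding Q_def
  proof (rule degree_sum_le)
    fix i assume "i \<in> {..<n}"
    then have "degree (H * k i) \<le> A + degree H"
      using deg[of i] degree_mult_le[of H "k i"] by simp
    with \<open>i \<in> _\<close> show "degree (if i + j = c then k i else if i + j = c + n then H * k i else 0) \<le> A + degree H"
      using deg[of i] by auto
  qed simp
  let ?N = "A + degree H + A' + 1"
  have n: "n \<ge> 1" using j by simp
  have "card {1..<n} * ?N < card ({..<n} \<times> {..A'})"
  proof -
    have "(n - 1) * ?N = (n - 1) * A' + A'" by (simp add: A'_def algebra_simps)
    also have "\<dots> = n * A'" using n by (metis Suc_diff_1 add.commute less_eq_Suc_le mult_Suc One_nat_def)
    finally show ?thesis using n by simp
  qed
  moreover have "degree (monom 1 (snd je) * Q c (fst je)) < ?N" if "je \<in> {..<n} \<times> {..A'}" for c je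
    using degree_mult_le[of "monom 1 (snd je)" "Q c (fst je)"] degQ[of c "fst je"] that
      degree_monom_le[of "1::'a" "snd je"] by auto
  ultimately have "\<exists>\<kappa>. (\<exists>je\<in>{..<n} \<times> {..A'}. \<kappa> je \<noteq> (0::'a)) \<and>
    (\<forall>c\<in>{1..<n}. (\<Sum>je\<in>{..<n} \<times> {..A'}. smult (\<kappa> je) (monom 1 (snd je) * Q c (fst je))) = 0)"
    by (intro poly_relations_nontrivial) auto
  then obtain \<kappa> where \<kappa>: "\<exists>je\<in>{..<n} \<times> {..A'}. \<kappa> je \<noteq> (0::'a)"
    "\<And>c. c \<in> {1..<n} \<Longrightarrow> (\<Sum>je\<in>{..<n} \<times> {..A'}. smult (\<kappa> je) (monom 1 (snd je) * Q c (fst je))) = 0"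
    by blast
  define b where "b = (\<lambda>j. \<Sum>e\<le>A'. monom (\<kappa> (j, e)) e)"
  have coeffb: "coeff (b j) e = (if e \<le> A' then \<kappa> (j, e) else 0)" for j e
    by (simp add: b_def coeff_sum if_distrib sum.delta cong: if_cong)
  have degb: "degree (b j) \<le> A'" for j
    by (rule degree_le) (simp add: coeffb)
  have b0: "\<exists>j<n. b j \<noteq> 0"
    using \<kappa>(1) coeffb by (metis SigmaE atMost_iff coeff_0 lessThan_iff)
  \<comment> \<open>\<open>m c\<close> is the coefficient of \<open>Y ^ c\<close> in the product of
    the given sum and the multiplier; the choice of \<open>\<kappa>\<close> kills all of them except
    \<open>m 0\<close>.\<close>
  define m where "m = (\<lambda>c. \<Sum>j<n. b j * Q c j)"
  have m_eq: "m c = (\<Sum>je\<in>{..<n} \<times> {..A'}. smult (\<kappa> je) (monom 1 (snd je) * Q c (fst je)))" for c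
    by (simp add: m_def b_def sum_distrib_right sum.cartesian_product smult_monom case_prod_unfold
        flip: mult_smult_left)
  have m0: "m c = 0" if "c \<in> {1..<n}" for c
    using \<kappa>(2)[OF that] by (simp add: m_eq)
  have m_eq2: "m c = (\<Sum>i<n. \<Sum>j<n. if i + j = c then k i * b j
             else if i + j = c + n then H * (k i * b j) else 0)" for c
    unfolding m_def Q_def sum_distrib_left
    by (subst sum.swap) (auto intro!: sum.cong simp: mult_ac)
  have red: "M dvd W ^ (i + j) - (if i + j < n then W ^ (i + j) else H * W ^ (i + j - n))" for i j
  proof (cases "i + j < n")
    case False
    then have "W ^ (i + j) = W ^ n * W ^ (i + j - n)" by (simp flip: power_add)
    then have "W ^ (i + j) - H * W ^ (i + j - n) = (W ^ n - H) * W ^ (i + j - n)"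
      by (simp add: algebra_simps)
    with False W show ?thesis by simp
  qed simp
  have "M dvd (\<Sum>i<n. \<Sum>j<n. k i * b j * (W ^ (i + j) -
             (if i + j < n then W ^ (i + j) else H * W ^ (i + j - n))))"
    by (intro dvd_sum dvd_mult red)
  also have "\<dots> = (\<Sum>i<n. k i * W ^ i) * (\<Sum>j<n. b j * W ^ j) -
       (\<Sum>i<n. \<Sum>j<n. k i * b j * (if i + j < n then W ^ (i + j) else H * W ^ (i + j - n)))"
    unfolding sum_product right_diff_distrib sum_subtractf power_add by (simp add: mult_ac)
  also have "(\<Sum>i<n. \<Sum>j<n. k i * b j * (if i + j < n then W ^ (i + j) else H * W ^ (i + j - n)))
     = (\<Sum>i<n. \<Sum>j<n. \<Sum>c<n. (if i + j = c then k i * b j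
             else if i + j = c + n then H * (k i * b j) else 0) * W ^ c)"
  proof (intro sum.cong refl)
    fix i j assume ij: "i \<in> {..<n}" "j \<in> {..<n}"
    let ?t = "\<lambda>c. (if i + j = c then k i * b j
             else if i + j = c + n then H * (k i * b j) else 0) * W ^ c"
    let ?c = "if i + j < n then i + j else i + j - n"
    have "(\<Sum>c<n. ?t c) = (\<Sum>c\<in>{?c}. ?t c)"
      by (rule sum.mono_neutral_right) (use ij in auto)
    then show "k i * b j * (if i + j < n then W ^ (i + j) else H * W ^ (i + j - n)) = (\<Sum>c<n. ?t c)"
      using ij by auto
  qed
  also have "\<dots> = (\<Sum>c<n. m c * W ^ c)"
    unfolding m_eq2 sum_distrib_right
    by (subst (2) sum.swap, subst sum.swap) (rule refl)
  also have "\<dots> = m 0"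
    using n m0 by (subst sum.remove[of _ 0]) (auto intro!: sum.neutral)
  finally have "M dvd (\<Sum>i<n. k i * W ^ i) * (\<Sum>j<n. b j * W ^ j) - m 0" .
  from dvd_diff[OF dvd_mult2[OF dvd, of "\<Sum>j<n. b j * W ^ j"] this] have "M dvd m 0" by simp
  moreover have "degree (m 0) < degree M"
  proof -
    have "degree (m 0) \<le> A' + (A + degree H)"
      unfolding m_def using degQ degb
      by (intro degree_sum_le) (auto intro!: order.trans[OF degree_mult_le] add_mono)
    also have "\<dots> < n * (A + degree H + 1)"
    proof -
      have "n * (A + degree H + 1) = A' + (A + degree H + 1)"
        using n unfolding A'_def by (metis Suc_diff_1 add.commute less_eq_Suc_le mult_Suc One_nat_def)
      then show ?thesis by simp
    qed
    finally show ?thesis using M by simp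
  qed
  ultimately have "m 0 = 0" using dvd_imp_degree_le[of M "m 0"] by force
  then have "m c = 0" if "c < n" for c
    using m0[of c] that by (cases "c = 0") auto
  moreover have "\<exists>c<n. m c \<noteq> 0"
    unfolding m_eq2 using kummer_norm_nonzero[OF H _ b0, of k] kj j by blast
  ultimately show False by blast
qed

section \<open>Stepanov's auxiliary polynomial\<close>

text \<open>The exponents \<open>r \<beta> + R i\<close> are at least \<open>R\<close> apart, so the lowest nonzero block must vanish to order \<open>R\<close>
  at \<open>z0\<close>, which Kummer independence forbids since \<open>(Xp + 1)\<^bsup>R n\<^esup> (Xp + 1) \<equiv> 1\<close> modulo \<open>(z - z0)\<^sup>r\<close>.\<close>

lemma auxiliary_poly_independence:
  fixes Xp X0 H0 :: "'a::field poly" and k :: "nat \<Rightarrow> nat \<Rightarrow> nat \<Rightarrow> 'a poly"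
  assumes Xp: "Xp = [:-z0, 1:] * X0" "poly X0 z0 \<noteq> 0"
    and H: "Xp + 1 = [:-z1, 1:] * H0" "poly H0 z1 \<noteq> 0"
    and r: "r = n * R + 1" and frob: "(Xp + 1) ^ r = Xp ^ r + 1"
    and deg: "\<And>\<beta> i j. degree (k \<beta> i j) \<le> A"
    and R: "n * (A + degree (Xp + 1) + 1) < R"
    and zero: "(\<Sum>\<beta>\<le>B. \<Sum>i<n. \<Sum>j<n.
        k \<beta> i j * ([:-z0, 1:] ^ (r * \<beta>) * Xp ^ (R * i) * (Xp + 1) ^ (R * j))) = 0"
    and ind: "\<beta> \<le> B" "i < n" "j < n"
  shows "k \<beta> i j = 0"
proof (rule ccontr)
  assume ne: "k \<beta> i j \<noteq> 0"
  define H where "H = Xp + 1"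
  define \<pi> where "\<pi> = [:-z0, 1:]"
  \<comment> \<open>\<open>pos\<close> is the order at \<open>z0\<close> forced by the explicit
    powers, \<open>Xp\<close> having a simple zero there; \<open>\<sigma>\<close> gathers the factor
    with the powers of \<open>Xp + 1\<close>.\<close>
  define pos where "pos = (\<lambda>(\<beta>, i). r * \<beta> + R * i)"
  define \<sigma> where "\<sigma> = (\<lambda>(\<beta>, i). \<Sum>j<n. k \<beta> i j * H ^ (R * j))"
  define S where "S = {..B} \<times> {..<n}"
  have R1: "R \<ge> 1" using R by simp
  obtain s where s: "s \<in> S" "\<exists>j<n. k (fst s) (snd s) j \<noteq> 0"
    and smin: "\<And>s'. s' \<in> S \<Longrightarrow> \<exists>j<n. k (fst s') (snd s') j \<noteq> 0 \<Longrightarrow> pos s \<le> pos s'"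
  proof -
    have "(\<beta>, i) \<in> S \<and> (\<exists>j<n. k (fst (\<beta>, i)) (snd (\<beta>, i)) j \<noteq> 0)"
      using ne ind by (auto simp: S_def)
    from ex_has_least_nat[of "\<lambda>s. s \<in> S \<and> (\<exists>j<n. k (fst s) (snd s) j \<noteq> 0)", OF this, of pos]
    show ?thesis using that by blast
  qed
  obtain b a where ba: "s = (b, a)" by (cases s)
  have gap: "pos s + R \<le> pos s'" if s': "s' \<in> S" "s' \<noteq> s" "pos s \<le> pos s'" for s'
  proof -
    obtain b' a' where s'eq: "s' = (b', a')" by (cases s')
    have an: "a < n" "a' < n" using s s' by (auto simp: S_def ba s'eq)
    have le: "r * b + R * a \<le> r * b' + R * a'" using s' by (simp add: pos_def ba s'eq)
    consider "b' < b" | "b' = b" | "b < b'" by linarith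
    then show ?thesis
    proof cases
      case 1
      have "R * a' \<le> R * n" using an by simp
      then have "R * a' < r" using r mult.commute[of n R] by linarith
      moreover have "r * b' + r \<le> r * b" using 1 mult_le_mono2[of "Suc b'" b r] by simp
      ultimately show ?thesis using le by simp
    next
      case 2
      then have "R * a \<le> R * a'" "a \<noteq> a'" using le s' by (auto simp: ba s'eq)
      with R1 have "a < a'" by simp
      then have "R * Suc a \<le> R * a'" by (intro mult_le_mono2) simp
      with 2 show ?thesis by (simp add: pos_def ba s'eq)
    next
      case 3
      have "R * Suc a \<le> R * n" using an by (intro mult_le_mono2) simp
      then have "R * a + R \<le> r" using r by (simp add: mult.commute)
      moreover have "r * b + r \<le> r * b'" using 3 mult_le_mono2[of "Suc b" b' r] by simp
      ultimately show ?thesis by (simp add: pos_def ba s'eq)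
    qed
  qed
  define G where "G = (\<lambda>(\<beta>, i). \<pi> ^ (r * \<beta>) * Xp ^ (R * i) * \<sigma> (\<beta>, i))"
  have G_eq: "G t = \<pi> ^ pos t * X0 ^ (R * snd t) * \<sigma> t" for t
    by (cases t) (simp add: G_def pos_def Xp(1) power_mult_distrib power_add \<pi>_def[symmetric] mult_ac)
  have "(\<Sum>\<beta>\<le>B. \<Sum>i<n. \<Sum>j<n. k \<beta> i j * (\<pi> ^ (r * \<beta>) * Xp ^ (R * i) * H ^ (R * j)))
      = (\<Sum>t\<in>S. G t)"
    by (simp add: S_def G_def \<sigma>_def sum.cartesian_product[symmetric] sum_distrib_left mult_ac)
  with zero have "(\<Sum>t\<in>S. G t) = 0" by (simp add: \<pi>_def H_def)
  then have "G s + (\<Sum>t\<in>S - {s}. G t) = 0"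
    using s by (subst (asm) sum.remove[of S s]) (auto simp: S_def)
  moreover have "\<pi> ^ (pos s + R) dvd (\<Sum>t\<in>S - {s}. G t)"
  proof (rule dvd_sum)
    fix t assume t: "t \<in> S - {s}"
    show "\<pi> ^ (pos s + R) dvd G t"
    proof (cases "\<exists>j<n. k (fst t) (snd t) j \<noteq> 0")
      case True
      then have "pos s + R \<le> pos t" using gap smin t by auto
      then show ?thesis unfolding G_eq by (simp add: dvd_mult2 le_imp_power_dvd)
    next
      case False
      then have "\<sigma> t = 0" by (auto simp: \<sigma>_def case_prod_unfold)
      then show ?thesis by (simp add: G_eq)
    qed
  qed
  ultimately have "\<pi> ^ (pos s + R) dvd G s"
    by (metis add_eq_0_iff2 dvd_minus_iff)
  then have "\<pi> ^ pos s * \<pi> ^ R dvd \<pi> ^ pos s * (X0 ^ (R * a) * \<sigma> s)"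
    by (simp add: G_eq ba power_add mult_ac)
  moreover have pi0: "\<pi> ^ pos s \<noteq> 0" by (simp add: \<pi>_def)
  ultimately have dv: "\<pi> ^ R dvd X0 ^ (R * a) * \<sigma> s" by (simp only: dvd_mult_cancel_left) simp
  have "\<pi> ^ R dvd \<sigma> s"
  proof (cases "\<sigma> s = 0")
    case False
    have "X0 \<noteq> 0" using Xp(2) by auto
    then have X00: "X0 ^ (R * a) \<noteq> 0" by simp
    have "order z0 (X0 ^ (R * a)) = 0" using Xp(2) by (intro order_0I) simp
    moreover have "R \<le> order z0 (X0 ^ (R * a) * \<sigma> s)"
      using dv False \<open>X0 \<noteq> 0\<close> order_divides[of z0 R "X0 ^ (R * a) * \<sigma> s"] unfolding \<pi>_def by simp
    ultimately have "R \<le> order z0 (\<sigma> s)" using False X00 by (simp add: order_mult)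
    then show ?thesis unfolding \<pi>_def by (rule power_dvd_of_le_order)
  qed simp
  \<comment> \<open>Modulo \<open>\<pi> ^ R\<close> one has \<open>H ^ r = 1\<close>; there
    \<open>W\<close> is an n-th root of \<open>H\<close>, and \<open>H ^ R\<close> is the inverse of
    \<open>W\<close>. Multiplying \<open>\<sigma> s\<close> by \<open>W ^ (n - 1)\<close> therefore
    turns the powers of \<open>H ^ R\<close> into powers of \<open>W\<close>.\<close>
  define W where "W = H ^ (R * (n - 1)) * H"
  have n: "n \<ge> 1" using ind by simp
  have one: "\<pi> ^ R dvd H ^ r - 1"
  proof -
    have "H ^ r - 1 = Xp ^ r" by (simp add: H_def frob)
    moreover have "R \<le> r" using r mult_le_mono1[OF n, of R] by linarith
    ultimately show ?thesis
      by (simp add: Xp(1) \<pi>_def[symmetric] power_mult_distrib le_imp_power_dvd dvd_mult2)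
  qed
  have one_power: "\<pi> ^ R dvd (H ^ r) ^ e - 1" for e
    using one by (rule dvd_trans) (simp add: power_diff_1_eq)
  have "W ^ n = H * (H ^ r) ^ (n - 1)"
  proof -
    have "(R * (n - 1) + 1) * n = 1 + r * (n - 1)"
      using n r by (cases n) (auto simp: algebra_simps)
    moreover have "W = H ^ (R * (n - 1) + 1)" by (simp add: W_def)
    then have "W ^ n = H ^ ((R * (n - 1) + 1) * n)" by (simp only: power_mult)
    ultimately show ?thesis by (simp add: power_add power_mult)
  qed
  then have Wn: "\<pi> ^ R dvd W ^ n - H"
    using dvd_mult[OF one_power[of "n - 1"], of H] by (simp add: right_diff_distrib)
  have WH: "W * H ^ R = H ^ r"
  proof -
    have "R * (n - 1) + 1 + R = r" using n r by (cases n) (auto simp: algebra_simps)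
    then have "H ^ (R * (n - 1) + 1 + R) = H ^ r" by (rule arg_cong)
    then show ?thesis by (simp add: W_def power_add mult_ac)
  qed
  have "\<pi> ^ R dvd (\<Sum>j<n. k b a j * W ^ (n - 1 - j) * ((H ^ r) ^ j - 1))"
    by (intro dvd_sum dvd_mult one_power)
  also have "(\<Sum>j<n. k b a j * W ^ (n - 1 - j) * ((H ^ r) ^ j - 1))
     = W ^ (n - 1) * \<sigma> s - (\<Sum>j<n. k b a j * W ^ (n - 1 - j))"
  proof -
    have "W ^ (n - 1 - j) * (H ^ r) ^ j = W ^ (n - 1) * H ^ (R * j)" if "j < n" for j
    proof -
      have "W ^ (n - 1 - j) * (H ^ r) ^ j = W ^ (n - 1 - j) * W ^ j * H ^ (R * j)"
        by (simp flip: WH add: power_mult_distrib power_mult)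
      also have "W ^ (n - 1 - j) * W ^ j = W ^ (n - 1)"
        using that by (simp flip: power_add)
      finally show ?thesis .
    qed
    then have "(\<Sum>j<n. k b a j * (W ^ (n - 1 - j) * (H ^ r) ^ j)) = W ^ (n - 1) * \<sigma> s"
      by (simp add: \<sigma>_def ba sum_distrib_left mult_ac)
    then show ?thesis by (simp add: right_diff_distrib sum_subtractf mult.assoc)
  qed
  finally have "\<pi> ^ R dvd W ^ (n - 1) * \<sigma> s - (\<Sum>j<n. k b a j * W ^ (n - 1 - j))" .
  from dvd_diff[OF dvd_mult[OF \<open>\<pi> ^ R dvd \<sigma> s\<close>, of "W ^ (n - 1)"] this]
  have "\<pi> ^ R dvd (\<Sum>j<n. k b a j * W ^ (n - 1 - j))" by simp
  also have "(\<Sum>j<n. k b a j * W ^ (n - 1 - j)) = (\<Sum>j<n. k b a (n - 1 - j) * W ^ j)"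
    by (rule sum.reindex_bij_witness[of _ "\<lambda>j. n - 1 - j" "\<lambda>j. n - 1 - j"]) auto
  finally have dvds: "\<pi> ^ R dvd (\<Sum>j<n. k b a (n - 1 - j) * W ^ j)" .
  have "degree (\<pi> ^ R) = R" by (simp add: \<pi>_def degree_power_eq)
  then have "k b a (n - 1 - j) = 0" if "j < n" for j
    using kummer_independence[OF H[folded H_def] Wn _ dvds _ that, of A] R deg by (simp add: H_def)
  then have k0: "k b a (n - Suc j) = 0" if "j < n" for j using that by simp
  have "k b a j = 0" if "j < n" for j
  proof -
    have "n - Suc (n - Suc j) = j" "n - Suc j < n" using that by simp_all
    then show ?thesis using k0[of "n - Suc j"] by simp
  qed
  with s(2) show False by (auto simp: ba)
qed

text \<open>On the counted points \<open>u = Xp\<^sup>R\<close> and \<open>v = (Xp + 1)\<^sup>R\<close> satisfy \<open>u\<^sup>r = a / u\<close> and \<open>v\<^sup>r = b / v\<close>, so there \<open>F\<^sup>r (u v)\<^bsup>n - 1\<^esup>\<close>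
  agrees with a polynomial of much smaller degree than \<open>F\<^sup>r\<close>. Its coefficients can be made to vanish
  while \<open>F \<noteq> 0\<close>.\<close>

lemma stepanov_count:
  fixes x0 a b :: "'a::alg_closed_field"
  assumes p: "CHAR('a) = p" "prime p" and r: "r = p ^ s" "r = n * R + 1"
    and q: "q = r * r" and Q: "Q = R * (r + 1)" and ab: "a \<noteq> 0" "b \<noteq> 0"
    and R: "n * (A + p + 1) < R"
    and cnt: "r * A + B + 2 * ((n - 1) * (p * R)) + 1 < (A + 1) * (B + 1) * (n * n)"
  defines "Xp \<equiv> monom 1 p - [:0, 1:] + [:x0:]"
  shows "card {z. z ^ q = z \<and> poly Xp z ^ Q = a \<and> (poly Xp z + 1) ^ Q = b}
       \<le> A + r * B + 2 * ((n - 1) * (p * R))"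
proof -
  have p2: "p \<ge> 2" using p prime_ge_2_nat by simp
  have pow: "(f + g) ^ r = f ^ r + g ^ r" for f g :: "'a poly"
    using freshmans_dream'[where 'a = "'a poly", of r s] p r(1) by simp
  have powK: "(f + g) ^ r = f ^ r + g ^ r" for f g :: 'a
    using freshmans_dream'[where 'a = "'a", of r s] p r(1) by simp
  have powq: "(f - g) ^ r = f ^ r - g ^ r" for f g :: 'a
    using powK[of "f - g" g] by simp
  have sumr: "(\<Sum>i\<in>I. f i) ^ r = (\<Sum>i\<in>I. f i ^ r)" for f :: "'i \<Rightarrow> 'a" and I
    using freshmans_dream_sum'[where 'a = "'a", of r s] p r(1) by simp
  have powp: "(f + g) ^ p = f ^ p + g ^ p" for f g :: "'a poly"
    by (rule freshmans_dream) (simp_all add: p)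
  have r1: "r \<ge> 1" using r by simp
  \<comment> \<open>An Artin-Schreier polynomial has derivative -1 and hence only simple zeros;
    around a zero it equals \<open>\<pi> ^ p - \<pi>\<close>.\<close>
  have factor: "\<exists>z Y0. Y = [:-z, 1:] * Y0 \<and> poly Y0 z \<noteq> 0"
    if Y: "Y = monom 1 p - [:0, 1:] + [:y:]" for Y :: "'a poly" and y
  proof -
    have "coeff Y p = 1" using p2 by (simp add: Y coeff_pCons split: nat.split)
    then have "degree Y > 0" using p2 le_degree[of Y p] by simp
    then obtain z where z: "poly Y z = 0" using alg_closed_imp_poly_has_root by blast
    define \<pi> where "\<pi> = [:-z, 1:]"
    have y: "y = z - z ^ p" using z by (simp add: Y poly_monom algebra_simps)
    have "\<pi> ^ p + [:z:] ^ p = ([:0, 1:]) ^ p" by (simp flip: powp add: \<pi>_def)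
    then have "\<pi> ^ p = monom 1 p - [:z ^ p:]"
      by (simp add: monom_altdef algebra_simps poly_const_pow)
    moreover have "Y = monom 1 p - [:z ^ p:] - \<pi>"
      by (rule poly_eqI) (simp add: Y y \<pi>_def coeff_pCons split: nat.split)
    ultimately have "Y = \<pi> ^ p - \<pi>" by simp
    also have "\<dots> = \<pi> * (\<pi> ^ (p - 1) - 1)"
      using p2 by (cases p) (auto simp: algebra_simps)
    finally show ?thesis
      using p2 by (intro exI[of _ z] exI[of _ "\<pi> ^ (p - 1) - 1"]) (auto simp: \<pi>_def power_0_left)
  qed
  obtain z0 X0 where Xp: "Xp = [:-z0, 1:] * X0" "poly X0 z0 \<noteq> 0"
    using factor[of Xp x0] by (auto simp: Xp_def)
  obtain z1 H0 where H: "Xp + 1 = [:-z1, 1:] * H0" "poly H0 z1 \<noteq> 0"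
    using factor[of "Xp + 1" "x0 + 1"] by (auto simp: Xp_def one_pCons algebra_simps)
  have degX: "degree Xp \<le> p"
    unfolding Xp_def using p2
    by (intro degree_add_le degree_diff_le) (auto intro: degree_monom_le)
  have degH: "degree (Xp + 1) \<le> p" using degX by (intro degree_add_le) auto
  define I where "I = {..B} \<times> {..<n} \<times> {..<n} \<times> {..A}"
  \<comment> \<open>Up to its coefficient, \<open>g t\<close> is what the r-th power of the term
    \<open>t\<close> of \<open>F\<close>, times \<open>(u * v) ^ (n - 1)\<close>, becomes on the
    counted points. The high powers collapse: \<open>(z - z0) ^ (r * r * \<beta>)\<close>, for
    instance, to \<open>(z - z0 ^ q) ^ \<beta>\<close>.\<close>
  define g where "g = (\<lambda>(\<beta>, i, j, e). smult (a ^ i * b ^ j)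
      (monom 1 (r * e) * [:- (z0 ^ q), 1:] ^ \<beta> * Xp ^ (R * (n - 1 - i)) * (Xp + 1) ^ (R * (n - 1 - j))))"
  have pw: "degree (Y ^ (R * (n - 1 - i))) \<le> (n - 1) * (p * R)" if "degree Y \<le> p" for Y :: "'a poly" and i
  proof -
    have "degree (Y ^ (R * (n - 1 - i))) \<le> degree Y * (R * (n - 1 - i))" by (rule degree_power_le)
    also have "\<dots> \<le> p * (R * (n - 1))" using that by (intro mult_le_mono) auto
    finally show ?thesis by (simp add: mult_ac)
  qed
  have pw2: "degree (Y ^ (R * i)) \<le> (n - 1) * (p * R)" if "degree Y \<le> p" "i < n" for Y :: "'a poly" and i
  proof -
    have "degree (Y ^ (R * i)) \<le> degree Y * (R * i)" by (rule degree_power_le)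
    also have "\<dots> \<le> p * (R * (n - 1))" using that by (intro mult_le_mono) auto
    finally show ?thesis by (simp add: mult_ac)
  qed
  have degg: "degree (g t) < r * A + B + 2 * ((n - 1) * (p * R)) + 1" if "t \<in> I" for t
  proof -
    obtain \<beta> i j e where t: "t = (\<beta>, i, j, e)" by (cases t)
    have "degree (g t) \<le> degree (monom (1::'a) (r * e)) + degree ([:- (z0 ^ q), 1:] ^ \<beta>)
        + degree (Xp ^ (R * (n - 1 - i))) + degree ((Xp + 1) ^ (R * (n - 1 - j)))"
      unfolding g_def t prod.case
      by (intro order.trans[OF degree_smult_le] order.trans[OF degree_mult_le] add_mono order.refl)
    moreover have "degree (monom (1::'a) (r * e)) \<le> r * A"
      using that by (auto simp: degree_monom_eq I_def t)
    moreover have "degree ([:- (z0 ^ q), 1:] ^ \<beta>) \<le> B"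
      using that by (auto simp: degree_power_eq I_def t)
    ultimately show ?thesis using pw[OF degX, of i] pw[OF degH, of j] by linarith
  qed
  have cardI: "card I = (A + 1) * (B + 1) * (n * n)"
    by (simp add: I_def card_cartesian_product algebra_simps)
  \<comment> \<open>By \<open>cnt\<close> the unknowns outnumber the coefficients of the reduced
    polynomial, so a nonzero choice makes it vanish identically.\<close>
  have "\<exists>\<kappa>. (\<exists>t\<in>I. \<kappa> t \<noteq> 0) \<and> (\<forall>c\<in>{()}. (\<Sum>t\<in>I. smult (\<kappa> t) (g t)) = 0)"
  proof (rule poly_relations_nontrivial)
    show "card {()} * (r * A + B + 2 * ((n - 1) * (p * R)) + 1) < card I"
      using cnt by (simp only: cardI card.empty card.insert finite.emptyI) simp
    show "finite I" by (simp add: I_def)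
  qed (use degg in simp_all)
  then obtain \<kappa> where \<kappa>: "\<exists>t\<in>I. \<kappa> t \<noteq> 0" "(\<Sum>t\<in>I. smult (\<kappa> t) (g t)) = 0" by blast
  \<comment> \<open>The system is linear in the r-th powers of the coefficients of \<open>F\<close>,
    because \<open>r\<close> is a power of the characteristic; algebraic closedness supplies the
    coefficients themselves.\<close>
  have "\<exists>y. y ^ r = \<kappa> t" for t by (rule nth_root_exists) (use r1 in simp)
  then obtain \<mu> where \<mu>: "\<And>t. \<mu> t ^ r = \<kappa> t" by metis
  define k where "k = (\<lambda>\<beta> i j. \<Sum>e\<le>A. monom (\<mu> (\<beta>, i, j, e)) e)"
  have coeffk: "coeff (k \<beta> i j) e = (if e \<le> A then \<mu> (\<beta>, i, j, e) else 0)" for \<beta> i j e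
    by (simp add: k_def coeff_sum if_distrib sum.delta cong: if_cong)
  have degk: "degree (k \<beta> i j) \<le> A" for \<beta> i j
    by (rule degree_le) (simp add: coeffk)
  define F where "F = (\<Sum>\<beta>\<le>B. \<Sum>i<n. \<Sum>j<n.
        k \<beta> i j * ([:-z0, 1:] ^ (r * \<beta>) * Xp ^ (R * i) * (Xp + 1) ^ (R * j)))"
  have F0: "F \<noteq> 0"
  proof
    assume "F = 0"
    have "n * (A + degree (Xp + 1) + 1) < R"
      using R degH by (meson add_le_mono le_less_trans mult_le_mono2 order.refl)
    with \<open>F = 0\<close> have k0: "k \<beta> i j = 0" if "\<beta> \<le> B" "i < n" "j < n" for \<beta> i j
      using auxiliary_poly_independence[OF Xp H r(2) _ degk _ _ that] pow[of Xp 1] by (simp add: F_def)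
    have "\<mu> t = 0" if "t \<in> I" for t
    proof -
      obtain \<beta> i j e where t: "t = (\<beta>, i, j, e)" by (cases t)
      then show ?thesis using that k0[of \<beta> i j] coeffk[of \<beta> i j e]
        by (simp add: I_def)
    qed
    moreover obtain t where "t \<in> I" "\<kappa> t \<noteq> 0" using \<kappa>(1) by blast
    ultimately show False using \<mu>[of t] r1 by (simp add: power_0_left)
  qed
  have degF: "degree F \<le> A + r * B + 2 * ((n - 1) * (p * R))"
    unfolding F_def
  proof (intro degree_sum_le)
    fix \<beta> i j assume as: "\<beta> \<in> {..B}" "i \<in> {..<n}" "j \<in> {..<n}"
    have "degree (k \<beta> i j * ([:-z0, 1:] ^ (r * \<beta>) * Xp ^ (R * i) * (Xp + 1) ^ (R * j)))
       \<le> degree (k \<beta> i j) + (degree ([:-z0, 1:] ^ (r * \<beta>)) + degree (Xp ^ (R * i)) + degree ((Xp + 1) ^ (R * j)))"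
      by (intro order.trans[OF degree_mult_le] add_mono order.refl)
    moreover have "degree ([:-z0, 1:] ^ (r * \<beta>)) \<le> r * B"
      using as by (auto simp: degree_power_eq)
    ultimately show "degree (k \<beta> i j * ([:-z0, 1:] ^ (r * \<beta>) * Xp ^ (R * i) * (Xp + 1) ^ (R * j)))
       \<le> A + r * B + 2 * ((n - 1) * (p * R))"
      using pw2[OF degX, of i] pw2[OF degH, of j] degk[of \<beta> i j] as by simp
  qed auto
  have root: "poly F z = 0"
    if z: "z ^ q = z" "poly Xp z ^ Q = a" "(poly Xp z + 1) ^ Q = b" for z
  proof -
    define u v where "u = poly Xp z ^ R" and "v = (poly Xp z + 1) ^ R"
    have u: "u * u ^ r = a" and v: "v * v ^ r = b"
      using z(2,3) by (simp_all add: u_def v_def Q power_mult power_add)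
    have uv0: "u \<noteq> 0" "v \<noteq> 0" using u v ab by auto
    have z0q: "(z - z0) ^ (r * r) = z - z0 ^ q"
      by (simp only: power_mult powq) (simp add: q[symmetric] z flip: power_mult)
    have eF: "poly F z = (\<Sum>(\<beta>, i, j, e)\<in>I. \<mu> (\<beta>, i, j, e) * (z ^ e * (z - z0) ^ (r * \<beta>) * u ^ i * v ^ j))"
      unfolding F_def k_def I_def
      by (simp add: poly_sum poly_monom u_def v_def sum_distrib_right sum_distrib_left
          sum.cartesian_product[symmetric] mult_ac flip: power_mult)
    have "poly F z ^ r * (u ^ (n - 1) * v ^ (n - 1)) = (\<Sum>t\<in>I. \<kappa> t * poly (g t) z)"
      unfolding eF sumr sum_distrib_right
    proof (rule sum.cong[OF refl])
      fix t assume "t \<in> I"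
      then obtain \<beta> i j e where t: "t = (\<beta>, i, j, e)" "i < n" "j < n" by (auto simp: I_def)
      have 1: "u ^ (i * r) * u ^ (n - 1) = a ^ i * u ^ (n - 1 - i)"
      proof -
        have "u ^ (n - 1) = u ^ i * u ^ (n - 1 - i)" using t by (simp flip: power_add)
        then have "u ^ (i * r) * u ^ (n - 1) = (u * u ^ r) ^ i * u ^ (n - 1 - i)"
          by (simp add: power_mult_distrib mult_ac flip: power_mult)
        then show ?thesis by (simp add: u)
      qed
      have 2: "v ^ (j * r) * v ^ (n - 1) = b ^ j * v ^ (n - 1 - j)"
      proof -
        have "v ^ (n - 1) = v ^ j * v ^ (n - 1 - j)" using t by (simp flip: power_add)
        then have "v ^ (j * r) * v ^ (n - 1) = (v * v ^ r) ^ j * v ^ (n - 1 - j)"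
          by (simp add: power_mult_distrib mult_ac flip: power_mult)
        then show ?thesis by (simp add: v)
      qed
      have 3: "(z - z0) ^ (r * \<beta> * r) = (z - z0 ^ q) ^ \<beta>"
        by (simp add: z0q[symmetric] mult_ac flip: power_mult)
      have "(case t of (\<beta>, i, j, e) \<Rightarrow> \<mu> (\<beta>, i, j, e) * (z ^ e * (z - z0) ^ (r * \<beta>) * u ^ i * v ^ j)) ^ r
          * (u ^ (n - 1) * v ^ (n - 1))
         = \<kappa> t * (z ^ (r * e) * (z - z0) ^ (r * \<beta> * r) * (u ^ (i * r) * u ^ (n - 1)) * (v ^ (j * r) * v ^ (n - 1)))"
        by (simp add: t \<mu>[symmetric] power_mult_distrib mult_ac flip: power_mult)
      also have "\<dots> = \<kappa> t * poly (g t) z"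
        unfolding 1 2 3 by (simp add: t g_def poly_monom u_def v_def power_mult mult_ac)
      finally show "(case t of (\<beta>, i, j, e) \<Rightarrow> \<mu> (\<beta>, i, j, e) * (z ^ e * (z - z0) ^ (r * \<beta>) * u ^ i * v ^ j)) ^ r
          * (u ^ (n - 1) * v ^ (n - 1)) = \<kappa> t * poly (g t) z" .
    qed
    also have "\<dots> = poly (\<Sum>t\<in>I. smult (\<kappa> t) (g t)) z" by (simp add: poly_sum)
    also have "\<dots> = 0" by (simp add: \<kappa>(2))
    finally show ?thesis using uv0 by simp
  qed
  have "card {z. z ^ q = z \<and> poly Xp z ^ Q = a \<and> (poly Xp z + 1) ^ Q = b} \<le> card {z. poly F z = 0}"
    using root poly_roots_finite[OF F0] by (intro card_mono) auto
  also have "\<dots> \<le> degree F" by (rule card_poly_roots_bound[OF F0])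
  finally show ?thesis using degF by simp
qed

section \<open>Finite subfields of an algebraically closed field\<close>

text \<open>For \<open>q\<close> a positive power of the characteristic and an algebraically closed
  type, this is the subfield with \<open>q\<close> elements. All extensions thus live inside one
  type, and inclusions need no embedding maps.\<close>

definition GF :: "nat \<Rightarrow> 'a::field set" where
  "GF q = {x. x ^ q = x}"

locale prime_char =
  fixes p :: nat and TYP :: "'a::alg_closed_field itself"
  assumes CHAR_p: "CHAR('a) = p" and prime_p: "prime p"
begin

lemma p_ge_2: "p \<ge> 2"
  using prime_p prime_ge_2_nat by blast

lemma q_ge_2: "m \<ge> 1 \<Longrightarrow> p ^ m \<ge> 2"
  using p_ge_2 self_le_power[of p m] by simp

lemma frob_add: "(x + y :: 'a) ^ (p ^ m) = x ^ (p ^ m) + y ^ (p ^ m)"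
  using freshmans_dream'[where 'a = 'a, of "p ^ m" m] prime_p CHAR_p by simp

lemma frob_sum: "(\<Sum>i\<in>I. f i :: 'a) ^ (p ^ m) = (\<Sum>i\<in>I. f i ^ (p ^ m))"
  using freshmans_dream_sum'[where 'a = 'a, of "p ^ m" m] prime_p CHAR_p by simp

lemma frob_diff: "(x - y :: 'a) ^ (p ^ m) = x ^ (p ^ m) - y ^ (p ^ m)"
  using frob_add[of "x - y" y m] by simp

text \<open>\<open>X ^ q - X\<close> has derivative -1 in characteristic \<open>p\<close>, so its
  \<open>q\<close> roots are distinct.\<close>

lemma card_GF:
  assumes "m \<ge> 1"
  shows "finite (GF (p ^ m) :: 'a set)" "card (GF (p ^ m) :: 'a set) = p ^ m"
proof -
  let ?q = "p ^ m"
  define f where "f = monom (1::'a) ?q - [:0, 1:]"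
  have q2: "?q \<ge> 2" using assms by (rule q_ge_2)
  have cf: "coeff f ?q = 1"
    using q2 le_degree[of "[:0, 1::'a:]" ?q] by (auto simp: f_def)
  have f0: "f \<noteq> 0" using cf by auto
  have degf: "degree f = ?q"
  proof (rule antisym)
    show "degree f \<le> ?q" unfolding f_def using q2
      by (intro degree_diff_le) (auto intro: degree_monom_le)
    show "?q \<le> degree f" using cf by (intro le_degree) (simp del: coeff_diff)
  qed
  have GF_eq: "(GF ?q :: 'a set) = {x. poly f x = 0}"
    by (auto simp: GF_def f_def poly_monom)
  show "finite (GF ?q :: 'a set)" unfolding GF_eq using f0 by (rule poly_roots_finite)
  obtain A where A: "size A = degree f" "f = smult (lead_coeff f) (\<Prod>x\<in>#A. [:-x, 1:])"
    using alg_closed_imp_factorization[OF f0] by blast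
  have pd: "pderiv f = -1"
  proof -
    have "of_nat ?q = (0::'a)"
      using assms CHAR_p by (simp add: of_nat_eq_0_iff_char_dvd dvd_power)
    then show ?thesis by (simp add: f_def pderiv_diff pderiv_monom pderiv_pCons one_pCons del: of_nat_power)
  qed
  have nodup: "count A x \<le> 1" for x
  proof (rule ccontr)
    assume "\<not> count A x \<le> 1"
    then have "{#x, x#} \<subseteq># A" by (auto simp: subseteq_mset_def)
    then obtain A' where "A = {#x, x#} + A'" by (metis mset_subset_eq_exists_conv)
    then have "f = [:-x, 1:] * ([:-x, 1:] * smult (lead_coeff f) (\<Prod>x\<in>#A'. [:-x, 1:]))"
      using A(2) by (metis (no_types, lifting) add_mset_add_single image_mset_add_mset
         mult_smult_right prod_mset.add_mset union_mset_add_mset_left empty_neutral(1))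
    then obtain h where "f = [:-x, 1:] * ([:-x, 1:] * h)" by blast
    then have "poly (pderiv f) x = 0" by (simp add: pderiv_mult del: mult_pCons_left)
    then show False by (simp add: pd)
  qed
  have "set_mset A = GF ?q"
  proof -
    have lc: "lead_coeff f \<noteq> 0" using f0 by simp
    have "poly f x = lead_coeff f * (\<Prod>y\<in>#A. x - y)" for x
      by (subst A(2)) (simp add: poly_prod_mset image_mset.compositionality o_def)
    then show ?thesis unfolding GF_eq using lc by (auto simp: prod_mset_zero_iff)
  qed
  moreover have "size A = card (set_mset A)"
    unfolding size_multiset_overloaded_eq using nodup
    by (subst card_eq_sum) (auto intro!: sum.cong simp: le_Suc_eq count_eq_zero_iff)
  ultimately show "card (GF ?q :: 'a set) = ?q" using A(1) degf by simp
qed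

lemma GF_0 [simp]: "(0::'a) \<in> GF (p ^ m)"
  using p_ge_2 by (simp add: GF_def power_0_left)

lemma GF_1 [simp]: "(1::'a) \<in> GF q"
  by (simp add: GF_def)

lemma GF_add: "x \<in> GF (p ^ m) \<Longrightarrow> y \<in> GF (p ^ m) \<Longrightarrow> (x + y :: 'a) \<in> GF (p ^ m)"
  by (simp add: GF_def frob_add)

lemma GF_diff: "x \<in> GF (p ^ m) \<Longrightarrow> y \<in> GF (p ^ m) \<Longrightarrow> (x - y :: 'a) \<in> GF (p ^ m)"
  by (simp add: GF_def frob_diff)

lemma GF_minus: "x \<in> GF (p ^ m) \<Longrightarrow> (- x :: 'a) \<in> GF (p ^ m)"
  using GF_diff[of 0 m x] by simp

lemma GF_mult: "x \<in> GF q \<Longrightarrow> y \<in> GF q \<Longrightarrow> (x * y :: 'a) \<in> GF q"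
  by (simp add: GF_def power_mult_distrib)

lemma GF_divide: "x \<in> GF q \<Longrightarrow> y \<in> GF q \<Longrightarrow> (x / y :: 'a) \<in> GF q"
  by (simp add: GF_def power_divide)

lemma sum_GF_mult:
  assumes "c \<in> GF q" "c \<noteq> (0::'a)"
  shows "(\<Sum>x\<in>GF q. f (c * x)) = (\<Sum>x\<in>GF q. f x)"
  by (rule sum.reindex_bij_witness[of _ "\<lambda>x. x / c" "\<lambda>x. c * x"])
     (use assms in \<open>auto intro: GF_mult GF_divide\<close>)

lemma sum_GF_add:
  assumes "c \<in> GF (p ^ m)"
  shows "(\<Sum>x\<in>GF (p ^ m). f (x + c :: 'a)) = (\<Sum>x\<in>GF (p ^ m). f x)"
  by (rule sum.reindex_bij_witness[of _ "\<lambda>x. x - c" "\<lambda>x. x + c"])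
     (use assms in \<open>auto intro: GF_add GF_diff\<close>)

end

section \<open>Characters, Gauss sums and Jacobi sums\<close>

text \<open>Characters are functions on the whole type, constrained only on \<open>GF q\<close> (and
  at 0). Even the trivial one is 0 at 0.\<close>

definition mchar :: "nat \<Rightarrow> ('a::field \<Rightarrow> complex) \<Rightarrow> bool" where
  "mchar q \<eta> \<longleftrightarrow> \<eta> 0 = 0 \<and> (\<forall>x\<in>GF q. \<forall>y\<in>GF q. \<eta> (x * y) = \<eta> x * \<eta> y) \<and>
     (\<forall>x\<in>GF q. x \<noteq> 0 \<longrightarrow> cmod (\<eta> x) = 1)"

definition achar :: "nat \<Rightarrow> ('a::field \<Rightarrow> complex) \<Rightarrow> bool" where
  "achar q \<epsilon> \<longleftrightarrow> (\<forall>x\<in>GF q. \<forall>y\<in>GF q. \<epsilon> (x + y) = \<epsilon> x * \<epsilon> y) \<and> (\<forall>x\<in>GF q. cmod (\<epsilon> x) = 1)"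

definition mchar_nontriv :: "nat \<Rightarrow> ('a::field \<Rightarrow> complex) \<Rightarrow> bool" where
  "mchar_nontriv q \<eta> \<longleftrightarrow> mchar q \<eta> \<and> (\<exists>c\<in>GF q. c \<noteq> 0 \<and> \<eta> c \<noteq> 1)"

definition achar_nontriv :: "nat \<Rightarrow> ('a::field \<Rightarrow> complex) \<Rightarrow> bool" where
  "achar_nontriv q \<epsilon> \<longleftrightarrow> achar q \<epsilon> \<and> (\<exists>c\<in>GF q. \<epsilon> c \<noteq> 1)"

lemma mchar_nontriv_imp_mchar: "mchar_nontriv q \<eta> \<Longrightarrow> mchar q \<eta>"
  by (simp add: mchar_nontriv_def)

lemma achar_nontriv_imp_achar: "achar_nontriv q \<epsilon> \<Longrightarrow> achar q \<epsilon>"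
  by (simp add: achar_nontriv_def)

lemma mchar_0: "mchar q \<eta> \<Longrightarrow> \<eta> 0 = 0"
  by (simp add: mchar_def)

lemma mchar_mult: "mchar q \<eta> \<Longrightarrow> x \<in> GF q \<Longrightarrow> y \<in> GF q \<Longrightarrow> \<eta> (x * y) = \<eta> x * \<eta> y"
  by (simp add: mchar_def)

lemma mchar_norm: "mchar q \<eta> \<Longrightarrow> x \<in> GF q \<Longrightarrow> x \<noteq> 0 \<Longrightarrow> cmod (\<eta> x) = 1"
  by (simp add: mchar_def)

lemma achar_add: "achar q \<epsilon> \<Longrightarrow> x \<in> GF q \<Longrightarrow> y \<in> GF q \<Longrightarrow> \<epsilon> (x + y) = \<epsilon> x * \<epsilon> y"
  by (simp add: achar_def)

lemma achar_norm: "achar q \<epsilon> \<Longrightarrow> x \<in> GF q \<Longrightarrow> cmod (\<epsilon> x) = 1"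
  by (simp add: achar_def)

lemma mult_cnj_unit: "cmod z = 1 \<Longrightarrow> z * cnj z = 1"
  by (metis complex_norm_square of_real_1 power_one)

context prime_char
begin

lemma mchar_1: "mchar q \<eta> \<Longrightarrow> \<eta> (1::'a) = 1"
  using mchar_mult[of q \<eta> 1 1] mchar_norm[of q \<eta> 1] by auto

lemma achar_0: "achar (p ^ m) \<epsilon> \<Longrightarrow> \<epsilon> (0::'a) = 1"
  using achar_add[of "p ^ m" \<epsilon> 0 0] achar_norm[of "p ^ m" \<epsilon> 0] by auto

lemma achar_minus:
  assumes "achar (p ^ m) \<epsilon>" "x \<in> GF (p ^ m)"
  shows "\<epsilon> (- x :: 'a) = cnj (\<epsilon> x)"
proof -
  have "\<epsilon> (-x) * \<epsilon> x = 1"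
    using achar_add[OF assms(1) GF_minus[OF assms(2)] assms(2)] achar_0[OF assms(1)] by simp
  moreover have "cnj (\<epsilon> x) * \<epsilon> x = 1"
    using mult_cnj_unit[OF achar_norm[OF assms]] by (simp add: mult.commute)
  ultimately show ?thesis by (metis mult_right_cancel zero_neq_one mult_zero_right)
qed

text \<open>Multiplication by some \<open>c\<close> with \<open>\<eta> c \<noteq> 1\<close> permutes
  the field and scales the sum by \<open>\<eta> c\<close>.\<close>

lemma sum_mchar:
  assumes "mchar_nontriv q \<eta>"
  shows "(\<Sum>x\<in>GF q. \<eta> (x::'a)) = 0"
proof -
  obtain c where c: "c \<in> GF q" "c \<noteq> 0" "\<eta> c \<noteq> 1" using assms by (auto simp: mchar_nontriv_def)
  have "(\<Sum>x\<in>GF q. \<eta> x) = (\<Sum>x\<in>GF q. \<eta> (c * x))" using sum_GF_mult[OF c(1,2), of \<eta>] by simp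
  also have "\<dots> = \<eta> c * (\<Sum>x\<in>GF q. \<eta> x)"
    unfolding sum_distrib_left
    by (intro sum.cong refl mchar_mult[OF mchar_nontriv_imp_mchar[OF assms]]) (use c in auto)
  finally show ?thesis using c(3) by simp
qed

lemma sum_achar:
  assumes "achar_nontriv (p ^ m) \<epsilon>"
  shows "(\<Sum>x\<in>GF (p ^ m). \<epsilon> (x::'a)) = 0"
proof -
  obtain c where c: "c \<in> GF (p ^ m)" "\<epsilon> c \<noteq> 1" using assms by (auto simp: achar_nontriv_def)
  have "(\<Sum>x\<in>GF (p ^ m). \<epsilon> x) = (\<Sum>x\<in>GF (p ^ m). \<epsilon> (x + c))" using sum_GF_add[OF c(1), of \<epsilon>] by simp
  also have "\<dots> = \<epsilon> c * (\<Sum>x\<in>GF (p ^ m). \<epsilon> x)"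
    unfolding sum_distrib_left
  proof (intro sum.cong refl)
    fix x :: 'a assume "x \<in> GF (p ^ m)"
    then have "\<epsilon> (x + c) = \<epsilon> x * \<epsilon> c"
      by (intro achar_add[OF achar_nontriv_imp_achar[OF assms] _ c(1)])
    then show "\<epsilon> (x + c) = \<epsilon> c * \<epsilon> x" by simp
  qed
  finally show ?thesis using c(2) by simp
qed

lemma sum_achar_scaled:
  assumes "m \<ge> 1" "achar_nontriv (p ^ m) \<epsilon>" "t \<in> GF (p ^ m)"
  shows "(\<Sum>y\<in>GF (p ^ m). \<epsilon> (t * y :: 'a)) = (if t = 0 then of_nat (p ^ m) else 0)"
proof (cases "t = 0")
  case True
  then show ?thesis using achar_0[OF achar_nontriv_imp_achar[OF assms(2)]] card_GF[OF assms(1)] by simp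
next
  case False
  then show ?thesis using sum_GF_mult[OF assms(3) False, of \<epsilon>] sum_achar[OF assms(2)] by simp
qed

text \<open>In g times its conjugate, the substitution \<open>x = y * t\<close> isolates the sum of
  \<open>\<epsilon> ((t - 1) * y)\<close> over \<open>y\<close>, which vanishes unless
  \<open>t = 1\<close>.\<close>

lemma gauss_sum_norm:
  fixes \<eta> \<epsilon> :: "'a \<Rightarrow> complex"
  assumes m: "m \<ge> 1" and \<eta>: "mchar_nontriv (p ^ m) \<eta>" and \<epsilon>: "achar_nontriv (p ^ m) \<epsilon>"
  shows "cmod (\<Sum>x\<in>GF (p ^ m). \<eta> x * \<epsilon> x) = sqrt (real (p ^ m))"
proof -
  let ?F = "GF (p ^ m) :: 'a set"
  let ?g = "\<Sum>x\<in>?F. \<eta> x * \<epsilon> x"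
  note \<eta>' = mchar_nontriv_imp_mchar[OF \<eta>] and \<epsilon>' = achar_nontriv_imp_achar[OF \<epsilon>]
  note fin = card_GF[OF m]
  have "?g * cnj ?g = (\<Sum>y\<in>?F. cnj (\<eta> y * \<epsilon> y) * ?g)"
    by (simp add: sum_distrib_left sum_distrib_right mult.commute)
  also have "\<dots> = (\<Sum>y\<in>?F. \<Sum>t\<in>?F. if y = 0 then 0 else \<eta> t * \<epsilon> ((t - 1) * y))"
  proof (rule sum.cong[OF refl])
    fix y assume y: "y \<in> ?F"
    show "cnj (\<eta> y * \<epsilon> y) * ?g = (\<Sum>t\<in>?F. if y = 0 then 0 else \<eta> t * \<epsilon> ((t - 1) * y))"
    proof (cases "y = 0")
      case True
      then show ?thesis using \<eta>' by (simp add: mchar_0)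
    next
      case False
      have "?g = (\<Sum>t\<in>?F. \<eta> (y * t) * \<epsilon> (y * t))"
        using sum_GF_mult[OF y False, of "\<lambda>x. \<eta> x * \<epsilon> x"] by simp
      then have "cnj (\<eta> y * \<epsilon> y) * ?g = (\<Sum>t\<in>?F. cnj (\<eta> y * \<epsilon> y) * (\<eta> (y * t) * \<epsilon> (y * t)))"
        by (simp add: sum_distrib_left)
      also have "\<dots> = (\<Sum>t\<in>?F. \<eta> t * \<epsilon> ((t - 1) * y))"
      proof (rule sum.cong[OF refl])
        fix t assume t: "t \<in> ?F"
        have "\<epsilon> ((t - 1) * y) = \<epsilon> (y * t) * cnj (\<epsilon> y)"
          using achar_add[OF \<epsilon>' GF_mult[OF y t] GF_minus[OF y]] achar_minus[OF \<epsilon>' y]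
          by (simp add: algebra_simps)
        moreover have "cnj (\<eta> y) * \<eta> (y * t) = \<eta> t"
          using mchar_mult[OF \<eta>' y t] mult_cnj_unit[OF mchar_norm[OF \<eta>' y False]]
          by (simp add: mult_ac)
        ultimately show "cnj (\<eta> y * \<epsilon> y) * (\<eta> (y * t) * \<epsilon> (y * t)) = \<eta> t * \<epsilon> ((t - 1) * y)"
          by (simp add: mult_ac)
      qed
      finally show ?thesis using False by simp
    qed
  qed
  also have "\<dots> = (\<Sum>t\<in>?F. \<Sum>y\<in>?F. if y = 0 then 0 else \<eta> t * \<epsilon> ((t - 1) * y))"
    by (rule sum.swap)
  \<comment> \<open>The missing term \<open>y = 0\<close> costs \<open>\<eta> t\<close>; these
    corrections later sum to 0.\<close>
  also have "\<dots> = (\<Sum>t\<in>?F. (if t = 1 then of_nat (p ^ m) else 0) - \<eta> t)"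
  proof (rule sum.cong[OF refl])
    fix t assume t: "t \<in> ?F"
    have t1: "t - 1 \<in> ?F" using t by (intro GF_diff) auto
    have "(\<Sum>y\<in>?F. if y = 0 then 0 else \<eta> t * \<epsilon> ((t - 1) * y))
       = (\<Sum>y\<in>?F. \<eta> t * \<epsilon> ((t - 1) * y) - (if y = 0 then \<eta> t else 0))"
      by (rule sum.cong) (auto simp: achar_0[OF \<epsilon>'])
    also have "\<dots> = \<eta> t * (\<Sum>y\<in>?F. \<epsilon> ((t - 1) * y)) - \<eta> t"
      using fin by (simp add: sum_subtractf sum_distrib_left)
    also have "\<dots> = (if t = 1 then of_nat (p ^ m) else 0) - \<eta> t"
      using sum_achar_scaled[OF m \<epsilon> t1] mchar_1[OF \<eta>'] by simp
    finally show "(\<Sum>y\<in>?F. if y = 0 then 0 else \<eta> t * \<epsilon> ((t - 1) * y))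
       = (if t = 1 then of_nat (p ^ m) else 0) - \<eta> t" .
  qed
  also have "\<dots> = of_nat (p ^ m)"
    using fin sum_mchar[OF \<eta>] by (simp add: sum_subtractf)
  finally have "complex_of_real ((cmod ?g)\<^sup>2) = of_nat (p ^ m)"
    by (simp only: complex_norm_square)
  then have "(cmod ?g)\<^sup>2 = real (p ^ m)" by (metis of_real_eq_iff of_real_of_nat_eq)
  then show ?thesis by (metis norm_ge_zero real_sqrt_unique)
qed

text \<open>Scaling the variable by \<open>v\<close> proves it for \<open>v \<noteq> 0\<close>; at
  \<open>v = 0\<close> both sides vanish, the left one by nontriviality of \<open>\<eta>\<close>.
  Including 0 lets it be applied termwise inside sums over \<open>v\<close>.\<close>

lemma gauss_sum_twist:
  fixes \<eta> \<epsilon> :: "'a \<Rightarrow> complex"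
  assumes \<eta>: "mchar_nontriv (p ^ m) \<eta>" and v: "v \<in> GF (p ^ m)"
  shows "(\<Sum>x\<in>GF (p ^ m). \<eta> x * \<epsilon> (v * x)) = cnj (\<eta> v) * (\<Sum>x\<in>GF (p ^ m). \<eta> x * \<epsilon> x)"
proof (cases "v = 0")
  case True
  have "(\<Sum>x\<in>GF (p ^ m). \<eta> x * \<epsilon> 0) = 0"
    using sum_mchar[OF \<eta>] by (simp flip: sum_distrib_right)
  with True show ?thesis using mchar_0[OF mchar_nontriv_imp_mchar[OF \<eta>]] by simp
next
  case False
  note \<eta>' = mchar_nontriv_imp_mchar[OF \<eta>]
  have "\<eta> x = cnj (\<eta> v) * \<eta> (v * x)" if "x \<in> GF (p ^ m)" for x
    using mchar_mult[OF \<eta>' v that] mult_cnj_unit[OF mchar_norm[OF \<eta>' v False]]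
    by (metis mult.assoc mult.commute mult_1)
  then have "(\<Sum>x\<in>GF (p ^ m). \<eta> x * \<epsilon> (v * x)) = (\<Sum>x\<in>GF (p ^ m). cnj (\<eta> v) * (\<eta> (v * x) * \<epsilon> (v * x)))"
    by (intro sum.cong) auto
  also have "\<dots> = cnj (\<eta> v) * (\<Sum>x\<in>GF (p ^ m). \<eta> (v * x) * \<epsilon> (v * x))"
    by (simp add: sum_distrib_left)
  also have "(\<Sum>x\<in>GF (p ^ m). \<eta> (v * x) * \<epsilon> (v * x)) = (\<Sum>x\<in>GF (p ^ m). \<eta> x * \<epsilon> x)"
    using sum_GF_mult[OF v False, of "\<lambda>x. \<eta> x * \<epsilon> x"] by simp
  finally show ?thesis .
qed

lemma mchar_cnj: "mchar q \<eta> \<Longrightarrow> mchar q (\<lambda>x::'a. cnj (\<eta> x))"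
  by (simp add: mchar_def)

lemma mchar_times: "mchar q \<eta> \<Longrightarrow> mchar q \<psi> \<Longrightarrow> mchar q (\<lambda>x::'a. \<eta> x * \<psi> x)"
  by (simp add: mchar_def norm_mult mult_ac)

lemma mchar_nontriv_cnj: "mchar_nontriv q \<eta> \<Longrightarrow> mchar_nontriv q (\<lambda>x::'a. cnj (\<eta> x))"
  by (auto simp: mchar_nontriv_def mchar_cnj)

text \<open>The trivial character, whose sum is -1, is included because a product of nontrivial
  characters may be trivial.\<close>

lemma gauss_sum_le:
  fixes \<eta> \<epsilon> :: "'a \<Rightarrow> complex"
  assumes m: "m \<ge> 1" and \<eta>: "mchar (p ^ m) \<eta>" and \<epsilon>: "achar_nontriv (p ^ m) \<epsilon>"
  shows "cmod (\<Sum>x\<in>GF (p ^ m). \<eta> x * \<epsilon> x) \<le> sqrt (real (p ^ m))"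
proof (cases "mchar_nontriv (p ^ m) \<eta>")
  case True
  then show ?thesis using gauss_sum_norm[OF m True \<epsilon>] by simp
next
  case False
  then have triv: "\<eta> c = (if c = 0 then 0 else 1)" if "c \<in> GF (p ^ m)" for c
    using \<eta> that by (auto simp: mchar_nontriv_def mchar_0)
  have "(\<Sum>x\<in>GF (p ^ m). \<eta> x * \<epsilon> x) = (\<Sum>x\<in>GF (p ^ m). \<epsilon> x - (if x = 0 then 1 else 0))"
    using achar_0[OF achar_nontriv_imp_achar[OF \<epsilon>]] by (intro sum.cong) (auto simp: triv)
  also have "\<dots> = -1" using card_GF[OF m] sum_achar[OF \<epsilon>] by (simp add: sum_subtractf)
  finally have "cmod (\<Sum>x\<in>GF (p ^ m). \<eta> x * \<epsilon> x) = 1" by simp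
  moreover have "1 \<le> sqrt (real (p ^ m))"
    using q_ge_2[OF m] by (intro real_le_rsqrt) (simp del: of_nat_power)
  ultimately show ?thesis by simp
qed

text \<open>Expanding \<open>\<psi> (x + 1)\<close> through the Gauss sum g of
  \<open>cnj \<psi>\<close> gives J g(conj psi) = g(conj psi conj eta) g(eta);
  \<open>\<epsilon>\<close> is auxiliary and leaves no trace in the estimate.\<close>

lemma jacobi_sum_le:
  fixes \<eta> \<psi> \<epsilon> :: "'a \<Rightarrow> complex"
  assumes m: "m \<ge> 1" and \<eta>: "mchar_nontriv (p ^ m) \<eta>" and \<psi>: "mchar_nontriv (p ^ m) \<psi>"
    and \<epsilon>: "achar_nontriv (p ^ m) \<epsilon>"
  shows "cmod (\<Sum>x\<in>GF (p ^ m). \<eta> x * \<psi> (x + 1)) \<le> sqrt (real (p ^ m))"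
proof -
  let ?F = "GF (p ^ m) :: 'a set"
  let ?J = "\<Sum>x\<in>?F. \<eta> x * \<psi> (x + 1)"
  define g where "g = (\<Sum>x\<in>?F. cnj (\<psi> x) * \<epsilon> x)"
  note \<eta>' = mchar_nontriv_imp_mchar[OF \<eta>] and \<psi>' = mchar_nontriv_imp_mchar[OF \<psi>]
    and \<epsilon>' = achar_nontriv_imp_achar[OF \<epsilon>]
  have tw: "\<psi> v * g = (\<Sum>x\<in>?F. cnj (\<psi> x) * \<epsilon> (v * x))" if "v \<in> ?F" for v
    using gauss_sum_twist[OF mchar_nontriv_cnj[OF \<psi>] that, of \<epsilon>] by (simp add: g_def)
  have "?J * g = (\<Sum>x\<in>?F. \<eta> x * (\<psi> (x + 1) * g))"
    by (simp add: sum_distrib_right mult.assoc)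
  also have "\<dots> = (\<Sum>x\<in>?F. \<eta> x * (\<Sum>v\<in>?F. cnj (\<psi> v) * \<epsilon> ((x + 1) * v)))"
    by (intro sum.cong refl, subst tw) (auto intro: GF_add)
  also have "\<dots> = (\<Sum>x\<in>?F. \<Sum>v\<in>?F. (cnj (\<psi> v) * \<epsilon> v) * (\<eta> x * \<epsilon> (v * x)))"
    unfolding sum_distrib_left
  proof (intro sum.cong refl)
    fix x v assume "x \<in> ?F" "v \<in> ?F"
    then have "\<epsilon> ((x + 1) * v) = \<epsilon> (v * x) * \<epsilon> v"
      using achar_add[OF \<epsilon>', of "v * x" v] GF_mult[of v "p ^ m" x] by (simp add: algebra_simps)
    then show "\<eta> x * (cnj (\<psi> v) * \<epsilon> ((x + 1) * v)) = (cnj (\<psi> v) * \<epsilon> v) * (\<eta> x * \<epsilon> (v * x))"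
      by simp
  qed
  also have "\<dots> = (\<Sum>v\<in>?F. (cnj (\<psi> v) * \<epsilon> v) * (\<Sum>x\<in>?F. \<eta> x * \<epsilon> (v * x)))"
    by (subst sum.swap) (simp add: sum_distrib_left)
  also have "\<dots> = (\<Sum>v\<in>?F. (cnj (\<psi> v) * \<epsilon> v) * (cnj (\<eta> v) * (\<Sum>x\<in>?F. \<eta> x * \<epsilon> x)))"
    by (intro sum.cong refl) (simp add: gauss_sum_twist[OF \<eta>])
  also have "\<dots> = (\<Sum>v\<in>?F. (cnj (\<psi> v) * cnj (\<eta> v)) * \<epsilon> v) * (\<Sum>x\<in>?F. \<eta> x * \<epsilon> x)"
    unfolding sum_distrib_right by (intro sum.cong) (auto simp: mult_ac)
  finally have "?J * g = (\<Sum>v\<in>?F. (cnj (\<psi> v) * cnj (\<eta> v)) * \<epsilon> v) * (\<Sum>x\<in>?F. \<eta> x * \<epsilon> x)" .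
  from arg_cong[OF this, of cmod]
  have "cmod ?J * cmod g = cmod (\<Sum>v\<in>?F. (cnj (\<psi> v) * cnj (\<eta> v)) * \<epsilon> v) * cmod (\<Sum>x\<in>?F. \<eta> x * \<epsilon> x)"
    by (simp only: norm_mult)
  also have "\<dots> \<le> sqrt (real (p ^ m)) * sqrt (real (p ^ m))"
    using gauss_sum_le[OF m mchar_times[OF mchar_cnj[OF \<psi>'] mchar_cnj[OF \<eta>']] \<epsilon>]
      gauss_sum_norm[OF m \<eta> \<epsilon>] by (intro mult_mono) auto
  finally have "cmod ?J * sqrt (real (p ^ m)) \<le> sqrt (real (p ^ m)) * sqrt (real (p ^ m))"
    unfolding g_def gauss_sum_norm[OF m mchar_nontriv_cnj[OF \<psi>] \<epsilon>] .
  moreover have "sqrt (real (p ^ m)) > 0" using q_ge_2[OF m] p_ge_2 by simp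
  ultimately show ?thesis by (rule mult_right_le_imp_le)
qed

section \<open>Doubling the field degree\<close>

text \<open>The two roots of a quadratic polynomial over \<open>GF q\<close> are either both fixed or interchanged by \<open>x \<mapsto> x\<^sup>q\<close>.\<close>

lemma sum_GF_quadratic_extension:
  fixes G :: "'a \<Rightarrow> 'a \<Rightarrow> complex"
  assumes m: "m \<ge> 1"
  defines "q \<equiv> p ^ m"
  shows "(\<Sum>x\<in>GF (q * q). G (x + x ^ q) (x ^ (q + 1))) + (\<Sum>a\<in>GF q. \<Sum>b\<in>GF q. G (a + b) (a * b))
       = 2 * (\<Sum>s\<in>GF q. \<Sum>t\<in>GF q. G s t)"
proof -
  have qq: "q * q = p ^ (2 * m)" by (simp add: q_def power_add mult_2)
  have fin2: "finite (GF (q * q) :: 'a set)" unfolding qq using m by (intro card_GF) simp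
  have fin: "finite (GF q :: 'a set)" unfolding q_def using m by (rule card_GF)
  have frq: "(x + y :: 'a) ^ q = x ^ q + y ^ q" for x y by (simp add: q_def frob_add)
  \<comment> \<open>Both sets record ordered pairs of roots of X^2 - s X + t: \<open>Xp\<close>
    those of the form x, x^q, and \<open>Y\<close> those with both roots in \<open>GF q\<close>. A
    double root is counted once by each.\<close>
  define Xp where "Xp = (\<lambda>s t. {x \<in> GF (q * q). x + x ^ q = s \<and> x ^ (q + 1) = (t::'a)})"
  define Y where "Y = (\<lambda>s t. {(a, b) \<in> GF q \<times> GF q. a + b = s \<and> a * b = (t::'a)})"
  have XY: "card (Xp s t) + card (Y s t) = 2" if st: "s \<in> GF q" "t \<in> GF q" for s t
  proof -
    define f where "f = [:t, -s, 1:]"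
    have "degree f > 0" by (simp add: f_def)
    then obtain y where y: "poly f y = 0" using alg_closed_imp_poly_has_root by blast
    define z where "z = s - y"
    have s: "s = y + z" by (simp add: z_def)
    have t: "t = y * z" using y by (simp add: f_def z_def algebra_simps add_eq_0_iff)
    have roots: "(a = y \<and> b = z) \<or> (a = z \<and> b = y)" if "a + b = s" "a * b = t" for a b
    proof -
      have "(a - y) * (a - z) = a * a - (y + z) * a + y * z" by (simp add: algebra_simps)
      also have "\<dots> = a * a - (a + b) * a + a * b" using that s t by simp
      also have "\<dots> = 0" by (simp add: algebra_simps)
      finally have "a = y \<or> a = z" by auto
      then show ?thesis using that s by auto
    qed
    have pw: "(y ^ q = y \<and> z ^ q = z) \<or> (y ^ q = z \<and> z ^ q = y)"
    proof -
      have "y ^ q + z ^ q = s" using st(1) s by (simp add: frq[symmetric] GF_def)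
      moreover have "y ^ q * z ^ q = t" using st(2) t by (simp add: power_mult_distrib[symmetric] GF_def)
      ultimately show ?thesis using roots by blast
    qed
    have Xe: "Xp s t = {x \<in> {y, z}. x ^ q = s - x}"
    proof -
      have "x \<in> Xp s t \<longleftrightarrow> x \<in> {y, z} \<and> x ^ q = s - x" for x
      proof
        assume x: "x \<in> Xp s t"
        then have "x + x ^ q = s" "x * x ^ q = t" by (auto simp: Xp_def)
        with roots[of x "x ^ q"] show "x \<in> {y, z} \<and> x ^ q = s - x" by (auto simp: algebra_simps)
      next
        assume x: "x \<in> {y, z} \<and> x ^ q = s - x"
        then have "(x = y \<and> x ^ q = z) \<or> (x = z \<and> x ^ q = y)" by (auto simp: s)
        moreover from this have "(x ^ q) ^ q = x" using pw by auto
        ultimately show "x \<in> Xp s t" by (auto simp: Xp_def GF_def s t power_mult mult_ac add_ac)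
      qed
      then show ?thesis by blast
    qed
    have Ye: "Y s t = {ab \<in> {(y, z), (z, y)}. y ^ q = y \<and> z ^ q = z}"
      using roots by (auto simp: Y_def GF_def s t mult_ac add_ac)
    show ?thesis
    proof (cases "y = z")
      case True
      then have "y ^ q = y" using pw by auto
      then have "Xp s t = {y}" "Y s t = {(y, y)}" using True unfolding Xe Ye by (auto simp: s)
      then show ?thesis by simp
    next
      case yz: False
      from pw show ?thesis
      proof
        assume "y ^ q = y \<and> z ^ q = z"
        then have "Xp s t = {}" "Y s t = {(y, z), (z, y)}" using yz unfolding Xe Ye by (auto simp: s)
        then show ?thesis using yz by simp
      next
        assume "y ^ q = z \<and> z ^ q = y"
        then have "Xp s t = {y, z}" "Y s t = {}" using yz unfolding Xe Ye by (auto simp: s)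
        then show ?thesis using yz by simp
      qed
    qed
  qed
  have inq: "x + x ^ q \<in> GF q \<and> x ^ (q + 1) \<in> GF q" if "x \<in> GF (q * q)" for x :: 'a
    using that by (simp add: GF_def frq power_mult power_mult_distrib add_ac mult_ac)
  have "(\<Sum>x\<in>GF (q * q). G (x + x ^ q) (x ^ (q + 1)))
      = (\<Sum>st\<in>GF q \<times> GF q. \<Sum>x\<in>{x \<in> GF (q * q). (x + x ^ q, x ^ (q + 1)) = st}. G (x + x ^ q) (x ^ (q + 1)))"
    by (rule sum.group[symmetric]) (use fin fin2 inq in auto)
  also have "\<dots> = (\<Sum>(s,t)\<in>GF q \<times> GF q. of_nat (card (Xp s t)) * G s t)"
    unfolding Xp_def by (intro sum.cong refl) (auto simp: case_prod_unfold intro!: sum.cong)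
  finally have 1: "(\<Sum>x\<in>GF (q * q). G (x + x ^ q) (x ^ (q + 1)))
      = (\<Sum>(s,t)\<in>GF q \<times> GF q. of_nat (card (Xp s t)) * G s t)" .
  have "(\<Sum>a\<in>GF q. \<Sum>b\<in>GF q. G (a + b) (a * b)) = (\<Sum>ab\<in>GF q \<times> GF q. G (fst ab + snd ab) (fst ab * snd ab))"
    by (simp add: sum.cartesian_product case_prod_unfold)
  also have "\<dots> = (\<Sum>st\<in>GF q \<times> GF q. \<Sum>ab\<in>{ab \<in> GF q \<times> GF q. (fst ab + snd ab, fst ab * snd ab) = st}.
       G (fst ab + snd ab) (fst ab * snd ab))"
    by (rule sum.group[symmetric]) (use fin in \<open>auto simp: q_def intro: GF_add GF_mult\<close>)
  also have "\<dots> = (\<Sum>(s,t)\<in>GF q \<times> GF q. of_nat (card (Y s t)) * G s t)"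
  proof (intro sum.cong refl)
    fix st :: "'a \<times> 'a" assume "st \<in> GF q \<times> GF q"
    obtain s t where st: "st = (s, t)" by (cases st)
    have "{ab \<in> GF q \<times> GF q. (fst ab + snd ab, fst ab * snd ab) = st} = Y s t"
      by (auto simp: Y_def st)
    moreover have "(\<Sum>ab\<in>Y s t. G (fst ab + snd ab) (fst ab * snd ab)) = (\<Sum>ab\<in>Y s t. G s t)"
      by (intro sum.cong) (auto simp: Y_def)
    ultimately show "(\<Sum>ab\<in>{ab \<in> GF q \<times> GF q. (fst ab + snd ab, fst ab * snd ab) = st}.
       G (fst ab + snd ab) (fst ab * snd ab)) = (case st of (s,t) \<Rightarrow> of_nat (card (Y s t)) * G s t)"
      by (simp add: st)
  qed
  finally have 2: "(\<Sum>a\<in>GF q. \<Sum>b\<in>GF q. G (a + b) (a * b))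
     = (\<Sum>(s,t)\<in>GF q \<times> GF q. of_nat (card (Y s t)) * G s t)" .
  have "(\<Sum>(s,t)\<in>GF q \<times> GF q. of_nat (card (Xp s t)) * G s t) + (\<Sum>(s,t)\<in>GF q \<times> GF q. of_nat (card (Y s t)) * G s t)
     = (\<Sum>(s,t)\<in>GF q \<times> GF q. of_nat (card (Xp s t) + card (Y s t)) * G s t)"
    by (simp add: sum.distrib[symmetric] case_prod_unfold algebra_simps)
  also have "\<dots> = (\<Sum>(s,t)\<in>GF q \<times> GF q. 2 * G s t)"
    by (intro sum.cong refl) (auto simp: XY simp del: of_nat_add)
  also have "\<dots> = 2 * (\<Sum>s\<in>GF q. \<Sum>t\<in>GF q. G s t)"
    by (simp add: sum.cartesian_product sum_distrib_left case_prod_unfold)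
  finally show ?thesis using 1 2 by simp
qed

definition mixed_sum :: "nat \<Rightarrow> ('a \<Rightarrow> complex) \<Rightarrow> ('a \<Rightarrow> complex) \<Rightarrow> ('a \<Rightarrow> complex) \<Rightarrow> complex" where
  "mixed_sum q \<eta> \<psi> \<epsilon> = (\<Sum>x\<in>GF q. \<eta> x * \<psi> (x + 1) * \<epsilon> x)"

text \<open>Over \<open>GF (q * q)\<close> the summand depends only on the trace s and the norm t of
  x, because the norm of x + 1 is t + s + 1; a product of two summands over \<open>GF q\<close> is
  the same function of sum and product. So \<open>sum_GF_quadratic_extension\<close> expresses the
  new sum plus the square of the old one as twice a double sum, which splits into two Gauss sums of
  modulus sqrt q.\<close>

lemma mixed_sum_doubling:
  fixes \<eta> \<psi> \<epsilon> :: "'a \<Rightarrow> complex"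
  assumes m: "m \<ge> 1"
  defines "q \<equiv> p ^ m"
  assumes \<eta>: "mchar_nontriv q \<eta>" and \<psi>: "mchar_nontriv q \<psi>" and \<epsilon>: "achar_nontriv q \<epsilon>"
  shows "(cmod (mixed_sum q \<eta> \<psi> \<epsilon>))\<^sup>2 - 2 * real q
    \<le> cmod (mixed_sum (q * q) (\<lambda>x. \<eta> (x ^ (q + 1))) (\<lambda>x. \<psi> (x ^ (q + 1))) (\<lambda>x. \<epsilon> (x + x ^ q)))"
proof -
  let ?F = "GF q :: 'a set"
  let ?S = "mixed_sum (q * q) (\<lambda>x. \<eta> (x ^ (q + 1))) (\<lambda>x. \<psi> (x ^ (q + 1))) (\<lambda>x. \<epsilon> (x + x ^ q))"
  define G where "G = (\<lambda>s t. \<eta> t * \<psi> (t + s + 1) * \<epsilon> s)"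
  note \<eta>' = mchar_nontriv_imp_mchar[OF \<eta>] and \<psi>' = mchar_nontriv_imp_mchar[OF \<psi>]
    and \<epsilon>' = achar_nontriv_imp_achar[OF \<epsilon>]
  have frq: "(x + y :: 'a) ^ q = x ^ q + y ^ q" for x y by (simp add: q_def frob_add)
  have "?S = (\<Sum>x\<in>GF (q * q). G (x + x ^ q) (x ^ (q + 1)))"
    unfolding mixed_sum_def G_def by (simp add: frq algebra_simps)
  moreover have "(mixed_sum q \<eta> \<psi> \<epsilon>)\<^sup>2 = (\<Sum>a\<in>?F. \<Sum>b\<in>?F. G (a + b) (a * b))"
  proof -
    have "(mixed_sum q \<eta> \<psi> \<epsilon>)\<^sup>2 = (\<Sum>a\<in>?F. \<Sum>b\<in>?F. (\<eta> a * \<psi> (a + 1) * \<epsilon> a) * (\<eta> b * \<psi> (b + 1) * \<epsilon> b))"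
      by (simp only: mixed_sum_def power2_eq_square sum_product)
    also have "\<dots> = (\<Sum>a\<in>?F. \<Sum>b\<in>?F. G (a + b) (a * b))"
    proof (intro sum.cong refl)
      fix a b assume ab: "a \<in> ?F" "b \<in> ?F"
      have ab1: "a + 1 \<in> ?F" "b + 1 \<in> ?F" using ab by (auto simp: q_def intro: GF_add)
      have e: "a * b + (a + b) + 1 = (a + 1) * (b + 1)" by (simp add: algebra_simps)
      show "(\<eta> a * \<psi> (a + 1) * \<epsilon> a) * (\<eta> b * \<psi> (b + 1) * \<epsilon> b) = G (a + b) (a * b)"
        unfolding G_def e using mchar_mult[OF \<eta>' ab] mchar_mult[OF \<psi>' ab1] achar_add[OF \<epsilon>' ab]
        by (simp add: mult_ac)
    qed
    finally show ?thesis .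
  qed
  moreover have "cmod (\<Sum>s\<in>?F. \<Sum>t\<in>?F. G s t) = real q"
  proof -
    have "(\<Sum>s\<in>?F. \<Sum>t\<in>?F. G s t) = (\<Sum>t\<in>?F. \<Sum>s\<in>?F. G s t)" by (rule sum.swap)
    \<comment> \<open>The substitution \<open>v = s + t + 1\<close> separates the variables.\<close>
    also have "\<dots> = (\<Sum>t\<in>?F. \<Sum>v\<in>?F. (\<eta> t * \<epsilon> (- t - 1)) * (\<psi> v * \<epsilon> v))"
    proof (rule sum.cong[OF refl])
      fix t assume t: "t \<in> ?F"
      have t1: "t + 1 \<in> GF (p ^ m)" using t by (auto simp: q_def intro: GF_add)
      have "(\<Sum>s\<in>?F. G s t) = (\<Sum>s\<in>?F. \<eta> t * \<psi> (s + (t + 1)) * \<epsilon> ((s + (t + 1)) - (t + 1)))"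
        by (simp add: G_def add_ac)
      also have "\<dots> = (\<Sum>v\<in>?F. \<eta> t * \<psi> v * \<epsilon> (v - (t + 1)))"
        unfolding q_def by (rule sum_GF_add[OF t1])
      also have "\<dots> = (\<Sum>v\<in>?F. (\<eta> t * \<epsilon> (- t - 1)) * (\<psi> v * \<epsilon> v))"
      proof (intro sum.cong refl)
        fix v assume v: "v \<in> ?F"
        have e: "v - (t + 1) = v + (- t - 1)" by simp
        have "- t - 1 \<in> ?F" using GF_minus[OF t1] by (simp add: q_def)
        from achar_add[OF \<epsilon>' v this]
        show "\<eta> t * \<psi> v * \<epsilon> (v - (t + 1)) = (\<eta> t * \<epsilon> (- t - 1)) * (\<psi> v * \<epsilon> v)"
          by (simp only: e mult_ac)
      qed
      finally show "(\<Sum>s\<in>?F. G s t) = (\<Sum>v\<in>?F. (\<eta> t * \<epsilon> (- t - 1)) * (\<psi> v * \<epsilon> v))" .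
    qed
    also have "\<dots> = (\<Sum>t\<in>?F. \<eta> t * \<epsilon> (- t - 1)) * (\<Sum>v\<in>?F. \<psi> v * \<epsilon> v)"
      by (simp add: sum_product)
    also have "(\<Sum>t\<in>?F. \<eta> t * \<epsilon> (- t - 1)) = \<epsilon> (- 1) * (\<Sum>t\<in>?F. \<eta> t * \<epsilon> ((- 1) * t))"
      unfolding sum_distrib_left
    proof (intro sum.cong refl)
      fix t assume t: "t \<in> ?F"
      have "\<epsilon> (- t + (- 1)) = \<epsilon> (- t) * \<epsilon> (- 1)"
        using t GF_minus[of t m] GF_minus[of 1 m] by (intro achar_add[OF \<epsilon>']) (auto simp: q_def)
      then show "\<eta> t * \<epsilon> (- t - 1) = \<epsilon> (- 1) * (\<eta> t * \<epsilon> ((- 1) * t))" by simp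
    qed
    also have "(\<Sum>t\<in>?F. \<eta> t * \<epsilon> ((- 1) * t)) = cnj (\<eta> (- 1)) * (\<Sum>t\<in>?F. \<eta> t * \<epsilon> t)"
      using GF_minus[of 1 m] \<eta> unfolding q_def by (intro gauss_sum_twist) auto
    finally have "cmod (\<Sum>s\<in>?F. \<Sum>t\<in>?F. G s t) = cmod (\<epsilon> (- 1)) * (cmod (\<eta> (- 1)) *
        cmod (\<Sum>t\<in>?F. \<eta> t * \<epsilon> t)) * cmod (\<Sum>v\<in>?F. \<psi> v * \<epsilon> v)"
      by (simp add: norm_mult)
    also have "\<dots> = sqrt (real q) * sqrt (real q)"
      using mchar_norm[OF \<eta>', of "- 1"] achar_norm[OF \<epsilon>', of "- 1"] GF_minus[of 1 m]
        gauss_sum_norm[OF m \<eta>[unfolded q_def] \<epsilon>[unfolded q_def]]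
        gauss_sum_norm[OF m \<psi>[unfolded q_def] \<epsilon>[unfolded q_def]] by (simp add: q_def)
    finally show ?thesis by simp
  qed
  ultimately have "?S + (mixed_sum q \<eta> \<psi> \<epsilon>)\<^sup>2 = 2 * (\<Sum>s\<in>?F. \<Sum>t\<in>?F. G s t)"
    using sum_GF_quadratic_extension[OF m, of G] by (simp add: q_def)
  then have eq: "(mixed_sum q \<eta> \<psi> \<epsilon>)\<^sup>2 = 2 * (\<Sum>s\<in>?F. \<Sum>t\<in>?F. G s t) - ?S"
    by (simp only: eq_diff_eq add.commute)
  have "cmod ((mixed_sum q \<eta> \<psi> \<epsilon>)\<^sup>2) \<le> cmod (2 * (\<Sum>s\<in>?F. \<Sum>t\<in>?F. G s t)) + cmod ?S"
    unfolding eq by (rule norm_triangle_ineq4)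
  then show ?thesis
    using \<open>cmod (\<Sum>s\<in>?F. \<Sum>t\<in>?F. G s t) = real q\<close> by (simp add: norm_mult norm_power)
qed

end

section \<open>The Weil bound for mixed sums\<close>

context prime_char
begin

text \<open>\<open>x \<mapsto> x ^ norm_exp m\<close> is the norm from \<open>GF (p ^ m)\<close> to \<open>GF p\<close>.\<close>

definition norm_exp :: "nat \<Rightarrow> nat" where "norm_exp m = (\<Sum>i<m. p ^ i)"

definition field_trace :: "nat \<Rightarrow> 'a \<Rightarrow> 'a" where "field_trace m x = (\<Sum>i<m. x ^ (p ^ i))"

text \<open>The geometric series, in the shape \<open>r = n * R + 1\<close> with
  \<open>n = p - 1\<close> on which the Stepanov argument runs.\<close>

lemma norm_exp_mult: "p ^ m = (p - 1) * norm_exp m + 1"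
proof (induction m)
  case (Suc m)
  have "p ^ Suc m = (p - 1) * p ^ m + p ^ m"
    using p_ge_2 by (cases p) (auto simp: algebra_simps)
  with Suc show ?case by (simp add: norm_exp_def algebra_simps)
qed (simp add: norm_exp_def)

lemma sum_double: "(\<Sum>i<2 * m. f i) = (\<Sum>i<m. f i) + (\<Sum>i<m. f (m + i))" for f :: "nat \<Rightarrow> 'b::comm_monoid_add"
proof -
  have "(\<Sum>i<2 * m. f i) = (\<Sum>i<m. f i) + (\<Sum>i\<in>{m..<2 * m}. f i)"
    by (subst sum.union_disjoint[symmetric]) (auto intro!: sum.cong)
  also have "(\<Sum>i\<in>{m..<2 * m}. f i) = (\<Sum>i<m. f (m + i))"
    by (rule sum.reindex_bij_witness[of _ "\<lambda>i. m + i" "\<lambda>i. i - m"]) auto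
  finally show ?thesis .
qed

text \<open>Transitivity of the norm through \<open>GF (p ^ m)\<close>, at the level of exponents;
  \<open>field_trace_double\<close> is its counterpart for traces.\<close>

lemma norm_exp_double: "norm_exp (2 * m) = norm_exp m * (p ^ m + 1)"
  unfolding norm_exp_def sum_double by (simp add: power_add sum_distrib_left sum.distrib algebra_simps)

lemma norm_exp_ge: "m \<le> norm_exp m"
proof -
  have "(\<Sum>i<m. 1) \<le> (\<Sum>i<m. p ^ i)" using p_ge_2 by (intro sum_mono) simp
  then show ?thesis by (simp add: norm_exp_def)
qed

lemma field_trace_double: "field_trace (2 * m) x = field_trace m (x + x ^ (p ^ m))"
  unfolding field_trace_def sum_double by (simp add: frob_add sum.distrib power_mult[symmetric] power_add)

lemma field_trace_add: "field_trace m (x + y) = field_trace m x + field_trace m y"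
  by (simp add: field_trace_def frob_add sum.distrib)

lemma field_trace_diff: "field_trace m (x - y) = field_trace m x - field_trace m y"
  by (simp add: field_trace_def frob_diff sum_subtractf)

text \<open>The sum telescopes. Together with \<open>artin_schreier_root\<close> this gives the
  additive Hilbert 90 that parametrizes the elements of a given trace.\<close>

lemma field_trace_artin_schreier: "field_trace m (z ^ p - z) = z ^ (p ^ m) - z"
proof -
  have "field_trace m (z ^ p - z) = (\<Sum>i<m. z ^ (p ^ Suc i) - z ^ (p ^ i))"
    by (simp add: field_trace_def frob_diff power_mult[symmetric])
  also have "\<dots> = z ^ (p ^ m) - z ^ (p ^ 0)" by (rule sum_lessThan_telescope)
  finally show ?thesis by simp
qed

lemma field_trace_frob: "field_trace m x ^ p - field_trace m x = x ^ (p ^ m) - x"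
proof -
  have "field_trace m x ^ p = (\<Sum>i<m. x ^ (p ^ Suc i))"
    using frob_sum[of "\<lambda>i. x ^ (p ^ i)" "{..<m}" 1] by (simp add: field_trace_def power_mult[symmetric] mult.commute)
  then have "field_trace m x ^ p - field_trace m x = (\<Sum>i<m. x ^ (p ^ Suc i) - x ^ (p ^ i))"
    by (simp add: field_trace_def sum_subtractf)
  also have "\<dots> = x ^ (p ^ m) - x ^ (p ^ 0)" by (rule sum_lessThan_telescope)
  finally show ?thesis by simp
qed

lemma field_trace_in_GF: "x \<in> GF (p ^ m) \<Longrightarrow> field_trace m x \<in> GF p"
  using field_trace_frob[of m x] by (simp add: GF_def)

lemma artin_schreier_root: "\<exists>z. z ^ p - z = (y :: 'a)"
proof -
  define f where "f = monom 1 p - [:y, 1:]"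
  have "coeff f p = 1"
    using p_ge_2 le_degree[of "[:y, 1:]" p] by (auto simp: f_def)
  then have "degree f > 0" using p_ge_2 le_degree[of f p] by simp
  then obtain z where "poly f z = 0" using alg_closed_imp_poly_has_root by blast
  then show ?thesis by (intro exI[of _ z]) (simp add: f_def poly_monom algebra_simps)
qed

text \<open>A solution exists by algebraic closedness, and \<open>field_trace_frob\<close> forces it
  into \<open>GF (p ^ m)\<close>. Surjectivity of trace and norm keeps lifted characters
  nontrivial.\<close>

lemma field_trace_surj:
  assumes "m \<ge> 1" "c \<in> GF p"
  shows "\<exists>x\<in>GF (p ^ m). field_trace m x = c"
proof -
  obtain m' where m': "m = Suc m'" using assms by (cases m) auto
  define f where "f = (\<Sum>i<m. monom 1 (p ^ i)) - [:c:]"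
  have "coeff f (p ^ m') = (\<Sum>i<m. if i = m' then 1 else 0)"
    using p_ge_2 by (auto simp: f_def coeff_sum coeff_pCons m' intro!: sum.cong split: nat.split)
  then have "coeff f (p ^ m') = 1" by (simp add: m')
  then have "degree f > 0" using p_ge_2 le_degree[of f "p ^ m'"] by (cases "degree f") auto
  then obtain x where "poly f x = 0" using alg_closed_imp_poly_has_root by blast
  then have x: "field_trace m x = c" by (simp add: f_def field_trace_def poly_sum poly_monom)
  have "x ^ (p ^ m) - x = 0" using field_trace_frob[of m x] assms by (simp add: x GF_def)
  with x show ?thesis by (auto simp: GF_def)
qed

lemma norm_in_GF:
  assumes "x \<in> GF (p ^ m)" "m \<ge> 1"
  shows "x ^ norm_exp m \<in> (GF p :: 'a set)"
proof (cases "x = 0")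
  case True
  then show ?thesis using GF_0[of 1] norm_exp_ge[of m] assms by (simp add: power_0_left)
next
  case False
  have "x ^ (p ^ m) = x ^ ((p - 1) * norm_exp m) * x" by (subst norm_exp_mult) simp
  then have "x ^ ((p - 1) * norm_exp m) = 1" using assms False by (simp add: GF_def)
  then have "(x ^ norm_exp m) ^ (p - 1) = 1" by (simp add: power_mult[symmetric] mult.commute)
  then have "(x ^ norm_exp m) ^ (Suc (p - 1)) = x ^ norm_exp m" by simp
  then show ?thesis using p_ge_2 by (simp add: GF_def)
qed

lemma norm_surj:
  assumes "m \<ge> 1" "c \<in> GF p" "c \<noteq> 0"
  shows "\<exists>x\<in>GF (p ^ m). x \<noteq> 0 \<and> x ^ norm_exp m = (c :: 'a)"
proof -
  have n0: "norm_exp m > 0" using norm_exp_ge[of m] assms by simp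
  then obtain x where x: "x ^ norm_exp m = c" using nth_root_exists[of "norm_exp m" c] by blast
  have x0: "x \<noteq> 0" using x assms n0 by (auto simp: power_0_left)
  have "c ^ Suc (p - 1) = c" using assms p_ge_2 by (simp add: GF_def)
  then have c1: "c ^ (p - 1) = 1" using assms by simp
  have "x ^ (p ^ m) = (x ^ norm_exp m) ^ (p - 1) * x"
    by (subst norm_exp_mult) (simp add: power_mult[symmetric] mult.commute)
  then have "x ^ (p ^ m) = x" by (simp only: x c1 mult_1)
  with x x0 show ?thesis by (auto simp: GF_def)
qed

lemma mchar_lift:
  assumes "mchar_nontriv p \<eta>" "m \<ge> 1"
  shows "mchar_nontriv (p ^ m) (\<lambda>x::'a. \<eta> (x ^ norm_exp m))"
proof -
  note \<eta> = mchar_nontriv_imp_mchar[OF assms(1)]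
  have n0: "norm_exp m > 0" using norm_exp_ge[of m] assms by simp
  obtain c where c: "c \<in> GF p" "c \<noteq> 0" "\<eta> c \<noteq> 1" using assms by (auto simp: mchar_nontriv_def)
  obtain x where "x \<in> GF (p ^ m)" "x \<noteq> 0" "x ^ norm_exp m = c" using norm_surj[OF assms(2) c(1,2)] by blast
  with c(3) have "\<exists>x\<in>GF (p ^ m). x \<noteq> 0 \<and> \<eta> (x ^ norm_exp m) \<noteq> 1" by blast
  moreover have "mchar (p ^ m) (\<lambda>x. \<eta> (x ^ norm_exp m))"
    unfolding mchar_def
    using n0 mchar_0[OF \<eta>] mchar_mult[OF \<eta> norm_in_GF norm_in_GF] mchar_norm[OF \<eta> norm_in_GF] assms(2)
    by (auto simp: power_0_left power_mult_distrib)
  ultimately show ?thesis by (simp add: mchar_nontriv_def)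
qed

lemma achar_lift:
  assumes "achar_nontriv p \<epsilon>" "m \<ge> 1"
  shows "achar_nontriv (p ^ m) (\<lambda>x. \<epsilon> (field_trace m x))"
proof -
  note \<epsilon> = achar_nontriv_imp_achar[OF assms(1)]
  obtain c where c: "c \<in> GF p" "\<epsilon> c \<noteq> 1" using assms by (auto simp: achar_nontriv_def)
  obtain x where "x \<in> GF (p ^ m)" "field_trace m x = c" using field_trace_surj[OF assms(2) c(1)] by blast
  with c(2) have "\<exists>x\<in>GF (p ^ m). \<epsilon> (field_trace m x) \<noteq> 1" by blast
  moreover have "achar (p ^ m) (\<lambda>x. \<epsilon> (field_trace m x))"
    unfolding achar_def
    using achar_add[OF \<epsilon> field_trace_in_GF field_trace_in_GF] achar_norm[OF \<epsilon> field_trace_in_GF]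
    by (auto simp: field_trace_add)
  ultimately show ?thesis by (simp add: achar_nontriv_def)
qed

text \<open>The substitution \<open>x = z\<^sup>p - z + x0\<close> absorbs the trace condition; it is \<open>p\<close>-to-one.\<close>

lemma stepanov_class_bound:
  fixes a b c :: 'a
  defines "n \<equiv> p - 1"
  assumes s: "s \<ge> 2 * n * (p + 1) + 2 * n * n + 2" and ab: "a \<noteq> 0" "b \<noteq> 0"
  shows "p * (n * n) * card {x \<in> GF (p ^ (2 * s)). x ^ norm_exp (2 * s) = a \<and> (x + 1) ^ norm_exp (2 * s) = b \<and> field_trace (2 * s) x = c}
    \<le> p ^ (2 * s) + (n * n + 4 * n * n * p + 2 * n * n * n * p) * p ^ s"
proof -
  define r R q Q where "r = p ^ s" and "R = norm_exp s" and "q = p ^ (2 * s)" and "Q = norm_exp (2 * s)"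
  define T where "T = {x \<in> GF q. x ^ Q = a \<and> (x + 1) ^ Q = b \<and> field_trace (2 * s) x = c}"
  \<comment> \<open>The condition \<open>n * (A + p + 1) < R\<close> allows \<open>A\<close> up to
    about R/n; half of that leaves room for the constant terms. \<open>B\<close> is about (r +
    E)/n^2, where \<open>(A + 1) * E\<close> pays for the degrees of the powers of \<open>Xp\<close>
    and \<open>Xp + 1\<close>.\<close>
  define E where "E = 4 * n * n * p"
  define A where "A = R div (2 * n)"
  define B where "B = (r + E) div (n * n)"
  have n1: "n \<ge> 1" using p_ge_2 by (simp add: n_def)
  have rR: "r = n * R + 1" using norm_exp_mult[of s] by (simp add: r_def R_def n_def)
  have q: "q = r * r" by (simp add: q_def r_def mult_2 power_add)
  have Q: "Q = R * (r + 1)" by (simp add: Q_def R_def r_def norm_exp_double)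
  have Rs: "R \<ge> 2 * n * (p + 1) + 2 * n * n + 2" using s norm_exp_ge[of s] by (simp add: R_def)
  have Rr: "R \<le> r" using rR mult_le_mono1[OF n1, of R] by linarith
  have nA: "2 * (n * A) \<le> R" unfolding A_def by (metis mult.assoc times_div_less_eq_dividend)
  have A1: "R < 2 * n * (A + 1)"
    using n1 dividend_less_times_div[of "2 * n" R] by (simp add: A_def algebra_simps)
  have nB: "n * n * B \<le> r + E" unfolding B_def by (rule times_div_less_eq_dividend)
  have B1: "r + E < n * n * (B + 1)"
    using n1 dividend_less_times_div[of "n * n" "r + E"] by (simp add: B_def algebra_simps)
  have BrE: "B \<le> r + E" unfolding B_def by (rule div_le_dividend)
  have c1: "n * (A + p + 1) < R"
  proof -
    have "2 * (n * (A + p + 1)) \<le> R + 2 * n * (p + 1)" using nA by (simp add: algebra_simps)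
    moreover have "2 * n * (p + 1) < R" using Rs by simp
    ultimately show ?thesis by linarith
  qed
  have c2: "r * A + B + 2 * ((n - 1) * (p * R)) + 1 < (A + 1) * (B + 1) * (n * n)"
  proof -
    have "(A + 1) * (r + E) \<le> (A + 1) * (n * n * (B + 1))" using B1 by (intro mult_le_mono2) simp
    also have "\<dots> = (A + 1) * (B + 1) * (n * n)" by (simp add: algebra_simps)
    finally have 1: "r * A + r + (A + 1) * E \<le> (A + 1) * (B + 1) * (n * n)" by (simp add: algebra_simps)
    have "2 * n * p * R \<le> 2 * n * p * (2 * n * (A + 1))" using A1 by (intro mult_le_mono2) simp
    also have "\<dots> = (A + 1) * E" by (simp add: E_def algebra_simps)
    finally have 2: "2 * n * p * R \<le> (A + 1) * E" .
    \<comment> \<open>The difference between \<open>n\<close> and \<open>n - 1\<close> frees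
      \<open>2 * p * R\<close>, which covers \<open>E + 1\<close>; with the spare \<open>r\<close>
      of the first inequality this absorbs \<open>B + 1\<close>.\<close>
    have 3: "2 * n * p * R = 2 * ((n - 1) * (p * R)) + 2 * p * R"
      using n1 by (cases n) (auto simp: algebra_simps)
    have "2 * p * (2 * n * n + 2) \<le> 2 * p * R" using Rs by (intro mult_le_mono2) linarith
    then have 4: "E + 1 < 2 * p * R" using p_ge_2 by (simp add: E_def algebra_simps)
    from 1 2 3 4 BrE show ?thesis by linarith
  qed
  have "p * card T * (n * n) \<le> q + (n * n + 4 * n * n * p + 2 * n * n * n * p) * r"
  proof (cases "T = {}")
    case False
    \<comment> \<open>A base point of the class: any other \<open>x\<close> in it has the same
      trace, so all solutions \<open>z\<close> of \<open>z ^ p - z = x - x0\<close> lie in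
      \<open>GF q\<close>.\<close>
    then obtain x0 where x0: "x0 \<in> T" by blast
    define Xp where "Xp = monom 1 p - [:0, 1:] + [:x0:]"
    define Z where "Z = {z. z ^ q = z \<and> poly Xp z ^ Q = a \<and> (poly Xp z + 1) ^ Q = b}"
    define fib where "fib = (\<lambda>x. {z::'a. z ^ p - z + x0 = x})"
    have polyX: "poly Xp z = z ^ p - z + x0" for z by (simp add: Xp_def poly_monom)
    have finq: "finite (GF q :: 'a set)" unfolding q_def using s by (intro card_GF) simp
    have finT: "finite T" using finq by (simp add: T_def)
    have finZ: "finite Z" using finq by (rule finite_subset[rotated]) (auto simp: Z_def GF_def)
    have fibZ: "fib x \<subseteq> Z" if "x \<in> T" for x
    proof
      fix z assume "z \<in> fib x"
      then have z: "z ^ p - z + x0 = x" by (simp add: fib_def)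
      then have "z ^ p - z = x - x0" by (simp add: algebra_simps)
      then have "z ^ (p ^ (2 * s)) - z = field_trace (2 * s) x - field_trace (2 * s) x0"
        by (metis field_trace_artin_schreier field_trace_diff)
      also have "\<dots> = 0" using that x0 by (simp add: T_def)
      finally have "z ^ q = z" by (simp add: q_def)
      then show "z \<in> Z" using that z by (simp add: Z_def polyX T_def)
    qed
    have cfib: "card (fib x) = p" for x
    proof -
      obtain z1 where z1: "z1 ^ p - z1 = x - x0" using artin_schreier_root by blast
      have "z \<in> fib x \<longleftrightarrow> z - z1 \<in> GF p" for z
      proof -
        have "(z - z1) ^ p = z ^ p - z1 ^ p" using frob_diff[of z z1 1] by simp
        moreover have "z1 ^ p = x - x0 + z1" using z1 by (simp add: algebra_simps)
        ultimately have "(z - z1) ^ p - (z - z1) = z ^ p - z + x0 - x" by simp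
        then have "(z - z1) ^ p = z - z1 \<longleftrightarrow> z ^ p - z + x0 = x" by (metis eq_iff_diff_eq_0)
        then show ?thesis by (simp add: fib_def GF_def)
      qed
      then have "bij_betw (\<lambda>z. z - z1) (fib x) (GF p)"
        by (intro bij_betwI[of _ _ _ "\<lambda>i. i + z1"]) auto
      then show ?thesis using bij_betw_same_card card_GF(2)[of 1] by fastforce
    qed
    have "card (\<Union>x\<in>T. fib x) = (\<Sum>x\<in>T. card (fib x))"
    proof (rule card_UN_disjoint)
      show "\<forall>x\<in>T. finite (fib x)" using fibZ finZ finite_subset by blast
      show "\<forall>x\<in>T. \<forall>y\<in>T. x \<noteq> y \<longrightarrow> fib x \<inter> fib y = {}" by (auto simp: fib_def)
    qed (rule finT)
    then have "p * card T = card (\<Union>x\<in>T. fib x)" by (simp add: cfib)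
    also have "\<dots> \<le> card Z" using fibZ finZ by (intro card_mono) auto
    also have "\<dots> \<le> A + r * B + 2 * ((n - 1) * (p * R))"
      unfolding Z_def Xp_def
      by (rule stepanov_count[OF CHAR_p prime_p _ rR q Q ab c1 c2]) (simp add: r_def)
    finally have "p * card T * (n * n) \<le> (A + r * B + 2 * ((n - 1) * (p * R))) * (n * n)"
      by (rule mult_le_mono1)
    also have "\<dots> = n * n * A + r * (n * n * B) + 2 * (n - 1) * p * R * (n * n)"
      by (simp add: add_mult_distrib add_mult_distrib2 mult_ac)
    also have "\<dots> \<le> n * n * r + r * (r + E) + 2 * n * p * r * (n * n)"
    proof (intro add_mono mult_le_mono order.refl nB Rr)
      show "A \<le> r" using Rr unfolding A_def by (meson div_le_dividend order.trans)
    qed simp_all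
    also have "\<dots> = q + (n * n + 4 * n * n * p + 2 * n * n * n * p) * r"
      by (simp add: q E_def algebra_simps)
    finally show ?thesis .
  qed simp
  then show ?thesis unfolding T_def q_def Q_def r_def by (simp add: mult_ac)
qed

text \<open>The upper bounds for all classes together with their exact total give matching lower bounds.\<close>

lemma mixed_sum_lift_bound:
  fixes \<eta> \<psi> \<epsilon> :: "'a \<Rightarrow> complex"
  assumes \<eta>: "mchar p \<eta>" and \<psi>: "mchar p \<psi>" and \<epsilon>: "achar_nontriv p \<epsilon>"
  defines "n \<equiv> p - 1"
  assumes s: "s \<ge> 2 * n * (p + 1) + 2 * n * n + 2"
  shows "cmod (mixed_sum (p ^ (2 * s)) (\<lambda>x. \<eta> (x ^ norm_exp (2 * s))) (\<lambda>x. \<psi> (x ^ norm_exp (2 * s))) (\<lambda>x. \<epsilon> (field_trace (2 * s) x)))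
    \<le> real (n * n + 4 * n * n * p + 2 * n * n * n * p + 2) * real (p ^ s)"
proof -
  define q Q where "q = p ^ (2 * s)" and "Q = norm_exp (2 * s)"
  define c0 where "c0 = n * n + 4 * n * n * p + 2 * n * n * n * p"
  define U :: "'a set" where "U = GF p - {0}"
  define V :: "'a set" where "V = GF p"
  define I where "I = U \<times> U \<times> V"
  define cl where "cl = (\<lambda>x::'a. (x ^ Q, (x + 1) ^ Q, field_trace (2 * s) x))"
  \<comment> \<open>At 0 and -1 the summand vanishes, through \<open>\<eta> 0\<close> or
    \<open>\<psi> 0\<close>; at every other point both norms are nonzero and the summand is a
    function of the class \<open>cl x\<close>.\<close>
  define F :: "'a set" where "F = GF q - {0, -1}"
  define N where "N = (\<lambda>abc. card {x \<in> F. cl x = abc})"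
  define w where "w = (\<lambda>(a, b, c). \<eta> a * \<psi> b * \<epsilon> c)"
  have s1: "s \<ge> 1" "2 * s \<ge> 1" using s by simp_all
  have n1: "n \<ge> 1" using p_ge_2 by (simp add: n_def)
  have finV: "finite V" "card V = p" using card_GF[of 1] by (simp_all add: V_def)
  have finU: "finite U" "card U = n"
    using card_GF[of 1] GF_0[of 1] by (simp_all add: U_def n_def)
  have finI: "finite I" "card I = n * n * p"
    using finU finV by (simp_all add: I_def card_cartesian_product)
  have finq: "finite (GF q :: 'a set)" "card (GF q :: 'a set) = q"
    using card_GF[OF s1(2)] by (simp_all add: q_def)
  have finF: "finite F" "card F = q - 2"
  proof -
    have "-1 \<in> (GF q :: 'a set)" "0 \<in> (GF q :: 'a set)" using GF_minus[of 1 "2 * s"] by (simp_all add: q_def)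
    then show "finite F" "card F = q - 2" using finq by (simp_all add: F_def card_Diff_subset)
  qed
  have Q0: "Q > 0" using norm_exp_ge[of "2 * s"] s1 by (simp add: Q_def)
  have clI: "cl x \<in> I" if "x \<in> F" for x
  proof -
    have x: "x \<in> GF q" "x \<noteq> 0" "x + 1 \<noteq> 0" using that by (auto simp: F_def add_eq_0_iff2)
    have x1: "x + 1 \<in> GF q" using x(1) unfolding q_def by (intro GF_add) simp_all
    show ?thesis
      using norm_in_GF[of x "2 * s"] norm_in_GF[of "x + 1" "2 * s"] field_trace_in_GF[of x "2 * s"] x x1 s1
      by (simp add: cl_def I_def U_def V_def q_def Q_def)
  qed
  have "mixed_sum q (\<lambda>x. \<eta> (x ^ Q)) (\<lambda>x. \<psi> (x ^ Q)) (\<lambda>x. \<epsilon> (field_trace (2 * s) x)) = (\<Sum>x\<in>F. w (cl x))"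
    unfolding mixed_sum_def F_def
    by (rule sum.mono_neutral_cong_right)
       (use finq Q0 mchar_0[OF \<eta>] mchar_0[OF \<psi>] in \<open>auto simp: w_def cl_def power_0_left\<close>)
  also have "\<dots> = (\<Sum>abc\<in>I. \<Sum>x\<in>{x \<in> F. cl x = abc}. w (cl x))"
    by (rule sum.group[symmetric]) (use finF finI clI in auto)
  also have "\<dots> = (\<Sum>abc\<in>I. of_nat (N abc) * w abc)"
    by (intro sum.cong refl) (simp add: N_def)
  finally have K: "mixed_sum q (\<lambda>x. \<eta> (x ^ Q)) (\<lambda>x. \<psi> (x ^ Q)) (\<lambda>x. \<epsilon> (field_trace (2 * s) x))
     = (\<Sum>abc\<in>I. of_nat (N abc) * w abc)" .
  have sumN: "(\<Sum>abc\<in>I. N abc) = q - 2"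
    using sum.group[of F I cl "\<lambda>_. 1::nat"] finF finI clI by (auto simp: N_def)
  have "(\<Sum>abc\<in>I. w abc) = (\<Sum>a\<in>U. \<Sum>b\<in>U. \<Sum>c\<in>V. \<eta> a * \<psi> b * \<epsilon> c)"
    by (simp add: I_def w_def sum.cartesian_product[symmetric])
  also have "\<dots> = 0"
    using sum_achar[of 1 \<epsilon>] \<epsilon> by (simp add: sum_distrib_left[symmetric] V_def)
  finally have w0: "(\<Sum>abc\<in>I. w abc) = 0" .
  have w1: "cmod (w abc) = 1" if "abc \<in> I" for abc
  proof -
    obtain a b c where abc: "abc = (a, b, c)" by (cases abc)
    then show ?thesis
      using that mchar_norm[OF \<eta>, of a] mchar_norm[OF \<psi>, of b]
        achar_norm[OF achar_nontriv_imp_achar[OF \<epsilon>], of c]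
      by (simp add: I_def w_def U_def V_def norm_mult)
  qed
  define \<kappa> where "\<kappa> = (real q + real c0 * real (p ^ s)) / real (p * (n * n))"
  have pos: "real (p * (n * n)) > 0" using n1 p_ge_2 by simp
  have Nle: "real (N abc) \<le> \<kappa>" if "abc \<in> I" for abc
  proof -
    obtain a b c where abc: "abc = (a, b, c)" by (cases abc)
    have ab: "a \<noteq> 0" "b \<noteq> 0" using that by (auto simp: abc I_def U_def)
    have "N abc \<le> card {x \<in> GF q. x ^ Q = a \<and> (x + 1) ^ Q = b \<and> field_trace (2 * s) x = c}"
      unfolding N_def abc cl_def F_def using finq by (intro card_mono) auto
    then have "p * (n * n) * N abc \<le> p * (n * n) * card {x \<in> GF q. x ^ Q = a \<and> (x + 1) ^ Q = b \<and> field_trace (2 * s) x = c}"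
      by (rule mult_le_mono2)
    also have "\<dots> \<le> q + c0 * p ^ s"
      using stepanov_class_bound[OF s[unfolded n_def] ab, of c] by (simp add: q_def Q_def c0_def n_def)
    finally have "real (p * (n * n)) * real (N abc) \<le> real q + real c0 * real (p ^ s)"
      by (metis of_nat_add of_nat_le_iff of_nat_mult)
    then show ?thesis unfolding \<kappa>_def using pos by (simp add: pos_le_divide_eq mult.commute)
  qed
  \<comment> \<open>The weights sum to 0, so \<open>\<kappa>\<close> may be subtracted from every
    count. Since \<open>\<kappa> - N\<close> is nonnegative, the sum of the moduli is exactly the
    total excess, of order \<open>p ^ s\<close>.\<close>
  have "(\<Sum>abc\<in>I. of_nat (N abc) * w abc) = (\<Sum>abc\<in>I. complex_of_real (real (N abc) - \<kappa>) * w abc)"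
  proof -
    have "(\<Sum>abc\<in>I. complex_of_real (real (N abc) - \<kappa>) * w abc) = (\<Sum>abc\<in>I. of_nat (N abc) * w abc) - \<kappa> * (\<Sum>abc\<in>I. w abc)"
      by (simp add: left_diff_distrib sum_subtractf sum_distrib_left)
    then show ?thesis by (simp add: w0)
  qed
  also have "cmod \<dots> \<le> (\<Sum>abc\<in>I. cmod (complex_of_real (real (N abc) - \<kappa>) * w abc))"
    by (rule norm_sum)
  also have "\<dots> = (\<Sum>abc\<in>I. \<kappa> - real (N abc))"
  proof (intro sum.cong refl)
    fix abc assume abc: "abc \<in> I"
    show "cmod (complex_of_real (real (N abc) - \<kappa>) * w abc) = \<kappa> - real (N abc)"
      unfolding norm_mult norm_of_real w1[OF abc] using Nle[OF abc] by simp
  qed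
  also have "\<dots> = real (n * n * p) * \<kappa> - real (\<Sum>abc\<in>I. N abc)"
    using finI by (simp add: sum_subtractf)
  also have "real (n * n * p) * \<kappa> = real q + real c0 * real (p ^ s)"
  proof -
    have e: "n * n * p = p * (n * n)" by (simp add: mult_ac)
    show ?thesis unfolding \<kappa>_def e using pos by (simp del: of_nat_mult of_nat_power)
  qed
  also have "real (\<Sum>abc\<in>I. N abc) = real q - 2"
    using q_ge_2[OF s1(2)] by (simp only: sumN) (simp add: q_def of_nat_diff)
  also have "real q + real c0 * real (p ^ s) - (real q - 2) \<le> real (c0 + 2) * real (p ^ s)"
    using q_ge_2[OF s1(1)] by (simp add: algebra_simps del: of_nat_power)
  finally show ?thesis using K by (simp add: q_def Q_def c0_def)
qed

text \<open>2 is a repelling fixed point of t^2 - 2. If \<open>k 0\<close> exceeded 2, doubling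
  would drive the normalized sums \<open>k j\<close> to infinity, while
  \<open>mixed_sum_lift_bound\<close> eventually keeps them below a constant depending only on
  \<open>p\<close>. The size of that constant is irrelevant, so crude estimates suffice on the
  Stepanov side.\<close>

theorem weil_mixed_bound:
  fixes \<eta> \<psi> \<epsilon> :: "'a \<Rightarrow> complex"
  assumes \<eta>: "mchar_nontriv p \<eta>" and \<psi>: "mchar_nontriv p \<psi>" and \<epsilon>: "achar_nontriv p \<epsilon>"
  shows "cmod (\<Sum>x\<in>GF p. \<eta> x * \<psi> (x + 1) * \<epsilon> x) \<le> 2 * sqrt (real p)"
proof (rule ccontr)
  define S where "S = (\<lambda>m. mixed_sum (p ^ m) (\<lambda>x. \<eta> (x ^ norm_exp m)) (\<lambda>x. \<psi> (x ^ norm_exp m)) (\<lambda>x. \<epsilon> (field_trace m x)))"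
  define k where "k = (\<lambda>j. cmod (S (2 ^ j)) / sqrt (real (p ^ (2 ^ j))))"
  assume neg: "\<not> ?thesis"
  have "S 1 = (\<Sum>x\<in>GF p. \<eta> x * \<psi> (x + 1) * \<epsilon> x)"
    by (simp add: S_def mixed_sum_def norm_exp_def field_trace_def)
  moreover have p0: "sqrt (real p) > 0" using p_ge_2 by simp
  ultimately have k0: "k 0 > 2" using neg by (simp add: k_def pos_less_divide_eq)
  have double: "(cmod (S m))\<^sup>2 - 2 * real (p ^ m) \<le> cmod (S (2 * m))" if m: "m \<ge> 1" for m
  proof -
    have e: "p ^ m * p ^ m = p ^ (2 * m)" by (simp add: mult_2 power_add)
    have "S (2 * m) = mixed_sum (p ^ m * p ^ m) (\<lambda>x. \<eta> ((x ^ (p ^ m + 1)) ^ norm_exp m))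
        (\<lambda>x. \<psi> ((x ^ (p ^ m + 1)) ^ norm_exp m)) (\<lambda>x. \<epsilon> (field_trace m (x + x ^ (p ^ m))))"
      unfolding S_def norm_exp_double field_trace_double e by (simp only: power_mult[symmetric] mult.commute)
    then show ?thesis
      using mixed_sum_doubling[OF m mchar_lift[OF \<eta> m] mchar_lift[OF \<psi> m] achar_lift[OF \<epsilon> m]]
      by (simp only: S_def)
  qed
  have kstep: "(k j)\<^sup>2 - 2 \<le> k (Suc j)" for j
  proof -
    let ?q = "real (p ^ (2 ^ j))"
    have q0: "?q > 0" using p_ge_2 by simp
    have "p ^ 2 ^ Suc j = (p ^ (2 ^ j)) * (p ^ (2 ^ j))" by (simp add: mult_2 power_add)
    then have sq: "sqrt (real (p ^ (2 ^ Suc j))) = ?q" using q0 by (simp del: of_nat_power)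
    have "(k j)\<^sup>2 = (cmod (S (2 ^ j)))\<^sup>2 / ?q"
      using q0 by (simp add: k_def power_divide del: of_nat_power)
    then have "(k j)\<^sup>2 - 2 = ((cmod (S (2 ^ j)))\<^sup>2 - 2 * ?q) / ?q"
      using q0 by (simp add: diff_divide_distrib del: of_nat_power)
    also have "\<dots> \<le> cmod (S (2 * 2 ^ j)) / ?q"
      using double[of "2 ^ j"] q0 by (intro divide_right_mono) (auto simp del: of_nat_power)
    also have "\<dots> = k (Suc j)" unfolding k_def sq by simp
    finally show ?thesis .
  qed
  define d where "d = k 0 - 2"
  have d: "d > 0" using k0 by (simp add: d_def)
  \<comment> \<open>(2 + y)^2 - 2 = 2 + 4 y + y^2, so the excess over 2 at least quadruples.\<close>
  have grow: "2 + 4 ^ j * d \<le> k j" for j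
  proof (induction j)
    case (Suc j)
    have "(2 + 4 ^ j * d)\<^sup>2 \<le> (k j)\<^sup>2" using Suc d by (intro power_mono) auto
    moreover have "2 + 4 ^ Suc j * d \<le> (2 + 4 ^ j * d)\<^sup>2 - 2"
      using d by (simp add: power2_eq_square algebra_simps)
    ultimately show ?case using kstep[of j] by linarith
  qed (simp add: d_def)
  define n where "n = p - 1"
  define C where "C = real (n * n + 4 * n * n * p + 2 * n * n * n * p + 2)"
  define s0 where "s0 = 2 * n * (p + 1) + 2 * n * n + 2"
  have upper: "k (Suc j) \<le> C" if "s0 \<le> 2 ^ j" for j
  proof -
    have "cmod (S (2 * 2 ^ j)) \<le> C * real (p ^ (2 ^ j))"
      unfolding S_def C_def n_def
      by (rule mixed_sum_lift_bound) (use \<eta> \<psi> \<epsilon> that in \<open>auto simp: s0_def n_def mchar_nontriv_def\<close>)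
    moreover have "p ^ 2 ^ Suc j = (p ^ (2 ^ j)) * (p ^ (2 ^ j))" by (simp add: mult_2 power_add)
    then have "sqrt (real (p ^ (2 ^ Suc j))) = real (p ^ (2 ^ j))" by (simp del: of_nat_power)
    moreover have "real (p ^ (2 ^ j)) > 0" using p_ge_2 by simp
    ultimately show ?thesis unfolding k_def by (simp add: pos_divide_le_eq del: of_nat_power)
  qed
  obtain j1 where j1: "C / d < 2 ^ j1" using real_arch_pow[of 2 "C / d"] by auto
  \<comment> \<open>\<open>s0\<close> makes \<open>upper\<close> applicable, \<open>j1\<close> makes
    \<open>4 ^ Suc j * d\<close> exceed \<open>C\<close>.\<close>
  define j where "j = j1 + s0"
  have "s0 \<le> 2 ^ j"
  proof -
    have "s0 \<le> j" by (simp add: j_def)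
    also have "j < 2 ^ j" by (rule less_exp)
    finally show ?thesis by simp
  qed
  then have "2 + 4 ^ Suc j * d \<le> C" using upper grow[of "Suc j"] by fastforce
  moreover have "(2::real) ^ j1 \<le> 4 ^ Suc j"
  proof -
    have "(2::real) ^ j1 \<le> 4 ^ j1" by (rule power_mono) auto
    also have "\<dots> \<le> 4 ^ Suc j" by (rule power_increasing) (auto simp: j_def)
    finally show ?thesis .
  qed
  then have "C < 4 ^ Suc j * d" using j1 d by (smt (verit) pos_divide_less_eq mult_right_mono)
  ultimately show False by simp
qed

end

section \<open>Character sums modulo a prime\<close>

definition modchar :: "nat \<Rightarrow> (int \<Rightarrow> complex) \<Rightarrow> bool" where
  "modchar p \<eta> \<longleftrightarrow> (\<forall>x y. \<eta> (x * y) = \<eta> x * \<eta> y) \<and> (\<forall>x. \<eta> (x + int p) = \<eta> x) \<and>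
     (\<forall>x. \<eta> x = 0 \<longleftrightarrow> int p dvd x)"

definition modchar_nontriv :: "nat \<Rightarrow> (int \<Rightarrow> complex) \<Rightarrow> bool" where
  "modchar_nontriv p \<eta> \<longleftrightarrow> modchar p \<eta> \<and> (\<exists>x. \<not> int p dvd x \<and> \<eta> x \<noteq> 1)"

definition ep :: "nat \<Rightarrow> int \<Rightarrow> complex" where
  "ep p x = cis (2 * pi * of_int x / real p)"

text \<open>A property of the number \<open>p\<close> alone, with no field type in it; this is what
  makes the final transfer to all primes possible. The additive twist by \<open>u\<close> is what
  completing an incomplete sum produces.\<close>

definition char_sum_bounds :: "nat \<Rightarrow> bool" where
  "char_sum_bounds p \<longleftrightarrow> (\<forall>\<eta> u. modchar_nontriv p \<eta> \<longrightarrow>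
     cmod (\<Sum>x\<in>{0..<int p}. \<eta> x * ep p (u * x)) \<le> sqrt (real p) \<and>
     (\<forall>\<psi> v. modchar_nontriv p \<psi> \<longrightarrow> \<not> int p dvd v \<longrightarrow>
       cmod (\<Sum>x\<in>{0..<int p}. \<eta> x * \<psi> (x + v) * ep p (u * x)) \<le> 2 * sqrt (real p)))"

lemma ep_add: "ep p (x + y) = ep p x * ep p y"
  by (simp add: ep_def cis_mult ring_distribs add_divide_distrib)

lemma ep_0 [simp]: "ep p 0 = 1"
  by (simp add: ep_def)

lemma norm_ep [simp]: "cmod (ep p x) = 1"
  by (simp add: ep_def)

lemma ep_power: "ep p (int k * x) = ep p x ^ k"
  by (induction k) (simp_all add: ep_add ring_distribs)

lemma ep_eq_1_iff:
  assumes "p > 0"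
  shows "ep p x = 1 \<longleftrightarrow> int p dvd x"
proof
  assume "ep p x = 1"
  then obtain k :: int where "2 * pi * of_int x / real p = of_int k * (2 * pi)"
    unfolding ep_def cis_conv_exp exp_eq_1 by auto
  then have "real_of_int x = of_int (k * int p)" using assms by (simp add: field_simps)
  then have "x = k * int p" by (simp only: of_int_eq_iff)
  then show "int p dvd x" by simp
next
  assume "int p dvd x"
  then obtain k where "x = int p * k" by (elim dvdE)
  then have "2 * pi * of_int x / real p = 2 * pi * of_int k" using assms by simp
  then show "ep p x = 1" by (simp only: ep_def cis_multiple_2pi Ints_of_int)
qed

lemma ep_cong:
  assumes "p > 0" "[x = y] (mod int p)"
  shows "ep p x = ep p y"
proof -
  have "int p dvd x - y" using assms by (simp add: cong_iff_dvd_diff)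
  then have "ep p (x - y) = 1" using assms by (simp add: ep_eq_1_iff)
  moreover have "ep p x = ep p (x - y) * ep p y" by (simp flip: ep_add)
  ultimately show ?thesis by simp
qed

lemma periodic_cong:
  fixes f :: "int \<Rightarrow> 'b"
  assumes per: "\<And>x. f (x + int p) = f x" and xy: "[x = y] (mod int p)"
  shows "f x = f y"
proof -
  have nat: "f (x + int k * int p) = f x" for x k
  proof (induction k)
    case (Suc k)
    have "x + int (Suc k) * int p = (x + int k * int p) + int p" by (simp add: algebra_simps)
    with Suc show ?case by (simp only: per)
  qed simp
  obtain k where k: "y = x + int p * k" using xy by (auto simp: cong_iff_lin)
  show ?thesis
  proof (cases "k \<ge> 0")
    case True
    then show ?thesis using nat[of x "nat k"] k by (simp add: mult.commute)
  next
    case False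
    then show ?thesis using nat[of y "nat (- k)"] k by (simp add: algebra_simps)
  qed
qed

lemma modchar_periodic: "modchar p \<eta> \<Longrightarrow> [x = y] (mod int p) \<Longrightarrow> \<eta> x = \<eta> y"
  by (rule periodic_cong[of \<eta> p]) (auto simp: modchar_def)

text \<open>By Fermat the value is a (p-1)-th root of unity.\<close>

lemma modchar_norm:
  assumes "prime p" "modchar p \<eta>" "\<not> int p dvd x"
  shows "cmod (\<eta> x) = 1"
proof -
  have 1: "\<eta> 1 = 1"
  proof -
    have "\<eta> 1 * \<eta> 1 = \<eta> (1 * 1)" using assms(2) unfolding modchar_def by metis
    moreover have "\<not> int p dvd 1" using prime_gt_1_nat[OF assms(1)] by simp
    then have "\<eta> 1 \<noteq> 0" using assms(2) unfolding modchar_def by blast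
    ultimately show ?thesis by simp
  qed
  have pw: "\<eta> (x ^ k) = \<eta> x ^ k" for k
    using 1 assms(2) by (induction k) (simp_all add: modchar_def)
  have "[x ^ (p - 1) = 1] (mod int p)"
  proof -
    have p0: "int p > 0" using prime_gt_0_nat[OF assms(1)] by simp
    let ?y = "nat (x mod int p)"
    have y: "int ?y = x mod int p" using p0 by simp
    have "\<not> p dvd ?y"
    proof
      assume "p dvd ?y"
      then have "int p dvd int ?y" by (simp only: int_dvd_int_iff)
      then show False using assms(3) unfolding y by (simp add: dvd_mod_iff)
    qed
    then have "[?y ^ (p - 1) = 1] (mod p)" by (rule fermat_theorem[OF assms(1)])
    then have "[int (?y ^ (p - 1)) = int 1] (mod int p)" by (simp only: cong_int_iff)
    then have "[(x mod int p) ^ (p - 1) = 1] (mod int p)" by (simp only: of_nat_power y of_nat_1)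
    moreover have "[(x mod int p) ^ (p - 1) = x ^ (p - 1)] (mod int p)"
      by (rule cong_pow) simp
    ultimately show ?thesis by (metis cong_sym cong_trans)
  qed
  then have "\<eta> x ^ (p - 1) = 1" using modchar_periodic[OF assms(2)] pw 1 by metis
  from power_eq_1_iff[OF this] show ?thesis using prime_gt_1_nat[OF assms(1)] by simp
qed

context prime_char
begin

lemma of_int_eq_iff_cong: "(of_int x :: 'a) = of_int y \<longleftrightarrow> [x = y] (mod int p)"
  using of_int_eq_iff_cong_CHAR[where 'a = 'a] CHAR_p by simp

lemma of_int_in_GF: "(of_int x :: 'a) \<in> GF p"
proof -
  have nat: "(of_nat k :: 'a) \<in> GF p" for k
    using GF_0[of 1] GF_1 GF_add[of _ 1] by (induction k) auto
  show ?thesis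
    by (cases x rule: int_cases2) (use nat GF_minus[of _ 1] in auto)
qed

lemma GF_p_eq: "bij_betw of_int {0..<int p} (GF p :: 'a set)"
proof -
  have inj: "inj_on (of_int :: int \<Rightarrow> 'a) {0..<int p}"
    by (rule inj_onI) (auto simp: of_int_eq_iff_cong unique_euclidean_semiring_class.cong_def)
  moreover have "of_int ` {0..<int p} = (GF p :: 'a set)"
  proof (rule card_subset_eq)
    show "finite (GF p :: 'a set)" using card_GF[of 1] by simp
    show "of_int ` {0..<int p} \<subseteq> (GF p :: 'a set)" using of_int_in_GF by auto
    show "card (of_int ` {0..<int p} :: 'a set) = card (GF p :: 'a set)"
      using card_image[OF inj] card_GF(2)[of 1] by simp
  qed
  ultimately show ?thesis by (simp add: bij_betw_def)
qed

lemma sum_GF_p: "(\<Sum>y\<in>GF p. g (y :: 'a)) = (\<Sum>x\<in>{0..<int p}. g (of_int x))"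
  using sum.reindex_bij_betw[OF GF_p_eq, of g] by simp

lemma GF_p_cases:
  assumes "y \<in> GF p"
  obtains x where "(y :: 'a) = of_int x"
  using assms GF_p_eq unfolding bij_betw_def by blast

text \<open>Reads a function on the integers as one on the prime field through an arbitrary integer
  representative; it is well defined for functions of period \<open>p\<close>.\<close>

definition lift_to_field :: "(int \<Rightarrow> complex) \<Rightarrow> 'a \<Rightarrow> complex" where
  "lift_to_field f y = f (SOME x. of_int x = y)"

lemma lift_to_field_of_int:
  assumes "\<And>x y. [x = y] (mod int p) \<Longrightarrow> f x = f y"
  shows "lift_to_field f (of_int x) = f x"
proof -
  have "(of_int (SOME x'. (of_int x' :: 'a) = of_int x) :: 'a) = of_int x" by (rule someI) simp
  then show ?thesis unfolding lift_to_field_def by (intro assms) (simp add: of_int_eq_iff_cong)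
qed

lemma of_int_eq_0_iff_dvd: "(of_int x :: 'a) = 0 \<longleftrightarrow> int p dvd x"
  using of_int_eq_iff_cong[of x 0] by (simp add: cong_0_iff)

lemma mchar_lift_to_field:
  assumes "modchar_nontriv p \<eta>"
  shows "mchar_nontriv p (lift_to_field \<eta>)"
proof -
  have \<eta>: "modchar p \<eta>" using assms by (simp add: modchar_nontriv_def)
  have L: "lift_to_field \<eta> (of_int x) = \<eta> x" for x by (rule lift_to_field_of_int) (rule modchar_periodic[OF \<eta>])
  obtain x where x: "\<not> int p dvd x" "\<eta> x \<noteq> 1" using assms by (auto simp: modchar_nontriv_def)
  have "mchar p (lift_to_field \<eta>)"
    unfolding mchar_def
  proof (intro conjI ballI impI)
    show "lift_to_field \<eta> 0 = 0" using L[of 0] \<eta> by (simp add: modchar_def)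
  next
    fix x y :: 'a assume "x \<in> GF p" "y \<in> GF p"
    then obtain a b where "x = of_int a" "y = of_int b" by (metis GF_p_cases)
    then show "lift_to_field \<eta> (x * y) = lift_to_field \<eta> x * lift_to_field \<eta> y"
      using L[of "a * b"] L \<eta> by (simp add: modchar_def)
  next
    fix x :: 'a assume "x \<in> GF p" "x \<noteq> 0"
    then obtain a where "x = of_int a" "\<not> int p dvd a" by (metis GF_p_cases of_int_eq_0_iff_dvd)
    then show "cmod (lift_to_field \<eta> x) = 1" using L modchar_norm[OF prime_p \<eta>] by simp
  qed
  moreover have "\<exists>c\<in>GF p. c \<noteq> 0 \<and> lift_to_field \<eta> c \<noteq> 1"
    using x L of_int_eq_0_iff_dvd of_int_in_GF by metis
  ultimately show ?thesis by (simp add: mchar_nontriv_def)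
qed

lemma achar_ep:
  shows "achar p (lift_to_field (\<lambda>x. ep p (u * x)))"
    and "\<not> int p dvd u \<Longrightarrow> achar_nontriv p (lift_to_field (\<lambda>x. ep p (u * x)))"
    and "lift_to_field (\<lambda>x. ep p (u * x)) (of_int x) = ep p (u * x)"
proof -
  have p0: "p > 0" using p_ge_2 by simp
  have L: "lift_to_field (\<lambda>x. ep p (u * x)) (of_int x) = ep p (u * x)" for x
    by (rule lift_to_field_of_int) (auto intro!: ep_cong p0 cong_mult)
  then show "lift_to_field (\<lambda>x. ep p (u * x)) (of_int x) = ep p (u * x)" .
  show ac: "achar p (lift_to_field (\<lambda>x. ep p (u * x)))"
    unfolding achar_def
  proof (intro conjI ballI)
    fix x y :: 'a assume "x \<in> GF p" "y \<in> GF p"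
    then obtain a b where "x = of_int a" "y = of_int b" by (metis GF_p_cases)
    then show "lift_to_field (\<lambda>x. ep p (u * x)) (x + y) = lift_to_field (\<lambda>x. ep p (u * x)) x * lift_to_field (\<lambda>x. ep p (u * x)) y"
      using L[of "a + b"] L by (simp add: ep_add ring_distribs)
  next
    fix x :: 'a assume "x \<in> GF p"
    then obtain a where "x = of_int a" by (metis GF_p_cases)
    then show "cmod (lift_to_field (\<lambda>x. ep p (u * x)) x) = 1" using L by simp
  qed
  assume "\<not> int p dvd u"
  then have "ep p (u * 1) \<noteq> 1" using p0 by (simp add: ep_eq_1_iff)
  then have "lift_to_field (\<lambda>x. ep p (u * x)) (of_int 1) \<noteq> 1" by (simp only: L) simp
  then show "achar_nontriv p (lift_to_field (\<lambda>x. ep p (u * x)))"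
    using ac of_int_in_GF[of 1] by (auto simp: achar_nontriv_def)
qed

text \<open>For trivial \<open>\<epsilon>\<close> the sum is a Jacobi sum, and
  \<open>achar_ep\<close> supplies the nontrivial additive character that
  \<open>jacobi_sum_le\<close> works with.\<close>

lemma mixed_sum_le:
  fixes \<eta> \<psi> \<epsilon> :: "'a \<Rightarrow> complex"
  assumes \<eta>: "mchar_nontriv p \<eta>" and \<psi>: "mchar_nontriv p \<psi>" and \<epsilon>: "achar p \<epsilon>"
  shows "cmod (\<Sum>x\<in>GF p. \<eta> x * \<psi> (x + 1) * \<epsilon> x) \<le> 2 * sqrt (real p)"
proof (cases "achar_nontriv p \<epsilon>")
  case True
  from weil_mixed_bound[OF \<eta> \<psi> True] show ?thesis .
next
  case False
  then have "\<epsilon> x = 1" if "x \<in> GF p" for x using \<epsilon> that by (auto simp: achar_nontriv_def)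
  then have e: "(\<Sum>x\<in>GF p. \<eta> x * \<psi> (x + 1) * \<epsilon> x) = (\<Sum>x\<in>GF p. \<eta> x * \<psi> (x + 1))" by simp
  have "\<not> int p dvd 1" using p_ge_2 by simp
  then have "cmod (\<Sum>x\<in>GF p. \<eta> x * \<psi> (x + 1)) \<le> sqrt (real p)"
    using jacobi_sum_le[of 1 \<eta> \<psi>] achar_ep(2)[of 1] \<eta> \<psi> by simp
  moreover have "sqrt (real p) \<le> 2 * sqrt (real p)" by simp
  ultimately show ?thesis unfolding e by linarith
qed

text \<open>Scaling \<open>x\<close> by \<open>v\<close> reduces the shift to 1: factors of modulus
  1 come out and \<open>\<epsilon>\<close> becomes another additive character.\<close>

lemma mixed_sum_shift_le:
  fixes \<eta> \<psi> \<epsilon> :: "'a \<Rightarrow> complex"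
  assumes \<eta>: "mchar_nontriv p \<eta>" and \<psi>: "mchar_nontriv p \<psi>" and \<epsilon>: "achar p \<epsilon>"
    and v: "v \<in> GF p" "v \<noteq> 0"
  shows "cmod (\<Sum>x\<in>GF p. \<eta> x * \<psi> (x + v) * \<epsilon> x) \<le> 2 * sqrt (real p)"
proof -
  note \<eta>' = mchar_nontriv_imp_mchar[OF \<eta>] and \<psi>' = mchar_nontriv_imp_mchar[OF \<psi>]
  have "(\<Sum>x\<in>GF p. \<eta> x * \<psi> (x + v) * \<epsilon> x) = (\<Sum>x\<in>GF p. \<eta> (v * x) * \<psi> (v * x + v) * \<epsilon> (v * x))"
    using sum_GF_mult[OF v, of "\<lambda>x. \<eta> x * \<psi> (x + v) * \<epsilon> x"] by simp
  also have "\<dots> = (\<Sum>x\<in>GF p. (\<eta> v * \<psi> v) * (\<eta> x * \<psi> (x + 1) * \<epsilon> (v * x)))"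
  proof (intro sum.cong refl)
    fix x :: 'a assume x: "x \<in> GF p"
    have "x + 1 \<in> GF p" using x GF_add[of x 1 1] by simp
    then have "\<psi> (v * x + v) = \<psi> v * \<psi> (x + 1)"
      using mchar_mult[OF \<psi>' v(1), of "x + 1"] by (simp add: algebra_simps)
    then show "\<eta> (v * x) * \<psi> (v * x + v) * \<epsilon> (v * x) = (\<eta> v * \<psi> v) * (\<eta> x * \<psi> (x + 1) * \<epsilon> (v * x))"
      using mchar_mult[OF \<eta>' v(1) x] by simp
  qed
  also have "\<dots> = (\<eta> v * \<psi> v) * (\<Sum>x\<in>GF p. \<eta> x * \<psi> (x + 1) * \<epsilon> (v * x))"
    by (simp add: sum_distrib_left)
  finally have "cmod (\<Sum>x\<in>GF p. \<eta> x * \<psi> (x + v) * \<epsilon> x) = cmod (\<Sum>x\<in>GF p. \<eta> x * \<psi> (x + 1) * \<epsilon> (v * x))"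
    using mchar_norm[OF \<eta>' v] mchar_norm[OF \<psi>' v] by (simp add: norm_mult)
  also have "\<dots> \<le> 2 * sqrt (real p)"
  proof (rule mixed_sum_le[OF \<eta> \<psi>])
    show "achar p (\<lambda>x. \<epsilon> (v * x))"
      unfolding achar_def using \<epsilon> v GF_mult[OF v(1)] by (auto simp: achar_def ring_distribs)
  qed
  finally show ?thesis .
qed

lemma char_sum_bounds_p: "char_sum_bounds p"
  unfolding char_sum_bounds_def
proof (intro allI impI conjI)
  fix \<eta> u assume \<eta>: "modchar_nontriv p \<eta>"
  have \<eta>': "modchar p \<eta>" using \<eta> by (simp add: modchar_nontriv_def)
  have L\<eta>: "lift_to_field \<eta> (of_int x) = \<eta> x" for x by (rule lift_to_field_of_int) (rule modchar_periodic[OF \<eta>'])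
  let ?\<epsilon> = "lift_to_field (\<lambda>x. ep p (u * x))"
  have "(\<Sum>x\<in>{0..<int p}. \<eta> x * ep p (u * x)) = (\<Sum>y\<in>GF p. lift_to_field \<eta> y * ?\<epsilon> y)"
    by (simp add: sum_GF_p L\<eta> achar_ep(3))
  also have "cmod \<dots> \<le> sqrt (real p)"
  proof (cases "int p dvd u")
    case True
    have "?\<epsilon> (of_int x) = 1" for x
      using True p_ge_2 by (simp add: achar_ep(3) ep_eq_1_iff)
    then have "?\<epsilon> y = 1" if "y \<in> GF p" for y using that by (metis GF_p_cases)
    then have "(\<Sum>y\<in>GF p. lift_to_field \<eta> y * ?\<epsilon> y) = (\<Sum>y\<in>GF p. lift_to_field \<eta> y)" by simp
    also have "\<dots> = 0" by (rule sum_mchar[OF mchar_lift_to_field[OF \<eta>]])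
    finally show ?thesis by simp
  next
    case False
    then show ?thesis
      using gauss_sum_norm[of 1 "lift_to_field \<eta>" ?\<epsilon>] mchar_lift_to_field[OF \<eta>] achar_ep(2)[OF False] by simp
  qed
  finally show "cmod (\<Sum>x\<in>{0..<int p}. \<eta> x * ep p (u * x)) \<le> sqrt (real p)" .
  fix \<psi> v assume \<psi>: "modchar_nontriv p \<psi>" and v: "\<not> int p dvd v"
  have \<psi>': "modchar p \<psi>" using \<psi> by (simp add: modchar_nontriv_def)
  have L\<psi>: "lift_to_field \<psi> (of_int x) = \<psi> x" for x by (rule lift_to_field_of_int) (rule modchar_periodic[OF \<psi>'])
  have "lift_to_field \<psi> (of_int x + of_int v) = \<psi> (x + v)" for x using L\<psi>[of "x + v"] by simp
  then have "(\<Sum>x\<in>{0..<int p}. \<eta> x * \<psi> (x + v) * ep p (u * x))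
      = (\<Sum>y\<in>GF p. lift_to_field \<eta> y * lift_to_field \<psi> (y + of_int v) * ?\<epsilon> y)"
    by (simp add: sum_GF_p L\<eta> achar_ep(3))
  also have "cmod \<dots> \<le> 2 * sqrt (real p)"
    by (rule mixed_sum_shift_le[OF mchar_lift_to_field[OF \<eta>] mchar_lift_to_field[OF \<psi>] achar_ep(1)])
       (use v of_int_in_GF in \<open>auto simp: of_int_eq_0_iff_dvd\<close>)
  finally show "cmod (\<Sum>x\<in>{0..<int p}. \<eta> x * \<psi> (x + v) * ep p (u * x)) \<le> 2 * sqrt (real p)" .
qed

end

section \<open>Incomplete sums\<close>

text \<open>The sine dominates a multiple of the distance from \<open>t\<close> to the nearest
  integer. Adding the reciprocals of \<open>t\<close> and \<open>1 - t\<close> avoids a case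
  distinction when this is summed over residues.\<close>

lemma sin_lower_bound:
  fixes t :: real
  assumes "0 < t" "t < 1"
  shows "1 / \<bar>sin (pi * t)\<bar> \<le> 2 * (1 / t + 1 / (1 - t))"
proof -
  \<comment> \<open>The cubic Taylor remainder and the crude \<open>y \<le> 2\<close>, from pi < 4,
    give \<open>sin y \<ge> y / 3\<close>.\<close>
  have half: "t / 2 \<le> sin (pi * t)" if t: "0 < t" "t \<le> 1 / 2" for t :: real
  proof -
    define y where "y = pi * t"
    have y: "0 < y" "y \<le> 2"
    proof -
      show "0 < y" using t by (simp add: y_def)
      have "pi * t \<le> 4 * (1 / 2)" using t pi_less_4 by (intro mult_mono) auto
      then show "y \<le> 2" by (simp add: y_def)
    qed
    have "\<bar>sin y - (\<Sum>m<3. sin_coeff m * y ^ m)\<bar> \<le> inverse (fact 3) * \<bar>y\<bar> ^ 3"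
      by (rule Maclaurin_sin_bound)
    then have "\<bar>sin y - y\<bar> \<le> y ^ 3 / 6"
      using y by (simp add: numeral_3_eq_3 sin_coeff_def fact_numeral)
    then have "y - y ^ 3 / 6 \<le> sin y" by linarith
    moreover have "y ^ 3 \<le> 4 * y"
    proof -
      have "y * y \<le> 2 * 2" using y by (intro mult_mono) auto
      then have "(y * y) * y \<le> 4 * y" using y by (intro mult_right_mono) auto
      then show ?thesis by (simp add: power3_eq_cube)
    qed
    ultimately have "y / 3 \<le> sin y" by simp
    moreover have "t / 2 \<le> y / 3"
    proof -
      have "2 * t \<le> pi * t" using t pi_ge_two by (intro mult_right_mono) auto
      then show ?thesis using t by (simp add: y_def)
    qed
    ultimately show ?thesis by (simp add: y_def)
  qed
  show ?thesis
  proof (cases "t \<le> 1 / 2")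
    case True
    have "t / 2 \<le> \<bar>sin (pi * t)\<bar>" using half[of t] True assms by linarith
    then have "1 / \<bar>sin (pi * t)\<bar> \<le> 1 / (t / 2)" using assms by (intro divide_left_mono mult_pos_pos) auto
    also have "\<dots> \<le> 2 * (1 / t + 1 / (1 - t))" using assms by simp
    finally show ?thesis .
  next
    case False
    have "sin (pi * (1 - t)) = sin (pi * t)" by (simp add: right_diff_distrib sin_diff)
    then have "(1 - t) / 2 \<le> \<bar>sin (pi * t)\<bar>" using half[of "1 - t"] False assms by fastforce
    then have "1 / \<bar>sin (pi * t)\<bar> \<le> 1 / ((1 - t) / 2)" using assms by (intro divide_left_mono mult_pos_pos) auto
    also have "\<dots> \<le> 2 * (1 / t + 1 / (1 - t))" using assms by simp
    finally show ?thesis .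
  qed
qed

lemma geometric_ep_bound:
  fixes A :: int and L :: nat and u :: int
  assumes u: "0 < u" "u < int p"
  shows "cmod (\<Sum>x\<in>{A..<A + int L}. ep p (- (u * x))) \<le> 2 * (real p / of_int u + real p / of_int (int p - u))"
proof -
  define w where "w = ep p (- u)"
  have p0: "p > 0" using u by simp
  have w1: "w \<noteq> 1" using u p0 by (simp add: w_def ep_eq_1_iff zdvd_not_zless)
  have "(\<Sum>x\<in>{A..<A + int L}. ep p (- (u * x))) = (\<Sum>j<L. ep p (- (u * A)) * w ^ j)"
  proof (rule sum.reindex_bij_witness[of _ "\<lambda>j. A + int j" "\<lambda>x. nat (x - A)"])
    fix x assume "x \<in> {A..<A + int L}"
    then have "- (u * x) = - (u * A) + int (nat (x - A)) * (- u)" by (simp add: algebra_simps)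
    then show "ep p (- (u * A)) * w ^ nat (x - A) = ep p (- (u * x))"
      by (simp only: ep_add ep_power w_def)
  qed auto
  also have "\<dots> = ep p (- (u * A)) * ((w ^ L - 1) / (w - 1))"
    using w1 by (simp add: sum_distrib_left[symmetric] geometric_sum)
  also have "cmod \<dots> = cmod (w ^ L - 1) / cmod (w - 1)" by (simp add: norm_mult norm_divide)
  also have "\<dots> \<le> 2 / cmod (w - 1)"
  proof (rule divide_right_mono)
    have "cmod (w ^ L - 1) \<le> cmod (w ^ L) + cmod 1" by (rule norm_triangle_ineq4)
    then show "cmod (w ^ L - 1) \<le> 2" by (simp add: w_def norm_power)
  qed simp
  also have "cmod (w - 1) = 2 * \<bar>sin (pi * (of_int u / real p))\<bar>"
  proof -
    have "w = exp (\<i> * of_real (- (2 * pi * of_int u / real p)))"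
      by (simp add: w_def ep_def cis_conv_exp)
    then have "cmod (w - 1) = 2 * \<bar>sin (- (2 * pi * of_int u / real p) / 2)\<bar>"
      by (simp only: dist_exp_i_1)
    then show ?thesis by simp
  qed
  also have "2 / (2 * \<bar>sin (pi * (of_int u / real p))\<bar>) = 1 / \<bar>sin (pi * (of_int u / real p))\<bar>" by simp
  also have "\<dots> \<le> 2 * (1 / (of_int u / real p) + 1 / (1 - of_int u / real p))"
    using u p0 by (intro sin_lower_bound) auto
  also have "1 / (1 - of_int u / real p) = real p / of_int (int p - u)"
    using u p0 by (simp add: field_simps)
  finally show ?thesis by simp
qed

lemma sum_ep:
  assumes p: "p > 0"
  shows "(\<Sum>k<p. ep p (int k * d)) = (if int p dvd d then of_nat p else 0)"
proof (cases "int p dvd d")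
  case True
  then have "ep p (int k * d) = 1" for k using p by (simp add: ep_eq_1_iff)
  then show ?thesis using True by simp
next
  case False
  have "(\<Sum>k<p. ep p (int k * d)) = (\<Sum>k<p. ep p d ^ k)" by (simp only: ep_power)
  also have "\<dots> = (ep p d ^ p - 1) / (ep p d - 1)"
    using False p by (intro geometric_sum) (simp add: ep_eq_1_iff)
  also have "ep p d ^ p = 1" using p by (simp add: ep_eq_1_iff flip: ep_power)
  finally show ?thesis using False by simp
qed

text \<open>Polya-Vinogradov completion: the finite Fourier expansion of \<open>f\<close> turns the
  interval sum into complete twisted sums, each at most \<open>B\<close>, weighted by geometric sums
  whose moduli add up to O(p log p).\<close>

lemma incomplete_sum_bound:
  fixes f :: "int \<Rightarrow> complex" and A :: int and L p :: nat
  assumes p: "p > 0" and per: "\<And>x. f (x + int p) = f x"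
    and bd: "\<And>u. cmod (\<Sum>x\<in>{0..<int p}. f x * ep p (u * x)) \<le> B" and L: "L \<le> p"
  shows "cmod (\<Sum>x\<in>{A..<A + int L}. f x) \<le> B * (5 + 4 * ln (real p))"
proof -
  let ?P = "{0..<int p}" and ?I = "{A..<A + int L}"
  have B0: "B \<ge> 0" using bd[of 0] norm_ge_zero order.trans by blast
  have orth: "(\<Sum>u\<in>?P. ep p (u * d)) = (if int p dvd d then of_nat p else 0)" for d
  proof -
    have "(\<Sum>u\<in>?P. ep p (u * d)) = (\<Sum>k<p. ep p (int k * d))"
      by (rule sum.reindex_bij_witness[of _ int nat]) auto
    then show ?thesis using p by (simp add: sum_ep)
  qed
  have pt: "of_nat p * f x = (\<Sum>y\<in>?P. \<Sum>u\<in>?P. f y * ep p (u * y) * ep p (- (u * x)))" for x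
  proof -
    have "(\<Sum>y\<in>?P. \<Sum>u\<in>?P. f y * ep p (u * y) * ep p (- (u * x))) = (\<Sum>y\<in>?P. f y * (\<Sum>u\<in>?P. ep p (u * (y - x))))"
      unfolding sum_distrib_left by (intro sum.cong refl) (simp add: right_diff_distrib flip: ep_add)
    also have "\<dots> = (\<Sum>y\<in>?P. if y = x mod int p then of_nat p * f x else 0)"
    proof (intro sum.cong refl)
      fix y assume y: "y \<in> ?P"
      have "int p dvd y - x \<longleftrightarrow> y = x mod int p"
        using y by (auto simp: mod_eq_dvd_iff[symmetric])
      moreover have "f (x mod int p) = f x" by (rule periodic_cong[of f p, OF per]) simp
      ultimately show "f y * (\<Sum>u\<in>?P. ep p (u * (y - x))) = (if y = x mod int p then of_nat p * f x else 0)"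
        by (auto simp: orth)
    qed
    also have "\<dots> = of_nat p * f x" using p by simp
    finally show ?thesis by simp
  qed
  have "of_nat p * (\<Sum>x\<in>?I. f x) = (\<Sum>x\<in>?I. \<Sum>y\<in>?P. \<Sum>u\<in>?P. f y * ep p (u * y) * ep p (- (u * x)))"
    by (simp only: sum_distrib_left pt)
  also have "\<dots> = (\<Sum>x\<in>?I. \<Sum>u\<in>?P. (\<Sum>y\<in>?P. f y * ep p (u * y)) * ep p (- (u * x)))"
    unfolding sum_distrib_right by (rule sum.cong[OF refl], rule sum.swap)
  also have "\<dots> = (\<Sum>u\<in>?P. (\<Sum>y\<in>?P. f y * ep p (u * y)) * (\<Sum>x\<in>?I. ep p (- (u * x))))"
    by (subst sum.swap) (simp only: sum_distrib_left)
  finally have eq: "of_nat p * (\<Sum>x\<in>?I. f x)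
     = (\<Sum>u\<in>?P. (\<Sum>y\<in>?P. f y * ep p (u * y)) * (\<Sum>x\<in>?I. ep p (- (u * x))))" .
  \<comment> \<open>\<open>u = 0\<close> contributes at most \<open>p\<close> as
    \<open>L \<le> p\<close>, and the other residues four times \<open>p\<close> times a harmonic
    sum; divided by \<open>p\<close> this is at most 1 + 4 (1 + ln p).\<close>
  define g where "g = (\<lambda>u::int. if u = 0 then real p else 2 * (real p / of_int u + real p / of_int (int p - u)))"
  have gb: "cmod (\<Sum>x\<in>?I. ep p (- (u * x))) \<le> g u" if "u \<in> ?P" for u
  proof (cases "u = 0")
    case True
    then show ?thesis using L by (simp add: g_def)
  next
    case False
    then show ?thesis using geometric_ep_bound[of u p A L] that by (simp add: g_def)
  qed
  have "real p * cmod (\<Sum>x\<in>?I. f x) = cmod (of_nat p * (\<Sum>x\<in>?I. f x))" by (simp add: norm_mult)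
  also have "\<dots> \<le> (\<Sum>u\<in>?P. cmod ((\<Sum>y\<in>?P. f y * ep p (u * y)) * (\<Sum>x\<in>?I. ep p (- (u * x)))))"
    unfolding eq by (rule norm_sum)
  also have "\<dots> \<le> (\<Sum>u\<in>?P. B * g u)"
    unfolding norm_mult using bd gb B0 by (intro sum_mono mult_mono) auto
  also have "\<dots> = B * (\<Sum>u\<in>?P. g u)" by (simp add: sum_distrib_left)
  also have "(\<Sum>u\<in>?P. g u) \<le> real p * (5 + 4 * ln (real p))"
  proof -
    have "(\<Sum>u\<in>?P. g u) = g 0 + (\<Sum>u\<in>{1..<int p}. g u)"
    proof -
      have "?P = insert 0 {1..<int p}" using p by auto
      then show ?thesis by simp
    qed
    also have "(\<Sum>u\<in>{1..<int p}. g u) = 2 * ((\<Sum>u\<in>{1..<int p}. real p / of_int u) + (\<Sum>u\<in>{1..<int p}. real p / of_int (int p - u)))"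
      by (simp add: g_def sum_distrib_left sum.distrib ring_distribs)
    also have "(\<Sum>u\<in>{1..<int p}. real p / of_int (int p - u)) = (\<Sum>u\<in>{1..<int p}. real p / of_int u)"
      by (rule sum.reindex_bij_witness[of _ "\<lambda>u. int p - u" "\<lambda>u. int p - u"]) auto
    also have "(\<Sum>u\<in>{1..<int p}. real p / of_int u) = real p * (\<Sum>k\<in>{1..<p}. inverse (real k))"
      unfolding sum_distrib_left
      by (rule sum.reindex_bij_witness[of _ int nat]) (auto simp: divide_inverse)
    also have "g 0 + 2 * (real p * (\<Sum>k\<in>{1..<p}. inverse (real k)) + real p * (\<Sum>k\<in>{1..<p}. inverse (real k)))
       = real p * (1 + 4 * (\<Sum>k\<in>{1..<p}. inverse (real k)))" by (simp add: g_def algebra_simps)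
    also have "\<dots> \<le> real p * (5 + 4 * ln (real p))"
    proof -
      have "(\<Sum>k\<in>{1..<p}. inverse (real k)) \<le> harm p"
        unfolding harm_def by (rule sum_mono2) auto
      also have "harm p \<le> 1 + ln (real p)"
        using euler_mascheroni_sequence_decreasing[of 1 p] p by (simp add: harm_def)
      finally show ?thesis by (intro mult_left_mono) auto
    qed
    finally show ?thesis .
  qed
  finally have "real p * cmod (\<Sum>x\<in>?I. f x) \<le> real p * (B * (5 + 4 * ln (real p)))"
    using B0 by (simp add: mult_left_mono mult.left_commute)
  then show ?thesis using p by simp
qed

section \<open>Cyclotomic sequences\<close>

lemma ep_nonzero [simp]: "ep p x \<noteq> 0"
  by (metis norm_ep norm_zero zero_neq_one)

lemma sum_period_shift:
  fixes f :: "int \<Rightarrow> 'b::comm_monoid_add"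
  assumes p: "p > 0" and per: "\<And>x. f (x + int p) = f x"
  shows "(\<Sum>x\<in>{A..<A + int p}. f x) = (\<Sum>x\<in>{0..<int p}. f x)"
proof (rule sum.reindex_bij_witness[of _ "\<lambda>y. A + (y - A) mod int p" "\<lambda>x. x mod int p"])
  fix x assume x: "x \<in> {A..<A + int p}"
  have "(x mod int p - A) mod int p = (x - A) mod int p" by (simp add: mod_diff_left_eq)
  then show "A + (x mod int p - A) mod int p = x" using x by simp
  show "x mod int p \<in> {0..<int p}" using p by simp
  show "f (x mod int p) = f x" by (rule periodic_cong[of f p, OF per]) simp
next
  fix y assume y: "y \<in> {0..<int p}"
  show "A + (y - A) mod int p \<in> {A..<A + int p}" using p by simp
  have "(A + (y - A) mod int p) mod int p = (A + (y - A)) mod int p" by (simp add: mod_add_right_eq)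
  then show "(A + (y - A) mod int p) mod int p = y" using y by simp
qed

text \<open>Limits the places where unimodularization can matter: two solutions would differ by a
  multiple of \<open>p\<close> smaller than \<open>p\<close>.\<close>

lemma card_multiples_in_interval:
  fixes A v :: int
  assumes "L \<le> p"
  shows "card {x \<in> {A..<A + int L}. int p dvd x + v} \<le> 1"
proof -
  have "x = y" if "x \<in> {A..<A + int L}" "y \<in> {A..<A + int L}" "int p dvd x + v" "int p dvd y + v" for x y
  proof -
    have "int p dvd (x + v) - (y + v)" using that by (intro dvd_diff) auto
    then have "int p dvd x - y" by simp
    moreover have "\<bar>x - y\<bar> < int p" using that assms by auto
    ultimately show ?thesis using dvd_imp_le_int[of "x - y" "int p"] by force
  qed
  moreover have "finite {x \<in> {A..<A + int L}. int p dvd x + v}"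
    by (rule finite_subset[of _ "{A..<A + int L}"]) auto
  ultimately show ?thesis by (simp only: One_nat_def card_le_Suc0_iff_eq) blast
qed

lemma dvd_residue_iff:
  assumes "x \<in> {0..<int p}"
  shows "int p dvd x \<longleftrightarrow> x = 0" "int p dvd x + 1 \<longleftrightarrow> x = int p - 1"
proof -
  show "int p dvd x \<longleftrightarrow> x = 0"
  proof
    assume "int p dvd x"
    then have "\<not> (0 < x \<and> x < int p)" using zdvd_not_zless by blast
    then show "x = 0" using assms by simp
  qed simp
  show "int p dvd x + 1 \<longleftrightarrow> x = int p - 1"
  proof
    assume "int p dvd x + 1"
    then have "\<not> (0 < x + 1 \<and> x + 1 < int p)" using zdvd_not_zless by blast
    then show "x = int p - 1" using assms by simp
  qed simp
qed

text \<open>The factor 1/n sits in the forward transform, so the value at 0 is the mean of the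
  pattern, and for \<open>n \<ge> 1\<close> balance says \<open>dft n d 0 = 0\<close>.\<close>

definition dft :: "nat \<Rightarrow> (nat \<Rightarrow> complex) \<Rightarrow> nat \<Rightarrow> complex" where
  "dft n d l = (\<Sum>k<n. d k * ep n (- (int l * int k))) / of_nat n"

lemma dft_0: "dft n d 0 = (\<Sum>k<n. d k) / of_nat n"
  by (simp add: dft_def)

lemma norm_dft_le:
  assumes "n \<ge> 1" "\<And>k. k < n \<Longrightarrow> cmod (d k) \<le> 1"
  shows "cmod (dft n d l) \<le> 1"
proof -
  have "cmod (\<Sum>k<n. d k * ep n (- (int l * int k))) \<le> (\<Sum>k<n. 1)"
    by (rule sum_norm_le) (use assms in \<open>simp add: norm_mult\<close>)
  then show ?thesis using assms(1) by (simp add: dft_def norm_divide)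
qed

lemma dft_inverse:
  assumes "n \<ge> 1" "k < n"
  shows "(\<Sum>l<n. dft n d l * ep n (int l * int k)) = d k"
proof -
  have "of_nat n * (\<Sum>l<n. dft n d l * ep n (int l * int k))
     = (\<Sum>l<n. (of_nat n * dft n d l) * ep n (int l * int k))"
    by (simp add: sum_distrib_left mult.assoc)
  also have "\<dots> = (\<Sum>l<n. \<Sum>j<n. d j * ep n (- (int l * int j)) * ep n (int l * int k))"
    using assms by (simp add: dft_def sum_distrib_right)
  also have "\<dots> = (\<Sum>l<n. \<Sum>j<n. d j * ep n (int l * (int k - int j)))"
    by (simp add: mult.assoc right_diff_distrib flip: ep_add)
  also have "\<dots> = (\<Sum>j<n. d j * (\<Sum>l<n. ep n (int l * (int k - int j))))"
    by (subst sum.swap) (simp add: sum_distrib_left)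
  also have "\<dots> = (\<Sum>j<n. if j = k then of_nat n * d k else 0)"
  proof (intro sum.cong refl)
    fix j assume j: "j \<in> {..<n}"
    have "int n dvd int k - int j \<longleftrightarrow> j = k"
    proof
      assume "int n dvd int k - int j"
      then have "int k mod int n = int j mod int n" by (simp add: mod_eq_dvd_iff)
      then show "j = k" using j assms by simp
    qed simp
    then show "d j * (\<Sum>l<n. ep n (int l * (int k - int j))) = (if j = k then of_nat n * d k else 0)"
      using assms by (simp add: sum_ep)
  qed
  also have "\<dots> = of_nat n * d k" using assms by simp
  finally show ?thesis using assms by simp
qed

text \<open>The character sum estimates enter as the assumption \<open>csb\<close>, discharged only
  in the final theorem, so that this part is independent of field types.\<close>

locale cyclotomy =
  fixes n a p :: nat
  assumes prime_p: "prime p" and n_ge_1: "n \<ge> 1" and p_cong: "[p = 1] (mod n)"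
    and primroot: "residue_primroot p a" and csb: "char_sum_bounds p"
begin

lemma p_gt_1: "p > 1"
  using prime_p by (rule prime_gt_1_nat)

lemma sqrt_p_ge_1: "1 \<le> sqrt (real p)"
  using p_gt_1 by simp

lemma n_dvd: "n dvd p - 1"
proof -
  have "[int p = int 1] (mod int n)" using p_cong by (simp only: cong_int_iff)
  then have "int n dvd int p - int 1" by (simp only: cong_iff_dvd_diff)
  then have "int n dvd int (p - 1)" using p_gt_1 by (simp add: of_nat_diff)
  then show ?thesis by (simp only: int_dvd_int_iff)
qed

lemma a_coprime: "\<not> int p dvd int a ^ i"
proof
  assume "int p dvd int a ^ i"
  then have "p dvd a ^ i" by (simp flip: of_nat_power)
  moreover have "coprime p a" using primroot by (simp add: residue_primroot_def)
  then have "coprime p (a ^ i)" by simp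
  ultimately have "p dvd 1" using coprime_common_divisor[of p "a ^ i" p] by simp
  then show False using p_gt_1 by simp
qed

lemma dlog_exists:
  assumes "\<not> int p dvd h"
  obtains i where "[h = int a ^ i] (mod int p)"
proof -
  let ?y = "nat (h mod int p)"
  have p0: "int p > 0" using p_gt_1 by simp
  have y: "int ?y = h mod int p" using p0 by simp
  have "?y \<noteq> 0" using assms unfolding dvd_eq_mod_eq_0 by (metis y of_nat_0)
  moreover have "?y < p" using p0 y by (metis of_nat_less_iff pos_mod_bound)
  ultimately have "?y \<in> totatives p"
    using prime_p by (simp add: totatives_prime)
  moreover have "(\<lambda>i. a ^ i mod p) ` {..<totient p} = totatives p"
    using residue_primroot_is_generator[OF p_gt_1 primroot] by (simp add: bij_betw_def)
  ultimately obtain i where "?y = a ^ i mod p" by blast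
  then have "h mod int p = int a ^ i mod int p" using y by (simp add: of_nat_mod of_nat_power)
  then show ?thesis using that by (simp add: unique_euclidean_semiring_class.cong_def)
qed

text \<open>Exponents are determined modulo \<open>ord p a = p - 1\<close>, hence modulo its divisor
  \<open>n\<close>.\<close>

lemma dlog_unique:
  assumes "[int a ^ i = int a ^ j] (mod int p)"
  shows "i mod n = j mod n"
proof -
  have "[int (a ^ i) = int (a ^ j)] (mod int p)" using assms by simp
  then have "[a ^ i = a ^ j] (mod p)" by (simp only: cong_int_iff)
  then have "[i = j] (mod ord p a)"
    using primroot by (subst (asm) order_divides_expdiff) (auto simp: residue_primroot_def)
  moreover have "ord p a = p - 1"
    using primroot prime_p by (simp add: residue_primroot_def totient_prime)
  ultimately have "[i = j] (mod n)" using n_dvd by (metis cong_dvd_modulus_nat)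
  then show ?thesis by (simp add: unique_euclidean_semiring_class.cong_def)
qed

text \<open>The choice made inside \<open>cyc_seq\<close>, kept verbatim; \<open>idx_eq\<close>
  identifies it as the discrete logarithm to base \<open>a\<close>, reduced modulo
  \<open>n\<close>.\<close>

definition idx :: "int \<Rightarrow> nat" where
  "idx h = (THE k. k < n \<and> (\<exists>y::int. [h = int a ^ k * y ^ n] (mod int p)))"

lemma idx_eq:
  assumes "[h = int a ^ i] (mod int p)"
  shows "idx h = i mod n"
  unfolding idx_def
proof (rule the_equality)
  have "int a ^ i = int a ^ (i mod n) * (int a ^ (i div n)) ^ n"
    by (simp flip: power_mult power_add)
  then show "i mod n < n \<and> (\<exists>y::int. [h = int a ^ (i mod n) * y ^ n] (mod int p))"
    using assms n_ge_1 by auto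
next
  fix k assume k: "k < n \<and> (\<exists>y::int. [h = int a ^ k * y ^ n] (mod int p))"
  then obtain y :: int where y: "[h = int a ^ k * y ^ n] (mod int p)" by blast
  have "\<not> int p dvd y"
  proof
    assume "int p dvd y"
    then have "int p dvd int a ^ k * y ^ n" using n_ge_1 by (simp add: dvd_power dvd_trans)
    then have "int p dvd h" using y by (simp add: cong_dvd_iff)
    then have "int p dvd int a ^ i" using assms by (simp add: cong_dvd_iff)
    then show False using a_coprime by blast
  qed
  then obtain j where j: "[y = int a ^ j] (mod int p)" by (rule dlog_exists)
  have "[int a ^ k * y ^ n = int a ^ k * (int a ^ j) ^ n] (mod int p)"
    using j by (intro cong_mult cong_pow) auto
  then have "[int a ^ i = int a ^ (k + j * n)] (mod int p)"
    using assms y by (metis cong_sym cong_trans power_add power_mult)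
  then have "i mod n = (k + j * n) mod n" by (rule dlog_unique)
  then show "k = i mod n" using k by simp
qed

lemma idx_less: "\<not> int p dvd h \<Longrightarrow> idx h < n"
  using dlog_exists[of h] idx_eq n_ge_1 by (metis mod_less_divisor less_le_trans zero_less_one)

lemma cyc_seq_eq: "cyc_seq n a p d h = (if int p dvd h then 0 else d (idx h))"
  by (simp add: cyc_seq_def idx_def cong_0_iff)

text \<open>The \<open>l\<close>-th power of the character of order \<open>n\<close> that sends
  \<open>a\<close> to \<open>ep n 1\<close>; it is 0 at multiples of \<open>p\<close> even for
  \<open>l = 0\<close>.\<close>

definition cyc_char :: "nat \<Rightarrow> int \<Rightarrow> complex" where
  "cyc_char l h = (if int p dvd h then 0 else ep n (int l * int (idx h)))"

lemma cyc_char_eq: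
  assumes "[h = int a ^ i] (mod int p)"
  shows "cyc_char l h = ep n (int l * int i)"
proof -
  have "\<not> int p dvd h" using assms a_coprime by (simp add: cong_dvd_iff)
  moreover have "ep n (int l * int (i mod n)) = ep n (int l * int i)"
    using n_ge_1 by (intro ep_cong cong_mult) (auto simp: of_nat_mod)
  ultimately show ?thesis using idx_eq[OF assms] by (simp add: cyc_char_def)
qed

lemma modchar_cyc_char: "modchar p (cyc_char l)"
  unfolding modchar_def
proof (intro conjI allI)
  fix x y
  show "cyc_char l (x * y) = cyc_char l x * cyc_char l y"
  proof (cases "int p dvd x * y")
    case True
    then have "int p dvd x \<or> int p dvd y" using prime_p by (simp add: prime_dvd_mult_iff)
    then show ?thesis using True by (auto simp: cyc_char_def)
  next
    case False
    then have "\<not> int p dvd x" "\<not> int p dvd y" by auto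
    then obtain i j where ij: "[x = int a ^ i] (mod int p)" "[y = int a ^ j] (mod int p)"
      by (metis dlog_exists)
    then have "[x * y = int a ^ (i + j)] (mod int p)" unfolding power_add by (rule cong_mult)
    then show ?thesis using ij by (simp add: cyc_char_eq ep_add ring_distribs)
  qed
next
  fix x
  show "cyc_char l (x + int p) = cyc_char l x"
  proof (cases "int p dvd x")
    case True
    then show ?thesis by (simp add: cyc_char_def)
  next
    case False
    then obtain i where i: "[x = int a ^ i] (mod int p)" by (rule dlog_exists)
    then have "[x + int p = int a ^ i] (mod int p)" by (simp add: unique_euclidean_semiring_class.cong_def)
    then show ?thesis using i by (simp add: cyc_char_eq)
  qed
  show "cyc_char l x = 0 \<longleftrightarrow> int p dvd x"
    by (simp add: cyc_char_def)
qed

lemma modchar_nontriv_cyc_char: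
  assumes "0 < l" "l < n"
  shows "modchar_nontriv p (cyc_char l)"
proof -
  have "cyc_char l (int a) = ep n (int l * int 1)" by (rule cyc_char_eq) simp
  moreover have "\<not> int n dvd int l" using assms by (simp add: nat_dvd_not_less)
  ultimately have "cyc_char l (int a) \<noteq> 1" using n_ge_1 by (simp add: ep_eq_1_iff)
  moreover have "\<not> int p dvd int a" using a_coprime[of 1] by simp
  ultimately show ?thesis unfolding modchar_nontriv_def using modchar_cyc_char by blast
qed

lemma modchar_nontriv_cnj_cyc_char:
  assumes "0 < l" "l < n"
  shows "modchar_nontriv p (\<lambda>x. cnj (cyc_char l x))"
  using modchar_nontriv_cyc_char[OF assms] by (auto simp: modchar_nontriv_def modchar_def)

lemma cyc_char_periodic: "cyc_char l (x + int p) = cyc_char l x"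
  using modchar_cyc_char by (simp add: modchar_def)

lemma norm_cyc_char: "cmod (cyc_char l x) = (if int p dvd x then 0 else 1)"
  by (simp add: cyc_char_def)

text \<open>Fourier inversion at the index of \<open>h\<close>. Multiples of \<open>p\<close> need
  no exception because every \<open>cyc_char l\<close>, the trivial one included, vanishes
  there.\<close>

lemma cyc_seq_dft: "cyc_seq n a p d h = (\<Sum>l<n. dft n d l * cyc_char l h)"
proof (cases "int p dvd h")
  case False
  then show ?thesis using dft_inverse[OF n_ge_1 idx_less[OF False], of d]
    by (simp add: cyc_seq_eq cyc_char_def)
qed (simp add: cyc_seq_eq cyc_char_def)

lemma cyc_seq_periodic: "cyc_seq n a p d (x + int p) = cyc_seq n a p d x"
  by (simp add: cyc_seq_dft cyc_char_periodic)

section \<open>Interval and correlation sums of cyclotomic sequences: upper bounds and main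
  terms\<close>

lemma gauss_bound:
  assumes "modchar_nontriv p \<eta>"
  shows "cmod (\<Sum>x\<in>{0..<int p}. \<eta> x * ep p (u * x)) \<le> sqrt (real p)"
  using csb assms by (simp add: char_sum_bounds_def)

lemma mixed_bound:
  assumes "modchar_nontriv p \<eta>" "modchar_nontriv p \<psi>" "\<not> int p dvd v"
  shows "cmod (\<Sum>x\<in>{0..<int p}. \<eta> x * \<psi> (x + v) * ep p (u * x)) \<le> 2 * sqrt (real p)"
  using csb assms by (simp add: char_sum_bounds_def)

definition log_factor :: real where "log_factor = 5 + 4 * ln (real p)"

lemma log_factor_ge_0: "log_factor \<ge> 0"
  using p_gt_1 by (simp add: log_factor_def)

text \<open>The zero mean removes \<open>l = 0\<close>; the interval sum of each remaining,
  nontrivial character is completed to Gauss sums.\<close>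

lemma cyc_seq_interval_bound:
  assumes "\<And>k. k < n \<Longrightarrow> cmod (c k) \<le> 1" "(\<Sum>k<n. c k) = 0" "L \<le> p"
  shows "cmod (\<Sum>x\<in>{A..<A + int L}. cyc_seq n a p c x) \<le> real n * (sqrt (real p) * log_factor)"
proof -
  have "(\<Sum>x\<in>{A..<A + int L}. cyc_seq n a p c x) = (\<Sum>l<n. dft n c l * (\<Sum>x\<in>{A..<A + int L}. cyc_char l x))"
    unfolding cyc_seq_dft by (subst sum.swap) (simp add: sum_distrib_left)
  also have "cmod \<dots> \<le> (\<Sum>l<n. sqrt (real p) * log_factor)"
  proof (rule sum_norm_le)
    fix l assume l: "l \<in> {..<n}"
    show "cmod (dft n c l * (\<Sum>x\<in>{A..<A + int L}. cyc_char l x)) \<le> sqrt (real p) * log_factor"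
    proof (cases "l = 0")
      case True
      then show ?thesis using assms log_factor_ge_0 by (simp add: dft_0)
    next
      case False
      then have "cmod (\<Sum>x\<in>{A..<A + int L}. cyc_char l x) \<le> sqrt (real p) * log_factor"
        unfolding log_factor_def using p_gt_1 l assms(3)
        by (intro incomplete_sum_bound cyc_char_periodic gauss_bound modchar_nontriv_cyc_char) auto
      moreover have "cmod (dft n c l) \<le> 1" using n_ge_1 assms(1) by (rule norm_dft_le)
      ultimately show ?thesis unfolding norm_mult
        using mult_mono[of "cmod (dft n c l)" 1] by fastforce
    qed
  qed
  finally show ?thesis by simp
qed

lemma cyc_seq_corr_dft:
  "(\<Sum>x\<in>I. cyc_seq n a p d (x + v) * cnj (cyc_seq n a p d' x))
   = (\<Sum>l<n. \<Sum>l'<n. (dft n d l * cnj (dft n d' l')) * (\<Sum>x\<in>I. cnj (cyc_char l' x) * cyc_char l (x + v)))"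
proof -
  have "cyc_seq n a p d (x + v) * cnj (cyc_seq n a p d' x)
     = (\<Sum>l<n. \<Sum>l'<n. (dft n d l * cnj (dft n d' l')) * (cnj (cyc_char l' x) * cyc_char l (x + v)))" for x
    unfolding cyc_seq_dft cnj_sum sum_product by (simp add: mult_ac)
  then have "(\<Sum>x\<in>I. cyc_seq n a p d (x + v) * cnj (cyc_seq n a p d' x))
    = (\<Sum>x\<in>I. \<Sum>l<n. \<Sum>l'<n. (dft n d l * cnj (dft n d' l')) * (cnj (cyc_char l' x) * cyc_char l (x + v)))"
    by simp
  also have "\<dots> = (\<Sum>l<n. \<Sum>l'<n. \<Sum>x\<in>I. (dft n d l * cnj (dft n d' l')) * (cnj (cyc_char l' x) * cyc_char l (x + v)))"
    by (subst sum.swap, rule sum.cong[OF refl], rule sum.swap)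
  finally show ?thesis by (simp add: sum_distrib_left)
qed

text \<open>Balance removes every pair of characters with a trivial member; for the others the Weil
  bound, at a shift prime to \<open>p\<close>, feeds the completion.\<close>

lemma cyc_seq_corr_bound:
  assumes "\<And>k. k < n \<Longrightarrow> cmod (d k) \<le> 1" "\<And>k. k < n \<Longrightarrow> cmod (d' k) \<le> 1"
    "(\<Sum>k<n. d k) = 0" "(\<Sum>k<n. d' k) = 0" "L \<le> p" "\<not> int p dvd v"
  shows "cmod (\<Sum>x\<in>{A..<A + int L}. cyc_seq n a p d (x + v) * cnj (cyc_seq n a p d' x))
     \<le> real n * (real n * (2 * sqrt (real p) * log_factor))"
proof -
  have "cmod (\<Sum>l<n. \<Sum>l'<n. (dft n d l * cnj (dft n d' l')) *
      (\<Sum>x\<in>{A..<A + int L}. cnj (cyc_char l' x) * cyc_char l (x + v))) \<le> (\<Sum>l<n. \<Sum>l'<n. 2 * sqrt (real p) * log_factor)"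
  proof (intro sum_norm_le)
    fix l l' assume l: "l \<in> {..<n}" "l' \<in> {..<n}"
    show "cmod ((dft n d l * cnj (dft n d' l')) *
      (\<Sum>x\<in>{A..<A + int L}. cnj (cyc_char l' x) * cyc_char l (x + v))) \<le> 2 * sqrt (real p) * log_factor"
    proof (cases "l = 0 \<or> l' = 0")
      case True
      then have "dft n d l * cnj (dft n d' l') = 0" using assms by (auto simp: dft_0)
      then show ?thesis using log_factor_ge_0 by (simp only: mult_zero_left norm_zero) simp
    next
      case False
      have "cmod (\<Sum>x\<in>{A..<A + int L}. cnj (cyc_char l' x) * cyc_char l (x + v)) \<le> 2 * sqrt (real p) * log_factor"
        unfolding log_factor_def
      proof (rule incomplete_sum_bound)
        fix x
        show "cnj (cyc_char l' (x + int p)) * cyc_char l (x + int p + v) = cnj (cyc_char l' x) * cyc_char l (x + v)"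
          using cyc_char_periodic[of l "x + v"] cyc_char_periodic[of l' x] by (simp add: ac_simps)
      next
        fix u
        show "cmod (\<Sum>x\<in>{0..<int p}. cnj (cyc_char l' x) * cyc_char l (x + v) * ep p (u * x)) \<le> 2 * sqrt (real p)"
          using False l assms(6) by (intro mixed_bound modchar_nontriv_cyc_char modchar_nontriv_cnj_cyc_char) auto
      qed (use p_gt_1 assms(5) in auto)
      moreover have "cmod (dft n d l) \<le> 1" "cmod (dft n d' l') \<le> 1"
        using n_ge_1 assms(1,2) by (auto intro: norm_dft_le)
      then have "cmod (dft n d l * cnj (dft n d' l')) \<le> 1"
        using mult_mono[of "cmod (dft n d l)" 1 "cmod (dft n d' l')" 1] by (simp add: norm_mult)
      ultimately show ?thesis unfolding norm_mult[of "dft n d l * cnj (dft n d' l')"]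
        using mult_mono[of "cmod (dft n d l * cnj (dft n d' l'))" 1] by fastforce
    qed
  qed
  then show ?thesis unfolding cyc_seq_corr_dft by simp
qed

text \<open>Two nontrivial characters fall under the Weil bound with \<open>u = 0\<close>. A trivial
  one only deletes a single term from a complete character sum, which costs at most 1.\<close>

lemma cyc_char_complete_bound:
  assumes "l < n" "l' < n" "l \<noteq> 0 \<or> l' \<noteq> 0"
  shows "cmod (\<Sum>x\<in>{0..<int p}. cnj (cyc_char l' x) * cyc_char l (x + 1)) \<le> 2 * sqrt (real p)"
proof -
  have p0: "p > 0" using p_gt_1 by simp
  have ind: "cyc_char 0 x = (if int p dvd x then 0 else 1)" for x by (simp add: cyc_char_def)
  consider "l \<noteq> 0" "l' \<noteq> 0" | "l \<noteq> 0" "l' = 0" | "l = 0" "l' \<noteq> 0" using assms(3) by blast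
  then show ?thesis
  proof cases
    case 1
    then show ?thesis
      using mixed_bound[of "\<lambda>x. cnj (cyc_char l' x)" "cyc_char l" 1 0] assms p_gt_1
        modchar_nontriv_cyc_char modchar_nontriv_cnj_cyc_char by simp
  next
    case 2
    have "(\<Sum>x\<in>{0..<int p}. cnj (cyc_char l' x) * cyc_char l (x + 1))
       = (\<Sum>x\<in>{0..<int p}. cyc_char l (x + 1) - (if x = 0 then cyc_char l 1 else 0))"
      using 2 by (intro sum.cong refl) (auto simp: ind zdvd_not_zless)
    also have "\<dots> = (\<Sum>x\<in>{0..<int p}. cyc_char l (x + 1)) - cyc_char l 1"
      using p0 by (simp add: sum_subtractf)
    also have "(\<Sum>x\<in>{0..<int p}. cyc_char l (x + 1)) = (\<Sum>x\<in>{1..<1 + int p}. cyc_char l x)"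
      by (rule sum.reindex_bij_witness[of _ "\<lambda>x. x - 1" "\<lambda>x. x + 1"]) auto
    also have "\<dots> = (\<Sum>x\<in>{0..<int p}. cyc_char l x)" by (rule sum_period_shift[of p "cyc_char l", OF p0 cyc_char_periodic])
    finally have "cmod (\<Sum>x\<in>{0..<int p}. cnj (cyc_char l' x) * cyc_char l (x + 1))
       \<le> cmod (\<Sum>x\<in>{0..<int p}. cyc_char l x) + cmod (cyc_char l 1)" by (simp add: norm_triangle_ineq4)
    also have "\<dots> \<le> sqrt (real p) + 1"
      using gauss_bound[OF modchar_nontriv_cyc_char, of l 0] 2 assms by (intro add_mono) (auto simp: norm_cyc_char)
    finally show ?thesis using sqrt_p_ge_1 by linarith
  next
    case 3
    have "(\<Sum>x\<in>{0..<int p}. cnj (cyc_char l' x) * cyc_char l (x + 1))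
       = (\<Sum>x\<in>{0..<int p}. cnj (cyc_char l' x) - (if x = int p - 1 then cnj (cyc_char l' (int p - 1)) else 0))"
    proof (intro sum.cong refl)
      fix x assume x: "x \<in> {0..<int p}"
      have "int p dvd x + 1 \<longleftrightarrow> x = int p - 1"
        using x by (rule dvd_residue_iff)
      then show "cnj (cyc_char l' x) * cyc_char l (x + 1) = cnj (cyc_char l' x) - (if x = int p - 1 then cnj (cyc_char l' (int p - 1)) else 0)"
        using 3 by (auto simp: ind)
    qed
    also have "\<dots> = (\<Sum>x\<in>{0..<int p}. cnj (cyc_char l' x)) - cnj (cyc_char l' (int p - 1))"
      using p_gt_1 by (simp add: sum_subtractf)
    finally have "cmod (\<Sum>x\<in>{0..<int p}. cnj (cyc_char l' x) * cyc_char l (x + 1))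
       \<le> cmod (\<Sum>x\<in>{0..<int p}. cnj (cyc_char l' x)) + cmod (cyc_char l' (int p - 1))"
      by (metis complex_mod_cnj norm_triangle_ineq4)
    also have "\<dots> \<le> sqrt (real p) + 1"
      using gauss_bound[OF modchar_nontriv_cnj_cyc_char, of l' 0] 3 assms by (intro add_mono) (auto simp: norm_cyc_char)
    finally show ?thesis using sqrt_p_ge_1 by linarith
  qed
qed

text \<open>The pair of trivial characters gives the main term, with \<open>p - 2\<close> because
  the residues 0 and -1 drop out at shift 1; each of the other pairs is O(sqrt p).\<close>

lemma cyc_seq_autocorr_lower:
  assumes "\<And>k. k < n \<Longrightarrow> cmod (d k) \<le> 1"
  shows "(cmod (dft n d 0))\<^sup>2 * (real p - 2) - real n * (real n * (2 * sqrt (real p)))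
     \<le> cmod (\<Sum>x\<in>{0..<int p}. cyc_seq n a p d (x + 1) * cnj (cyc_seq n a p d x))"
proof -
  define t where "t = (\<lambda>l l'. (dft n d l * cnj (dft n d l')) * (\<Sum>x\<in>{0..<int p}. cnj (cyc_char l' x) * cyc_char l (x + 1)))"
  have fin: "(0, 0) \<in> {..<n} \<times> {..<n}" using n_ge_1 by simp
  have "(\<Sum>x\<in>{0..<int p}. cyc_seq n a p d (x + 1) * cnj (cyc_seq n a p d x)) = (\<Sum>(l,l')\<in>{..<n} \<times> {..<n}. t l l')"
    unfolding cyc_seq_corr_dft t_def sum.cartesian_product ..
  also have "\<dots> = t 0 0 + (\<Sum>(l,l')\<in>{..<n} \<times> {..<n} - {(0,0)}. t l l')"
    using fin by (subst sum.remove[of _ "(0,0)"]) auto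
  finally have eq: "(\<Sum>x\<in>{0..<int p}. cyc_seq n a p d (x + 1) * cnj (cyc_seq n a p d x))
     = t 0 0 + (\<Sum>(l,l')\<in>{..<n} \<times> {..<n} - {(0,0)}. t l l')" .
  have "cmod (\<Sum>(l,l')\<in>{..<n} \<times> {..<n} - {(0,0)}. t l l') \<le> (\<Sum>(l,l')\<in>{..<n} \<times> {..<n} - {(0,0)}. 2 * sqrt (real p))"
  proof (rule sum_norm_le)
    fix ll assume ll: "ll \<in> {..<n} \<times> {..<n} - {(0,0)}"
    obtain l l' where eq: "ll = (l, l')" by (cases ll)
    have l: "l \<in> {..<n}" "l' \<in> {..<n}" "(l, l') \<noteq> (0, 0)" using ll by (auto simp: eq)
    have "cmod (\<Sum>x\<in>{0..<int p}. cnj (cyc_char l' x) * cyc_char l (x + 1)) \<le> 2 * sqrt (real p)"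
      using l by (intro cyc_char_complete_bound) auto
    moreover have "cmod (dft n d l) \<le> 1" "cmod (dft n d l') \<le> 1"
      using n_ge_1 assms by (auto intro: norm_dft_le)
    then have "cmod (dft n d l * cnj (dft n d l')) \<le> 1"
      using mult_mono[of "cmod (dft n d l)" 1 "cmod (dft n d l')" 1] by (simp add: norm_mult)
    ultimately have "cmod (t l l') \<le> 2 * sqrt (real p)" unfolding t_def norm_mult[of "dft n d l * cnj (dft n d l')"]
      using mult_mono[of "cmod (dft n d l * cnj (dft n d l'))" 1] by fastforce
    then show "cmod (case ll of (l, l') \<Rightarrow> t l l') \<le> (case ll of (l, l') \<Rightarrow> 2 * sqrt (real p))"
      by (simp add: eq)
  qed
  also have "\<dots> \<le> (\<Sum>(l,l')\<in>{..<n} \<times> {..<n}. 2 * sqrt (real p))"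
    by (rule sum_mono2) auto
  also have "\<dots> = real n * (real n * (2 * sqrt (real p)))" by (simp add: case_prod_unfold)
  finally have rest: "cmod (\<Sum>(l,l')\<in>{..<n} \<times> {..<n} - {(0,0)}. t l l') \<le> real n * (real n * (2 * sqrt (real p)))" .
  have "(\<Sum>x\<in>{0..<int p}. cnj (cyc_char 0 x) * cyc_char 0 (x + 1)) = (\<Sum>x\<in>{0..<int p} - {0, int p - 1}. 1)"
  proof (rule sum.mono_neutral_cong_right)
    have dv: "int p dvd x + 1 \<longleftrightarrow> x = int p - 1" "int p dvd x \<longleftrightarrow> x = 0" if "x \<in> {0..<int p}" for x
      using dvd_residue_iff[OF that] by auto
    show "\<forall>i\<in>{0..<int p} - ({0..<int p} - {0, int p - 1}). cnj (cyc_char 0 i) * cyc_char 0 (i + 1) = 0"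
      using dv by (auto simp: cyc_char_def)
    show "\<And>x. x \<in> {0..<int p} - {0, int p - 1} \<Longrightarrow> cnj (cyc_char 0 x) * cyc_char 0 (x + 1) = 1"
      using dv by (auto simp: cyc_char_def)
  qed auto
  also have "\<dots> = of_nat (p - 2)"
    using p_gt_1 by (simp add: card_Diff_subset)
  finally have "cmod (\<Sum>x\<in>{0..<int p}. cnj (cyc_char 0 x) * cyc_char 0 (x + 1)) = real (p - 2)" by (simp only: norm_of_nat)
  then have "cmod (t 0 0) = (cmod (dft n d 0))\<^sup>2 * (real p - 2)"
    using p_gt_1 by (simp add: t_def norm_mult power2_eq_square of_nat_diff)
  moreover have "cmod (t 0 0) - cmod (\<Sum>(l,l')\<in>{..<n} \<times> {..<n} - {(0,0)}. t l l')
     \<le> cmod (t 0 0 + (\<Sum>(l,l')\<in>{..<n} \<times> {..<n} - {(0,0)}. t l l'))" by (rule norm_diff_ineq)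
  ultimately show ?thesis using rest unfolding eq by linarith
qed

text \<open>The trivial character contributes \<open>p - 1\<close> times the mean of
  \<open>c\<close>, every other one at most \<open>sqrt p\<close>.\<close>

lemma cyc_seq_sum_lower:
  assumes "\<And>k. k < n \<Longrightarrow> cmod (c k) \<le> 1"
  shows "cmod (dft n c 0) * (real p - 1) - real n * sqrt (real p)
    \<le> cmod (\<Sum>x\<in>{0..<int p}. cyc_seq n a p c x)"
proof -
  define t where "t = (\<lambda>l. dft n c l * (\<Sum>x\<in>{0..<int p}. cyc_char l x))"
  have "(\<Sum>x\<in>{0..<int p}. cyc_seq n a p c x) = (\<Sum>l<n. t l)"
    unfolding cyc_seq_dft t_def by (subst sum.swap) (simp add: sum_distrib_left)
  also have "\<dots> = t 0 + (\<Sum>l\<in>{..<n} - {0}. t l)"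
    using n_ge_1 by (subst sum.remove[of _ 0]) auto
  finally have eq: "(\<Sum>x\<in>{0..<int p}. cyc_seq n a p c x) = t 0 + (\<Sum>l\<in>{..<n} - {0}. t l)" .
  have "cmod (\<Sum>l\<in>{..<n} - {0}. t l) \<le> (\<Sum>l\<in>{..<n} - {0}. sqrt (real p))"
  proof (rule sum_norm_le)
    fix l assume l: "l \<in> {..<n} - {0}"
    have "cmod (\<Sum>x\<in>{0..<int p}. cyc_char l x) \<le> sqrt (real p)"
      using gauss_bound[OF modchar_nontriv_cyc_char, of l 0] l by simp
    moreover have "cmod (dft n c l) \<le> 1" using n_ge_1 assms by (rule norm_dft_le)
    ultimately show "cmod (t l) \<le> sqrt (real p)"
      unfolding t_def norm_mult using mult_mono[of "cmod (dft n c l)" 1] by fastforce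
  qed
  also have "\<dots> \<le> (\<Sum>l<n. sqrt (real p))" by (rule sum_mono2) auto
  finally have rest: "cmod (\<Sum>l\<in>{..<n} - {0}. t l) \<le> real n * sqrt (real p)" by simp
  have "(\<Sum>x\<in>{0..<int p}. cyc_char 0 x) = (\<Sum>x\<in>{1..<int p}. 1)"
  proof (rule sum.mono_neutral_cong_right)
    show "\<forall>i\<in>{0..<int p} - {1..<int p}. cyc_char 0 i = 0"
    proof
      fix i assume "i \<in> {0..<int p} - {1..<int p}"
      then have "i = 0" by auto
      then show "cyc_char 0 i = 0" by (simp add: cyc_char_def)
    qed
    show "\<And>x. x \<in> {1..<int p} \<Longrightarrow> cyc_char 0 x = 1" using zdvd_not_zless by (auto simp: cyc_char_def)
  qed auto
  also have "\<dots> = of_nat (p - 1)" by (simp add: nat_diff_distrib)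
  finally have "cmod (\<Sum>x\<in>{0..<int p}. cyc_char 0 x) = real (p - 1)" by (simp only: norm_of_nat)
  then have "cmod (t 0) = cmod (dft n c 0) * (real p - 1)"
    using p_gt_1 by (simp add: t_def norm_mult of_nat_diff)
  moreover have "cmod (t 0) - cmod (\<Sum>l\<in>{..<n} - {0}. t l) \<le> cmod (t 0 + (\<Sum>l\<in>{..<n} - {0}. t l))"
    by (rule norm_diff_ineq)
  ultimately show ?thesis using rest unfolding eq by linarith
qed

end

section \<open>Aperiodic correlations of instances\<close>

lemma rotation_support:
  assumes "\<And>x. cmod (G x) = 1"
  shows "{j. rotation p G r j \<noteq> 0} = {0..<int p}"
proof -
  have "G x \<noteq> 0" for x using assms[of x] by auto
  then show ?thesis by (auto simp: rotation_def)
qed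

text \<open>The supports overlap in \<open>p - \<bar>s\<bar>\<close> places, and in none once
  \<open>\<bar>s\<bar> \<ge> p\<close>, whence \<open>nat\<close>. Unit modulus makes the support of
  the second sequence the whole window, and in the periodic variable the relative shift is
  \<open>r + s - r'\<close>.\<close>

lemma crosscorr_rotation:
  fixes F G :: "int \<Rightarrow> complex"
  assumes "\<And>x. cmod (G x) = 1"
  shows "crosscorr (rotation p F r) (rotation p G r') s =
    (\<Sum>x\<in>{r' + max 0 (- s)..<r' + max 0 (- s) + int (nat (int p - \<bar>s\<bar>))}. F (x + (r + s - r')) * cnj (G x))"
proof -
  let ?J = "{max 0 (- s)..<max 0 (- s) + int (nat (int p - \<bar>s\<bar>))}"
  have "crosscorr (rotation p F r) (rotation p G r') s
      = (\<Sum>j\<in>{0..<int p}. rotation p F r (j + s) * cnj (rotation p G r' j))"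
    unfolding crosscorr_def rotation_support[OF assms] ..
  also have "\<dots> = (\<Sum>j\<in>?J. F (r + (j + s)) * cnj (G (r' + j)))"
    by (rule sum.mono_neutral_cong_right) (auto simp: rotation_def max_def split: if_splits)
  also have "\<dots> = (\<Sum>x\<in>{r' + max 0 (- s)..<r' + max 0 (- s) + int (nat (int p - \<bar>s\<bar>))}. F (x + (r + s - r')) * cnj (G x))"
    by (rule sum.reindex_bij_witness[of _ "\<lambda>x. x - r'" "\<lambda>j. r' + j"]) (auto simp: algebra_simps)
  finally show ?thesis .
qed

lemma norm_sum_unit_le:
  assumes "\<And>x. cmod (F x) = 1" "\<And>x. cmod (G x) = 1"
  shows "cmod (\<Sum>x\<in>{A..<A + int L}. F (x + v) * cnj (G x)) \<le> real L"
proof -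
  have "cmod (\<Sum>x\<in>{A..<A + int L}. F (x + v) * cnj (G x)) \<le> (\<Sum>x\<in>{A..<A + int L}. 1)"
    by (rule sum_norm_le) (simp add: norm_mult assms)
  then show ?thesis by simp
qed

locale cyclotomic_instance = cyclotomy +
  fixes D :: "(nat \<Rightarrow> complex) set" and ft :: "(nat \<Rightarrow> complex) \<Rightarrow> int \<Rightarrow> complex"
    and r :: "(nat \<Rightarrow> complex) \<Rightarrow> int"
  assumes finite_D: "finite D" and D_ne: "D \<noteq> {}" and patterns: "\<And>d. d \<in> D \<Longrightarrow> cyc_pattern n d"
    and unimod: "\<And>d k. d \<in> D \<Longrightarrow> k < n \<Longrightarrow> cmod (d k) = 1"
    and ft: "\<And>d. d \<in> D \<Longrightarrow> unimodularization p (cyc_seq n a p d) (ft d)"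
begin

definition codebook :: "(int \<Rightarrow> complex) set" where
  "codebook = (\<lambda>d. rotation p (ft d) (r d)) ` D"

lemma p_pos: "p > 0"
  using p_gt_1 by simp

lemma ft_periodic: "d \<in> D \<Longrightarrow> ft d (x + int p) = ft d x"
  using ft by (simp add: unimodularization_def)

lemma ft_eq: "d \<in> D \<Longrightarrow> \<not> int p dvd x \<Longrightarrow> ft d x = cyc_seq n a p d x"
  using ft by (simp add: unimodularization_def cong_0_iff)

lemma norm_ft:
  assumes "d \<in> D"
  shows "cmod (ft d x) = 1"
proof (cases "int p dvd x")
  case True
  then have "[x = 0] (mod int p)" by (simp add: cong_0_iff)
  then have "ft d x = ft d 0" by (rule periodic_cong[of "ft d" p, OF ft_periodic[OF assms]])
  then show ?thesis using ft[OF assms] by (simp add: unimodularization_def)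
next
  case False
  then show ?thesis using ft_eq[OF assms False] unimod[OF assms idx_less[OF False]] by (simp add: cyc_seq_eq)
qed

text \<open>The summands can differ only for x congruent to 0 or to -v modulo \<open>p\<close>, at
  most one place each, and there the cyclotomic product is 0 while the other has modulus 1.\<close>

lemma ft_corr_diff:
  assumes d: "d \<in> D" "d' \<in> D" and L: "L \<le> p"
  shows "cmod ((\<Sum>x\<in>{A..<A + int L}. ft d (x + v) * cnj (ft d' x))
      - (\<Sum>x\<in>{A..<A + int L}. cyc_seq n a p d (x + v) * cnj (cyc_seq n a p d' x))) \<le> 2"
proof -
  let ?I = "{A..<A + int L}"
  let ?E = "{x \<in> ?I. int p dvd x + v} \<union> {x \<in> ?I. int p dvd x + 0}"
  let ?g = "\<lambda>x. ft d (x + v) * cnj (ft d' x) - cyc_seq n a p d (x + v) * cnj (cyc_seq n a p d' x)"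
  have "(\<Sum>x\<in>?I. ft d (x + v) * cnj (ft d' x)) - (\<Sum>x\<in>?I. cyc_seq n a p d (x + v) * cnj (cyc_seq n a p d' x))
      = (\<Sum>x\<in>?I. ?g x)" by (simp add: sum_subtractf)
  also have "\<dots> = (\<Sum>x\<in>?E. ?g x)"
    by (rule sum.mono_neutral_right) (auto simp: ft_eq d)
  finally have eq: "(\<Sum>x\<in>?I. ft d (x + v) * cnj (ft d' x))
      - (\<Sum>x\<in>?I. cyc_seq n a p d (x + v) * cnj (cyc_seq n a p d' x)) = (\<Sum>x\<in>?E. ?g x)" .
  have "cmod (\<Sum>x\<in>?E. ?g x) \<le> (\<Sum>x\<in>?E. 1)"
  proof (rule sum_norm_le)
    fix x assume "x \<in> ?E"
    then have "cyc_seq n a p d (x + v) * cnj (cyc_seq n a p d' x) = 0" by (auto simp: cyc_seq_eq)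
    then show "cmod (?g x) \<le> 1" by (simp only: diff_0_right norm_mult complex_mod_cnj norm_ft d)
  qed
  also have "\<dots> = real (card ?E)" by simp
  also have "\<dots> \<le> 2"
  proof -
    have "card ?E \<le> card {x \<in> ?I. int p dvd x + v} + card {x \<in> ?I. int p dvd x + 0}"
      by (rule card_Un_le)
    also have "\<dots> \<le> 1 + 1" using L by (intro add_mono card_multiples_in_interval)
    finally show ?thesis by simp
  qed
  finally show ?thesis unfolding eq .
qed

lemma crosscorr_eq:
  assumes "d \<in> D" "d' \<in> D"
  shows "crosscorr (rotation p (ft d) (r d)) (rotation p (ft d') (r d')) s =
    (\<Sum>x\<in>{r d' + max 0 (- s)..<r d' + max 0 (- s) + int (nat (int p - \<bar>s\<bar>))}.
        ft d (x + (r d + s - r d')) * cnj (ft d' x))"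
  using assms by (intro crosscorr_rotation norm_ft)

lemma SDC_codebook: "SDC codebook = real p"
proof -
  have "Re (crosscorr f f 0) = real p" if f: "f \<in> codebook" for f
  proof -
    obtain d where d: "d \<in> D" "f = rotation p (ft d) (r d)" using f by (auto simp: codebook_def)
    have "crosscorr f f 0 = (\<Sum>x\<in>{r d..<r d + int p}. ft d x * cnj (ft d x))"
      using crosscorr_eq[OF d(1) d(1), of 0] d(2) by simp
    also have "\<dots> = (\<Sum>x\<in>{r d..<r d + int p}. 1)"
      by (intro sum.cong refl mult_cnj_unit norm_ft d)
    finally show ?thesis by simp
  qed
  then have "(\<lambda>f. Re (crosscorr f f 0)) ` codebook = {real p}"
    using D_ne by (auto simp: codebook_def)
  then show ?thesis by (simp add: SDC_def)
qed

lemma codebook_len_codebook: "codebook_len codebook = p"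
proof -
  have len: "seq_len f = p" if f: "f \<in> codebook" for f
  proof -
    obtain d where d: "d \<in> D" "f = rotation p (ft d) (r d)" using f by (auto simp: codebook_def)
    have "{j. f j \<noteq> 0} = {0..<int p}" unfolding d(2) by (rule rotation_support) (rule norm_ft[OF d(1)])
    also have "\<dots> = {0..int p - 1}" by auto
    finally have "{j. f j \<noteq> 0} = {0..int p - 1}" .
    moreover have "Max {0..int p - 1} = int p - 1" "Min {0..int p - 1} = 0"
      using p_gt_1 by (auto intro!: Max_eqI Min_eqI)
    ultimately show ?thesis using p_gt_1 by (simp add: seq_len_def)
  qed
  obtain f where f: "f \<in> codebook" using D_ne by (auto simp: codebook_def)
  show ?thesis
    unfolding codebook_len_def
  proof (rule the_equality)
    show "\<forall>f\<in>codebook. seq_len f = p" using len by blast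
    fix l assume "\<forall>f\<in>codebook. seq_len f = l"
    then show "l = p" using len[OF f] f by metis
  qed
qed

text \<open>The relative shift \<open>v\<close> decides. If \<open>p\<close> does not divide it,
  balance gives the bound. If \<open>p\<close> divides it, two distinct patterns multiply to a
  pattern that orthogonality makes balanced, while a sequence against itself has no overlap left, as
  then \<open>\<bar>s\<bar> \<ge> p\<close>.\<close>

lemma GUC_codebook_upper:
  assumes bal: "plan_balanced n D" and orth: "plan_orthogonal n D"
  shows "GUC codebook \<le> real n * (real n * (2 * sqrt (real p) * log_factor)) + 2"
  unfolding GUC_def
proof (rule cSup_least)
  obtain d where "d \<in> D" using D_ne by blast
  then have f: "rotation p (ft d) (r d) \<in> codebook" by (simp add: codebook_def)
  have "cmod (crosscorr (rotation p (ft d) (r d)) (rotation p (ft d) (r d)) 1)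
      \<in> {cmod (crosscorr f g s) |f g s. f \<in> codebook \<and> g \<in> codebook \<and> \<not> (f = g \<and> s = 0)}"
    by (rule CollectI, rule exI[of _ "rotation p (ft d) (r d)"], rule exI[of _ "rotation p (ft d) (r d)"],
        rule exI[of _ 1]) (simp add: f)
  then show "{cmod (crosscorr f g s) |f g s. f \<in> codebook \<and> g \<in> codebook \<and> \<not> (f = g \<and> s = 0)} \<noteq> {}"
    by blast
next
  fix y assume "y \<in> {cmod (crosscorr f g s) |f g s. f \<in> codebook \<and> g \<in> codebook \<and> \<not> (f = g \<and> s = 0)}"
  then obtain d d' s where d: "d \<in> D" "d' \<in> D"
    and y: "y = cmod (crosscorr (rotation p (ft d) (r d)) (rotation p (ft d') (r d')) s)"
    and ns: "\<not> (rotation p (ft d) (r d) = rotation p (ft d') (r d') \<and> s = 0)"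
    by (auto simp: codebook_def)
  define v where "v = r d + s - r d'"
  define A where "A = r d' + max 0 (- s)"
  define L where "L = nat (int p - \<bar>s\<bar>)"
  let ?I = "{A..<A + int L}"
  let ?S = "\<Sum>x\<in>?I. cyc_seq n a p d (x + v) * cnj (cyc_seq n a p d' x)"
  have Lp: "L \<le> p" by (simp add: L_def)
  have y2: "y = cmod (\<Sum>x\<in>?I. ft d (x + v) * cnj (ft d' x))"
    unfolding y crosscorr_eq[OF d] by (simp add: v_def A_def L_def)
  have "y \<le> cmod ?S + cmod ((\<Sum>x\<in>?I. ft d (x + v) * cnj (ft d' x)) - ?S)"
    unfolding y2 by (rule norm_triangle_sub)
  also have "\<dots> \<le> cmod ?S + 2" using ft_corr_diff[OF d Lp, where A = A and v = v] by simp
  also have "cmod ?S \<le> real n * (real n * (2 * sqrt (real p) * log_factor))"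
  proof (cases "int p dvd v")
    case False
    show ?thesis
    proof (rule cyc_seq_corr_bound[OF _ _ _ _ Lp False])
      show "\<And>k. k < n \<Longrightarrow> cmod (d k) \<le> 1" "\<And>k. k < n \<Longrightarrow> cmod (d' k) \<le> 1"
        using unimod[OF d(1)] unimod[OF d(2)] by simp_all
      show "(\<Sum>k<n. d k) = 0" "(\<Sum>k<n. d' k) = 0" using bal d by (simp_all add: plan_balanced_def)
    qed
  next
    case True
    show ?thesis
    proof (cases "d = d'")
      case True': True
      then have "s \<noteq> 0" using ns by blast
      moreover have "int p dvd s" using True by (simp add: v_def True')
      ultimately have "int p \<le> \<bar>s\<bar>" using dvd_imp_le_int[of s "int p"] by simp
      then have "L = 0" by (simp add: L_def)
      then show ?thesis using log_factor_ge_0 by simp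
    next
      case False
      define c where "c = (\<lambda>k. d k * cnj (d' k))"
      have eq: "?S = (\<Sum>x\<in>?I. cyc_seq n a p c x)"
      proof (intro sum.cong refl)
        fix x
        have "cyc_seq n a p d (x + v) = cyc_seq n a p d x"
          by (rule periodic_cong[of "cyc_seq n a p d" p, OF cyc_seq_periodic])
             (use True in \<open>simp add: cong_iff_dvd_diff\<close>)
        then show "cyc_seq n a p d (x + v) * cnj (cyc_seq n a p d' x) = cyc_seq n a p c x"
          by (simp add: cyc_seq_eq c_def)
      qed
      have "cmod (\<Sum>x\<in>?I. cyc_seq n a p c x) \<le> real n * (sqrt (real p) * log_factor)"
      proof (rule cyc_seq_interval_bound[OF _ _ Lp])
        show "\<And>k. k < n \<Longrightarrow> cmod (c k) \<le> 1" using unimod[OF d(1)] unimod[OF d(2)] by (simp add: c_def norm_mult)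
        show "(\<Sum>k<n. c k) = 0" using orth d False by (simp add: plan_orthogonal_def c_def)
      qed
      also have "\<dots> \<le> real n * (real n * (2 * sqrt (real p) * log_factor))"
      proof (intro mult_left_mono)
        have "1 * (sqrt (real p) * log_factor) \<le> (real n * 2) * (sqrt (real p) * log_factor)"
          using n_ge_1 log_factor_ge_0 by (intro mult_right_mono) auto
        then show "sqrt (real p) * log_factor \<le> real n * (2 * sqrt (real p) * log_factor)" by (simp add: mult.assoc)
      qed simp
      finally show ?thesis unfolding eq .
    qed
  qed
  finally show "y \<le> real n * (real n * (2 * sqrt (real p) * log_factor)) + 2" by simp
qed

text \<open>A real \<open>Sup\<close> dominates its set only if the set is bounded; here every
  correlation is at most \<open>p\<close>.\<close>

lemma GUC_codebook_ge:
  assumes d: "d \<in> D" "d' \<in> D"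
    and ns: "\<not> (rotation p (ft d) (r d) = rotation p (ft d') (r d') \<and> s = 0)"
  shows "cmod (crosscorr (rotation p (ft d) (r d)) (rotation p (ft d') (r d')) s) \<le> GUC codebook"
  unfolding GUC_def
proof (rule cSup_upper)
  show "cmod (crosscorr (rotation p (ft d) (r d)) (rotation p (ft d') (r d')) s)
     \<in> {cmod (crosscorr f g s) |f g s. f \<in> codebook \<and> g \<in> codebook \<and> \<not> (f = g \<and> s = 0)}"
    using assms by (auto simp: codebook_def)
  show "bdd_above {cmod (crosscorr f g s) |f g s. f \<in> codebook \<and> g \<in> codebook \<and> \<not> (f = g \<and> s = 0)}"
  proof (rule bdd_aboveI)
    fix y assume "y \<in> {cmod (crosscorr f g s) |f g s. f \<in> codebook \<and> g \<in> codebook \<and> \<not> (f = g \<and> s = 0)}"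
    then obtain e e' t where e: "e \<in> D" "e' \<in> D"
      and y: "y = cmod (crosscorr (rotation p (ft e) (r e)) (rotation p (ft e') (r e')) t)"
      by (auto simp: codebook_def)
    have "y \<le> real (nat (int p - \<bar>t\<bar>))"
      unfolding y crosscorr_eq[OF e] by (intro norm_sum_unit_le norm_ft e)
    also have "\<dots> \<le> real p" by simp
    finally show "y \<le> real p" .
  qed
qed

text \<open>The aperiodic autocorrelation at shift 1 is the periodic one short of one wrap-around
  term. That term, of modulus 1, and the error 2 of unimodularization make up the constant
  3.\<close>

lemma GUC_codebook_lower_unbalanced:
  assumes d: "d \<in> D"
  shows "(cmod (dft n d 0))\<^sup>2 * (real p - 2) - real n * (real n * (2 * sqrt (real p))) - 3 \<le> GUC codebook"
proof -
  let ?f = "rotation p (ft d) (r d)"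
  let ?t = "\<lambda>x. ft d (x + 1) * cnj (ft d x)"
  have "crosscorr ?f ?f 1 = (\<Sum>x\<in>{r d..<r d + (int p - 1)}. ?t x)"
    using crosscorr_eq[OF d d, of 1] p_gt_1 by (simp add: add.commute)
  moreover have "{r d..<r d + int p} = insert (r d + int p - 1) {r d..<r d + (int p - 1)}"
    using p_gt_1 by auto
  then have "(\<Sum>x\<in>{r d..<r d + int p}. ?t x) = ?t (r d + int p - 1) + (\<Sum>x\<in>{r d..<r d + (int p - 1)}. ?t x)"
    by (simp only:) (subst sum.insert, auto)
  moreover have "(\<Sum>x\<in>{r d..<r d + int p}. ?t x) = (\<Sum>x\<in>{0..<int p}. ?t x)"
  proof (rule sum_period_shift[OF p_pos])
    fix x
    show "ft d (x + int p + 1) * cnj (ft d (x + int p)) = ft d (x + 1) * cnj (ft d x)"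
      using ft_periodic[OF d, of x] ft_periodic[OF d, of "x + 1"] by (simp add: ac_simps)
  qed
  ultimately have "(\<Sum>x\<in>{0..<int p}. ?t x) = ?t (r d + int p - 1) + crosscorr ?f ?f 1" by simp
  then have 1: "cmod (\<Sum>x\<in>{0..<int p}. ?t x) \<le> cmod (?t (r d + int p - 1)) + cmod (crosscorr ?f ?f 1)"
    by (simp only: norm_triangle_ineq)
  have 2: "cmod (?t (r d + int p - 1)) = 1" by (simp add: norm_mult norm_ft d)
  let ?S = "\<Sum>x\<in>{0..<int p}. cyc_seq n a p d (x + 1) * cnj (cyc_seq n a p d x)"
  have 3: "cmod ((\<Sum>x\<in>{0..<int p}. ?t x) - ?S) \<le> 2"
    using ft_corr_diff[OF d d order.refl, where A = 0 and v = 1] by simp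
  have 4: "cmod ?S \<le> cmod (\<Sum>x\<in>{0..<int p}. ?t x) + cmod ((\<Sum>x\<in>{0..<int p}. ?t x) - ?S)"
    using norm_triangle_sub[of ?S "\<Sum>x\<in>{0..<int p}. ?t x"] norm_minus_commute[of ?S "\<Sum>x\<in>{0..<int p}. ?t x"]
    by linarith
  have 5: "(cmod (dft n d 0))\<^sup>2 * (real p - 2) - real n * (real n * (2 * sqrt (real p))) \<le> cmod ?S"
    using unimod[OF d] by (intro cyc_seq_autocorr_lower) simp
  have 6: "cmod (crosscorr ?f ?f 1) \<le> GUC codebook" using d by (intro GUC_codebook_ge) auto
  from 1 2 3 4 5 6 show ?thesis by linarith
qed

text \<open>At a shift \<open>s\<close> aligning the two rotations modulo \<open>p\<close>, the
  aperiodic correlations at \<open>s\<close> and \<open>s - p\<close> cover one period and add up to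
  the periodic correlation at 0. One of them has at least half its modulus, whence the division by
  2.\<close>

lemma GUC_codebook_lower_nonorthogonal:
  assumes d: "d \<in> D" "d' \<in> D" and ne: "d \<noteq> d'"
  defines "c \<equiv> \<lambda>k. d k * cnj (d' k)"
  shows "(cmod (dft n c 0) * (real p - 1) - real n * sqrt (real p) - 2) / 2 \<le> GUC codebook"
proof -
  let ?f = "rotation p (ft d) (r d)" and ?g = "rotation p (ft d') (r d')"
  let ?t = "\<lambda>x. ft d x * cnj (ft d' x)"
  define s where "s = (r d' - r d) mod int p"
  have s: "0 \<le> s" "s < int p" using p_pos by (simp_all add: s_def)
  have dv: "int p dvd r d + s - r d'"
  proof -
    have "int p dvd (r d' - r d) - s" unfolding s_def by (rule dvd_minus_mod)
    then have "int p dvd - ((r d' - r d) - s)" by (simp only: dvd_minus_iff)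
    then show ?thesis by (simp add: algebra_simps)
  qed
  have shift: "ft d (x + (r d + t - r d')) = ft d x" if "int p dvd r d + t - r d'" for x t
    by (rule periodic_cong[of "ft d" p, OF ft_periodic[OF d(1)]])
       (use that in \<open>simp add: cong_iff_dvd_diff\<close>)
  have C1: "crosscorr ?f ?g s = (\<Sum>x\<in>{r d'..<r d' + (int p - s)}. ?t x)"
    unfolding crosscorr_eq[OF d] shift[OF dv] using s by simp
  have dv2: "int p dvd r d + (s - int p) - r d'"
    using dvd_diff[OF dv dvd_refl] by (simp add: algebra_simps)
  have C2: "crosscorr ?f ?g (s - int p) = (\<Sum>x\<in>{r d' + (int p - s)..<r d' + int p}. ?t x)"
    unfolding crosscorr_eq[OF d] shift[OF dv2] using s by (simp add: algebra_simps)
  have "crosscorr ?f ?g s + crosscorr ?f ?g (s - int p) = (\<Sum>x\<in>{r d'..<r d' + int p}. ?t x)"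
  proof -
    have "{r d'..<r d' + int p} = {r d'..<r d' + (int p - s)} \<union> {r d' + (int p - s)..<r d' + int p}"
      using s by auto
    then show ?thesis unfolding C1 C2 by (simp only:) (subst sum.union_disjoint, auto)
  qed
  also have "\<dots> = (\<Sum>x\<in>{0..<int p}. ?t x)"
    by (rule sum_period_shift[OF p_pos]) (simp add: ft_periodic d)
  finally have sum: "crosscorr ?f ?g s + crosscorr ?f ?g (s - int p) = (\<Sum>x\<in>{0..<int p}. ?t x)" .
  define T S where "T = (\<Sum>x\<in>{0..<int p}. ?t x)" and "S = (\<Sum>x\<in>{0..<int p}. cyc_seq n a p c x)"
  have "cyc_seq n a p d x * cnj (cyc_seq n a p d' x) = cyc_seq n a p c x" for x
    by (simp add: cyc_seq_eq c_def)
  then have diff: "cmod (T - S) \<le> 2"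
    unfolding T_def S_def using ft_corr_diff[OF d order.refl, where A = 0 and v = 0] by simp
  have 1: "cmod S \<le> cmod T + cmod (T - S)"
    using norm_triangle_sub[of S T] norm_minus_commute[of S T] by linarith
  define Q where "Q = cmod (dft n c 0) * (real p - 1) - real n * sqrt (real p)"
  have 2: "Q \<le> cmod S"
    unfolding Q_def S_def using unimod d by (intro cyc_seq_sum_lower) (simp add: c_def norm_mult)
  have 3: "cmod T \<le> cmod (crosscorr ?f ?g s) + cmod (crosscorr ?f ?g (s - int p))"
    unfolding T_def sum[symmetric] by (rule norm_triangle_ineq)
  \<comment> \<open>\<open>s = 0\<close> is admissible only if the rotated sequences differ. If they
    coincided, so would the two periodic sequences, and hence the patterns: their entries are read
    off at the powers \<open>a ^ k\<close>, and beyond \<open>n\<close> both are 0.\<close>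
  have 4: "cmod (crosscorr ?f ?g s) \<le> GUC codebook"
  proof (rule GUC_codebook_ge[OF d])
    show "\<not> (?f = ?g \<and> s = 0)"
    proof
      assume as: "?f = ?g \<and> s = 0"
      have r0: "int p dvd r d - r d'" using dv as by simp
      have eq0: "ft d (r d + j) = ft d' (r d' + j)" if "0 \<le> j" "j < int p" for j
        using fun_cong[OF conjunct1[OF as], of j] that by (simp add: rotation_def)
      have eq: "ft d x = ft d' x" for x
      proof -
        define j where "j = (x - r d') mod int p"
        have j: "0 \<le> j" "j < int p" using p_pos by (simp_all add: j_def)
        have xj: "int p dvd x - r d' - j" unfolding j_def by (rule dvd_minus_mod)
        have "ft d x = ft d (r d + j)"
        proof (rule periodic_cong[of "ft d" p, OF ft_periodic[OF d(1)]])
          have "int p dvd (x - r d' - j) - (r d - r d')" using xj r0 by (rule dvd_diff)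
          then show "[x = r d + j] (mod int p)" by (simp add: cong_iff_dvd_diff algebra_simps)
        qed
        also have "\<dots> = ft d' (r d' + j)" by (rule eq0[OF j])
        also have "\<dots> = ft d' x"
        proof (rule periodic_cong[of "ft d'" p, OF ft_periodic[OF d(2)]])
          have "int p dvd - (x - r d' - j)" using xj by (simp only: dvd_minus_iff)
          then show "[r d' + j = x] (mod int p)" by (simp add: cong_iff_dvd_diff algebra_simps)
        qed
        finally show ?thesis .
      qed
      have "d k = d' k" for k
      proof (cases "k < n")
        case True
        have "idx (int a ^ k) = k" using idx_eq[of "int a ^ k" k] True by simp
        then show ?thesis
          using eq[of "int a ^ k"] ft_eq[OF d(1) a_coprime[of k]] ft_eq[OF d(2) a_coprime[of k]] a_coprime[of k]
          by (simp add: cyc_seq_eq)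
      next
        case False
        then show ?thesis using patterns[OF d(1)] patterns[OF d(2)] by (simp add: cyc_pattern_def)
      qed
      then show False using ne by blast
    qed
  qed
  have 5: "cmod (crosscorr ?f ?g (s - int p)) \<le> GUC codebook"
    using s by (intro GUC_codebook_ge[OF d]) auto
  have "cmod T \<le> GUC codebook + GUC codebook" using order.trans[OF 3 add_mono[OF 4 5]] .
  with 1 2 diff have "Q - 2 \<le> 2 * GUC codebook" by linarith
  then have "(Q - 2) / 2 \<le> GUC codebook" by simp
  then show ?thesis unfolding Q_def .
qed

end

section \<open>Growth rates: linear against exponent 3/4, and sqrt x log x against any exponent
  above 1/2\<close>

lemma growth_beats:
  fixes c C :: real
  assumes "c > 0"
  shows "\<exists>M. \<forall>x>M. x powr (1/2 + 1/4) < c * x - C * sqrt x - C"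
proof -
  have lim: "filterlim (\<lambda>x::real. (c * x - C * sqrt x - C) - x powr (1/2 + 1/4)) at_top at_top"
    using assms by real_asymp
  have "eventually (\<lambda>x. (c * x - C * sqrt x - C) - x powr (1/2 + 1/4) > 0) at_top"
    using spec[OF lim[unfolded filterlim_at_top_dense], of 0] .
  then obtain M where "\<forall>x\<ge>M. (c * x - C * sqrt x - C) - x powr (1/2 + 1/4) > 0"
    by (auto simp: eventually_at_top_linorder)
  then show ?thesis by (intro exI[of _ M]) force
qed

lemma upper_bound_growth:
  fixes \<epsilon> \<delta> c :: real
  assumes "\<epsilon> > 0" "\<delta> > 0"
  shows "\<exists>M. \<forall>x>M. (c * (2 * sqrt x * (5 + 4 * ln x)) + 2) / x powr (1/2 + \<epsilon>) < \<delta>"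
proof -
  have "((\<lambda>x. (c * (2 * sqrt x * (5 + 4 * ln x)) + 2) / x powr (1/2 + \<epsilon>)) \<longlongrightarrow> 0) at_top"
    using assms by real_asymp
  then have "eventually (\<lambda>x. (c * (2 * sqrt x * (5 + 4 * ln x)) + 2) / x powr (1/2 + \<epsilon>) < \<delta>) at_top"
    using assms(2) by (rule order_tendstoD)
  then obtain M where "\<forall>x\<ge>M. (c * (2 * sqrt x * (5 + 4 * ln x)) + 2) / x powr (1/2 + \<epsilon>) < \<delta>"
    by (auto simp: eventually_at_top_linorder)
  then show ?thesis by (intro exI[of _ M]) force
qed

section \<open>Transfer to every prime\<close>

text \<open>The prime \<open>p\<close> is a term, but the field of characteristic \<open>p\<close> is a type. A single type whose
  characteristic is a counterexample, if there is one, therefore covers all primes at once.\<close>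

definition critical_prime :: nat where
  "critical_prime = (if \<exists>p. prime p \<and> \<not> char_sum_bounds p
     then SOME p. prime p \<and> \<not> char_sum_bounds p else 2)"

text \<open>The default 2 keeps this true when no counterexample exists, so the type below has prime
  cardinality in any case.\<close>

lemma prime_critical_prime: "prime critical_prime"
  unfolding critical_prime_def by (auto intro: someI2)

typedef critical_index = "{..<critical_prime}"
  using prime_gt_0_nat[OF prime_critical_prime] by auto

lemma CARD_critical_index: "CARD(critical_index) = critical_prime"
  using type_definition.card[OF type_definition_critical_index] by simp

instance critical_index :: prime_card
  by standard (simp add: CARD_critical_index prime_critical_prime)

text \<open>If any prime failed, \<open>critical_prime\<close> would be a failing one; but
  \<open>critical_index mod_ring alg_closure\<close> is an algebraically closed field of exactly
  that characteristic, over which the bounds are proved.\<close>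

theorem char_sum_bounds_prime:
  assumes "prime p"
  shows "char_sum_bounds p"
proof (rule ccontr)
  assume neg: "\<not> char_sum_bounds p"
  interpret prime_char critical_prime "TYPE(critical_index mod_ring alg_closure)"
    by standard (simp_all add: CARD_critical_index prime_critical_prime)
  have ex: "\<exists>p. prime p \<and> \<not> char_sum_bounds p" using assms neg by blast
  then have "critical_prime = (SOME p. prime p \<and> \<not> char_sum_bounds p)"
    by (simp only: critical_prime_def if_True)
  with someI_ex[OF ex] have "\<not> char_sum_bounds critical_prime" by simp
  then show False using char_sum_bounds_p by blast
qed

section \<open>Asymptotics of GUC against SDC along the family\<close>

theorem theorem1p1:
  fixes n :: nat and \<alpha> :: "nat \<Rightarrow> nat"
    and D :: "(nat \<Rightarrow> complex) set" and \<A> :: "(int \<Rightarrow> complex) set set"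
  assumes "n \<ge> 1"
    and "\<And>p. prime p \<Longrightarrow> residue_primroot p (\<alpha> p)"
    and "cyc_plan n D" and "D \<noteq> {}"
    and "plan_unimodular n D"
    and "\<And>A. A \<in> \<A> \<Longrightarrow> unimod_instance n \<alpha> D A"
    and "\<forall>M. \<exists>A\<in>\<A>. codebook_len A > M"
  shows "well_regulated_GUC \<A> \<longleftrightarrow> plan_balanced n D \<and> plan_orthogonal n D"
proof -
  define U where "U = (\<lambda>p::nat. real n * (real n * (2 * sqrt (real p) * (5 + 4 * ln (real p)))) + 2)"
  define ip where "ip = (\<lambda>(d :: nat \<Rightarrow> complex) d' k. d k * cnj (d' k))"
  \<comment> \<open>The prime, the unimodularizations and the rotations depend on \<open>A\<close>.
    These four facts, phrased through \<open>codebook_len A\<close>, are all that the asymptotic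
    argument sees of them.\<close>
  have SDC_eq: "SDC A = real (codebook_len A)"
    and upper: "plan_balanced n D \<Longrightarrow> plan_orthogonal n D \<Longrightarrow> GUC A \<le> U (codebook_len A)"
    and lower_unbalanced: "\<And>d. d \<in> D \<Longrightarrow> (cmod (dft n d 0))\<^sup>2 * (real (codebook_len A) - 2)
        - real n * (real n * (2 * sqrt (real (codebook_len A)))) - 3 \<le> GUC A"
    and lower_nonorthogonal: "\<And>d d'. d \<in> D \<Longrightarrow> d' \<in> D \<Longrightarrow> d \<noteq> d' \<Longrightarrow>
        (cmod (dft n (ip d d') 0) * (real (codebook_len A) - 1)
          - real n * sqrt (real (codebook_len A)) - 2) / 2 \<le> GUC A"
    if A: "A \<in> \<A>" for A
  proof -
    obtain p ft r where p: "prime p" "[p = 1] (mod n)"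
      and ft: "\<And>d. d \<in> D \<Longrightarrow> unimodularization p (cyc_seq n (\<alpha> p) p d) (ft d)"
      and A_eq: "A = (\<lambda>d. rotation p (ft d) (r d)) ` D"
      using assms(6)[OF A] unfolding unimod_instance_def unimod_p_instance_def by blast
    interpret cyclotomic_instance n "\<alpha> p" p D ft r
      by standard (use assms p ft char_sum_bounds_prime in
          \<open>auto simp: cyc_plan_def plan_unimodular_def\<close>)
    have A': "A = codebook" by (simp add: A_eq codebook_def)
    note len = codebook_len_codebook
    show "SDC A = real (codebook_len A)" unfolding A' len by (rule SDC_codebook)
    show "GUC A \<le> U (codebook_len A)" if "plan_balanced n D" "plan_orthogonal n D"
      using GUC_codebook_upper[OF that] unfolding A' len U_def log_factor_def .
    show "(cmod (dft n d 0))\<^sup>2 * (real (codebook_len A) - 2)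
        - real n * (real n * (2 * sqrt (real (codebook_len A)))) - 3 \<le> GUC A" if "d \<in> D" for d
      unfolding A' len by (rule GUC_codebook_lower_unbalanced[OF that])
    show "(cmod (dft n (ip d d') 0) * (real (codebook_len A) - 1)
          - real n * sqrt (real (codebook_len A)) - 2) / 2 \<le> GUC A"
      if "d \<in> D" "d' \<in> D" "d \<noteq> d'" for d d'
      unfolding A' len ip_def by (rule GUC_codebook_lower_nonorthogonal[OF that])
  qed
  have unbdd: "\<exists>A\<in>\<A>. SDC A > M" for M
  proof -
    obtain A where A: "A \<in> \<A>" "codebook_len A > nat \<lceil>M\<rceil>" using assms(7) by blast
    then have "SDC A > M" using SDC_eq[OF A(1)] by linarith
    with A(1) show ?thesis by blast
  qed
  show ?thesis
  proof
    assume bo: "plan_balanced n D \<and> plan_orthogonal n D"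
    have "\<exists>M. \<forall>F\<in>\<A>. SDC F > M \<longrightarrow> GUC F / SDC F powr (1/2 + \<epsilon>) < \<delta>"
      if ed: "\<epsilon> > 0" "\<delta> > 0" for \<epsilon> \<delta> :: real
    proof -
      obtain M where M: "\<forall>x>M. (real n * real n * (2 * sqrt x * (5 + 4 * ln x)) + 2) / x powr (1/2 + \<epsilon>) < \<delta>"
        using upper_bound_growth[OF ed, of "real n * real n"] by blast
      have "GUC F / SDC F powr (1/2 + \<epsilon>) < \<delta>" if F: "F \<in> \<A>" "SDC F > M" for F
      proof -
        define p where "p = codebook_len F"
        have p: "SDC F = real p" "GUC F \<le> U p" using SDC_eq upper F(1) bo by (simp_all add: p_def)
        have "GUC F / SDC F powr (1/2 + \<epsilon>) \<le> U p / real p powr (1/2 + \<epsilon>)"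
          unfolding p(1) using p(2) by (intro divide_right_mono) auto
        also have "\<dots> < \<delta>" using M F(2) p(1) by (simp add: U_def mult.assoc)
        finally show ?thesis .
      qed
      then show ?thesis by blast
    qed
    then show "well_regulated_GUC \<A>" using unbdd by (simp add: well_regulated_GUC_def)
  next
    assume wr: "well_regulated_GUC \<A>"
    then obtain M where M: "\<And>F. F \<in> \<A> \<Longrightarrow> SDC F > M \<Longrightarrow> GUC F / SDC F powr (1/2 + 1/4) < 1"
      unfolding well_regulated_GUC_def by (meson zero_less_one zero_less_divide_1_iff zero_less_numeral)
    \<comment> \<open>Either failure will yield a lower bound of this linear form, which is
      incompatible with the exponent 1/2 + 1/4 and the threshold 1 fixed in
      \<open>M\<close>.\<close>
    have no_linear: False if c: "c > 0"
      and low: "\<And>A p. A \<in> \<A> \<Longrightarrow> codebook_len A = p \<Longrightarrow> c * real p - C * sqrt (real p) - C \<le> GUC A" for c C :: real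
    proof -
      obtain M' where M': "\<forall>x>M'. x powr (1/2 + 1/4) < c * x - C * sqrt x - C"
        using growth_beats[OF c] by blast
      obtain A where A: "A \<in> \<A>" "SDC A > max 0 (max M M')" using unbdd by blast
      define p where "p = codebook_len A"
      have p: "SDC A = real p" using SDC_eq[OF A(1)] by (simp add: p_def)
      have "GUC A < real p powr (1/2 + 1/4)"
        using M[OF A(1)] A(2) unfolding p by (simp add: divide_less_eq)
      moreover have "real p powr (1/2 + 1/4) < c * real p - C * sqrt (real p) - C"
        using M' A(2) p by simp
      ultimately show False using low[OF A(1) p_def[symmetric]] by linarith
    qed
    show "plan_balanced n D \<and> plan_orthogonal n D"
    proof
      show "plan_balanced n D"
        unfolding plan_balanced_def
      proof (intro ballI, rule ccontr)
        fix d assume d: "d \<in> D" "(\<Sum>k<n. d k) \<noteq> 0"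
        define c where "c = (cmod (dft n d 0))\<^sup>2"
        \<comment> \<open>Large enough to absorb the \<open>2 * c\<close> from \<open>p - 2\<close>,
          the factor of \<open>sqrt p\<close> and the constant 3.\<close>
        define C where "C = 2 * c + 2 * real n * real n + 3"
        have "c > 0" using d(2) assms(1) by (simp add: c_def dft_0)
        moreover have "c * real p - C * sqrt (real p) - C \<le> GUC A" if A: "A \<in> \<A>" "codebook_len A = p" for A p
        proof -
          have "c * (real p - 2) - real n * (real n * (2 * sqrt (real p))) - 3 \<le> GUC A"
            using lower_unbalanced[OF A(1) d(1)] unfolding c_def A(2) .
          moreover have "real n * (real n * (2 * sqrt (real p))) \<le> C * sqrt (real p)"
            using \<open>c > 0\<close> by (simp add: C_def algebra_simps)
          moreover have "2 * c + 3 \<le> C" by (simp add: C_def)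
          ultimately show ?thesis by (simp add: algebra_simps)
        qed
        ultimately show False by (rule no_linear)
      qed
      show "plan_orthogonal n D"
        unfolding plan_orthogonal_def
      proof (intro ballI impI, rule ccontr)
        fix d d' assume d: "d \<in> D" "d' \<in> D" "d \<noteq> d'" "(\<Sum>k<n. d k * cnj (d' k)) \<noteq> 0"
        define c where "c = cmod (dft n (ip d d') 0) / 2"
        define C where "C = c + real n + 1"
        have "c > 0" using d(4) assms(1) by (simp add: c_def dft_0 ip_def)
        moreover have "c * real p - C * sqrt (real p) - C \<le> GUC A" if A: "A \<in> \<A>" "codebook_len A = p" for A p
        proof -
          have "(2 * c * (real p - 1) - real n * sqrt (real p) - 2) / 2 \<le> GUC A"
            using lower_nonorthogonal[OF A(1) d(1-3)] unfolding c_def A(2) by simp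
          moreover have "real n * sqrt (real p) / 2 \<le> C * sqrt (real p)"
            using \<open>c > 0\<close> by (simp add: C_def algebra_simps)
          moreover have "c + 1 \<le> C" by (simp add: C_def)
          ultimately show ?thesis by (simp add: algebra_simps)
        qed
        ultimately show False by (rule no_linear)
      qed
    qed
  qed
qed

end
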